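(* Let $h\ge 0$ and let $K:\mathbb{R}\to\mathbb{R}$ satisfy $K\ge 0$, $\int_{\mathbb{R}}K(s)e^{\lambda s}ds<\infty$ for all $\lambda\in\mathbb{R}$, and $\int_{\mathbb{R}}K(s)ds=1$. Let $g\in C(\mathbb{R}_+,\mathbb{R}_+)$ have only one local extremum on $(0,\infty)$, a maximum at $s=s_M$, with $g(0)=0$ and $g(s)>0$ for $s>0$; suppose that $0$ and $\kappa>0$ are the only two solutions of $g(s)=s$, and that $g$ is differentiable at $0$ with $g'(0)>1$. Let $0<\zeta_1<\zeta_2$ be such that $g([\zeta_1,\zeta_2])\subseteq[\zeta_1,\zeta_2]$, $g([0,\zeta_1])\subseteq[0,\zeta_2]$, $\min_{s\in[\zeta_1,\zeta_2]}g(s)=g(\zeta_1)$, and $g(s)>s$ for $s\in(0,\zeta_1]$. Suppose further that $g$ is $C^3$ on $[\zeta_1,\zeta_2]$, that its Schwarzian derivative satisfies $(Sg)(s)<0$ for all $s\in[\zeta_1,\zeta_2]\setminus\{s_M\}$, and that $g(g(\zeta_2))\ge\kappa$. If, for some $\epsilon>0$, $$\Big(1-\min\Big\{e^{-h},\ \int_{-h/\sqrt{\epsilon}}^{0}K(u)\,du\Big\}\Big)g'(\kappa)\ge-1,$$ then the equation $$u_t(t,x)=u_{xx}(t,x)-u(t,x)+\int_{\mathbb{R}}K(x-y)g(u(t-h,y))\,dy$$ has a wavefront $u(t,x)=\phi(x+ct)$ for every $c\ge\max\{\tilde c_*,1/\sqrt{\epsilon}\}$, where $\tilde c_*:=\big(\epsilon_0(h,\sup_{s>0}g(s)/s,1)\big)^{-1/2}$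 with $\epsilon_0$ as defined in the context. Moreover, for these values of $c$, each semi-wavefront $u(t,x)=\phi(x+ct)$ of this equation is in fact a wavefront.
   Context: Definition of $\epsilon_0$: for $h\ge0$, $p>q>0$ put $$\psi(z,\epsilon)=\epsilon z^2-z-q+p\,e^{-zh}\int_{\mathbb{R}}K(s)e^{-\sqrt{\epsilon}\,zs}ds .$$ There are uniquely determined extended positive numbers $0<\epsilon_0\le\epsilon_1\le+\infty$, $\epsilon_i=\epsilon_i(h,p,q)$ (depending also on $K$), such that: for $\epsilon\in(0,\epsilon_0)$ the equation $\psi(z,\epsilon)=0$ has exactly two real roots $z$, both positive; for $\epsilon\in(\epsilon_0,\epsilon_1)$, $\psi(z,\epsilon)>0$ for all $z\in\mathbb{R}$; for $\epsilon\in(\epsilon_1,\infty)$ the equation $\psi(z,\epsilon)=0$ has exactly two real roots, both negative. Moreover $\epsilon_0=\epsilon_1$ if and only if both are $+\infty$. Convention: $(+\infty)^{-1/2}=0$. The Schwarzian derivative is $(Sg)(s)=g'''(s)/g'(s)-\tfrac32\big(g''(s)/g'(s)\big)^2$ (in particular $g'(s)\ne0$ where it is considered). A semi-wavefront is a bounded positive classical solution $u(t,x)=\phi(x+ct)$ with $\phi(-\infty)=0$; it is a wavefront if moreover $\phi(+\infty)=\kappa$. $\mathbb{R}_+=[0,\infty)$. *)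

theory Defs
  imports "HOL-Analysis.Analysis"
begin

text \<open>Integrals over the real line are taken with respect to Lebesgue measure, so kernels are only
  required to be Lebesgue measurable.\<close>

definition psi :: "(real \<Rightarrow> real) \<Rightarrow> real \<Rightarrow> real \<Rightarrow> real \<Rightarrow> real \<Rightarrow> real \<Rightarrow> real" where
  "psi K h p q z \<epsilon> =
     \<epsilon> * z\<^sup>2 - z - q + p * exp (- z * h) * (\<integral>s. K s * exp (- sqrt \<epsilon> * z * s) \<partial>lebesgue)"

definition critical_eps ::
  "(real \<Rightarrow> real) \<Rightarrow> real \<Rightarrow> real \<Rightarrow> real \<Rightarrow> ereal \<Rightarrow> ereal \<Rightarrow> bool" where
  "critical_eps K h p q e0 e1 \<longleftrightarrow>
     0 < e0 \<and> e0 \<le> e1 \<and>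
     (\<forall>\<epsilon>::real. 0 < \<epsilon> \<and> ereal \<epsilon> < e0 \<longrightarrow>
        card {z. psi K h p q z \<epsilon> = 0} = 2 \<and> (\<forall>z. psi K h p q z \<epsilon> = 0 \<longrightarrow> z > 0)) \<and>
     (\<forall>\<epsilon>::real. e0 < ereal \<epsilon> \<and> ereal \<epsilon> < e1 \<longrightarrow> (\<forall>z. psi K h p q z \<epsilon> > 0)) \<and>
     (\<forall>\<epsilon>::real. e1 < ereal \<epsilon> \<longrightarrow>
        card {z. psi K h p q z \<epsilon> = 0} = 2 \<and> (\<forall>z. psi K h p q z \<epsilon> = 0 \<longrightarrow> z < 0)) \<and>
     (e0 = e1 \<longleftrightarrow> e0 = \<infinity> \<and> e1 = \<infinity>)"

definition eps0 :: "(real \<Rightarrow> real) \<Rightarrow> real \<Rightarrow> real \<Rightarrow> real \<Rightarrow> ereal" where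
  "eps0 K h p q = (THE e0. \<exists>e1. critical_eps K h p q e0 e1)"

text \<open>The speed \<open>\<epsilon>\<^sub>0 powr (-1/2)\<close>, with value \<open>0\<close> for \<open>\<epsilon>\<^sub>0 = \<infinity>\<close>. For the nonlinearities
  considered, the supremum is that of a set bounded above.\<close>

definition c_star :: "(real \<Rightarrow> real) \<Rightarrow> real \<Rightarrow> (real \<Rightarrow> real) \<Rightarrow> real" where
  "c_star K h g =
     (let e = eps0 K h (SUP s\<in>{0<..}. g s / s) 1
      in if e = \<infinity> then 0 else real_of_ereal e powr (- 1 / 2))"

definition local_max_at :: "(real \<Rightarrow> real) \<Rightarrow> real \<Rightarrow> bool" where
  "local_max_at g s \<longleftrightarrow> (\<forall>\<^sub>F r in nhds s. g r \<le> g s)"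

definition local_min_at :: "(real \<Rightarrow> real) \<Rightarrow> real \<Rightarrow> bool" where
  "local_min_at g s \<longleftrightarrow> (\<forall>\<^sub>F r in nhds s. g s \<le> g r)"

text \<open>Derivatives relative to a set, so that they are one-sided at the endpoints of a compact
  interval and do not depend on the function outside it.\<close>

definition deriv_on :: "real set \<Rightarrow> (real \<Rightarrow> real) \<Rightarrow> real \<Rightarrow> real" where
  "deriv_on S f = (\<lambda>x. vector_derivative f (at x within S))"

definition Ck_on :: "nat \<Rightarrow> real set \<Rightarrow> (real \<Rightarrow> real) \<Rightarrow> bool" where
  "Ck_on k S f \<longleftrightarrow>
     (\<forall>j<k. \<forall>x\<in>S. ((deriv_on S ^^ j) f has_real_derivative (deriv_on S ^^ Suc j) f x) (at x within S)) \<and>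
     continuous_on S ((deriv_on S ^^ k) f)"

definition schwarzian_on :: "real set \<Rightarrow> (real \<Rightarrow> real) \<Rightarrow> real \<Rightarrow> real" where
  "schwarzian_on S g s =
     (deriv_on S ^^ 3) g s / deriv_on S g s - 3 / 2 * ((deriv_on S ^^ 2) g s / deriv_on S g s)\<^sup>2"

definition classical_solution ::
  "real \<Rightarrow> (real \<Rightarrow> real) \<Rightarrow> (real \<Rightarrow> real) \<Rightarrow> (real \<Rightarrow> real \<Rightarrow> real) \<Rightarrow> bool" where
  "classical_solution h K g u \<longleftrightarrow>
     (\<exists>ut ux uxx.
        continuous_on UNIV (\<lambda>(t, x). ut t x) \<and>
        continuous_on UNIV (\<lambda>(t, x). ux t x) \<and>
        continuous_on UNIV (\<lambda>(t, x). uxx t x) \<and>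
        (\<forall>t x. ((\<lambda>r. u r x) has_real_derivative ut t x) (at t) \<and>
               ((\<lambda>y. u t y) has_real_derivative ux t x) (at x) \<and>
               ((\<lambda>y. ux t y) has_real_derivative uxx t x) (at x) \<and>
               integrable lebesgue (\<lambda>y. K (x - y) * g (u (t - h) y)) \<and>
               ut t x = uxx t x - u t x + (\<integral>y. K (x - y) * g (u (t - h) y) \<partial>lebesgue)))"

definition semi_wavefront ::
  "real \<Rightarrow> (real \<Rightarrow> real) \<Rightarrow> (real \<Rightarrow> real) \<Rightarrow> real \<Rightarrow> (real \<Rightarrow> real) \<Rightarrow> bool" where
  "semi_wavefront h K g c \<phi> \<longleftrightarrow>
     classical_solution h K g (\<lambda>t x. \<phi> (x + c * t)) \<and>
     bounded (range \<phi>) \<and> (\<forall>s. \<phi> s > 0) \<and> (\<phi> \<longlongrightarrow> 0) at_bot"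

definition wavefront ::
  "real \<Rightarrow> (real \<Rightarrow> real) \<Rightarrow> (real \<Rightarrow> real) \<Rightarrow> real \<Rightarrow> real \<Rightarrow> (real \<Rightarrow> real) \<Rightarrow> bool" where
  "wavefront h K g \<kappa> c \<phi> \<longleftrightarrow> semi_wavefront h K g c \<phi> \<and> (\<phi> \<longlongrightarrow> \<kappa>) at_top"

end

theory Submission
  imports Defs "HOL-Complex_Analysis.Great_Picard" "HOL-Probability.Probability" "HOL-Real_Asymp.Real_Asymp"
begin

text \<open>A profile satisfies \<open>\<phi>'' - c * \<phi>' - \<phi> + G = 0\<close>, where \<open>G t\<close> averages \<open>g (\<phi> (t + r))\<close> over \<open>r\<close>; it is
  the convolution of \<open>G\<close> with a positive Green's function and therefore satisfies a Harnack inequality.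
  Where a profile is small it grows exponentially, at a rate uniform over all profiles: otherwise a rescaled
  limit would be a positive solution of the linearisation at \<open>0\<close> with a nonpositive exponent, which the
  characteristic function does not allow. This gives persistence at \<open>+\<infinity>\<close>, and it also shows that a limit of
  solutions of slightly forced problems, normalised to be small on a half line, decays at \<open>-\<infinity>\<close>; the forced
  problems are solved by a fixed point argument. Let \<open>m\<close> and \<open>M\<close> be the lower and upper limits of a profile
  at \<open>+\<infinity>\<close>, with \<open>\<xi>\<close> the minimum in the slope condition. If \<open>m < \<kappa> < M\<close>, the equation at an extremum of a
  limiting profile produces \<open>x < \<kappa> < M\<close> which the map \<open>(1 - \<xi>) * g + \<xi> * \<kappa>\<close> sends beyond each other, and
  this contradicts the negative Schwarzian derivative together with the slope condition at \<open>\<kappa>\<close>.\<close>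

text \<open>The hypothesis on the speed enters in two ways. If the parameter of \<open>psi\<close>
  is \<open>1 / c\<^sup>2\<close>, the substitution \<open>z = c * x\<close> turns
  \<open>psi\<close> into \<open>x\<^sup>2 - c * x - 1 + p * J (c * h) 1 x\<close>, so
  \<open>c \<ge> c_star\<close> supplies an exponent \<open>w > 0\<close> at which this is
  nonpositive. It serves two purposes: \<open>exp (w * t)\<close> is a supersolution for the slope
  \<open>p\<close>, the supremum of \<open>g s / s\<close>; and by convexity, with the value
  \<open>g0 - 1 > 0\<close> at 0, the characteristic function for the smaller slope
  \<open>g0\<close> is positive on the whole half line \<open>z \<le> 0\<close>. The bound
  \<open>c \<ge> 1 / sqrt \<epsilon>\<close> makes the delay window \<open>{- (c * h)..0}\<close>
  wide enough to have mass at least \<xi>. The obstacle to existence is a lower bound. Mere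
  differentiability at 0, a slope \<open>p\<close> possibly larger than \<open>g0\<close>, and the
  critical speed itself leave no basis for the usual explicit subsolution. Nontriviality therefore
  comes from the forcing, and decay at minus infinity from the growth estimate, which is why that
  estimate must be uniform over all forced problems with \<theta> near 1.\<close>

section \<open>A fixed point theorem and a compactness principle\<close>

text \<open>Kuhn's combinatorial lemma in dimension \<open>n\<close> with mesh \<open>1 / n\<close>, followed by a diagonal
  subsequence.\<close>

lemma hilbert_cube_fixed_point:
  fixes F :: "(nat \<Rightarrow> real) \<Rightarrow> nat \<Rightarrow> real"
  assumes F01: "\<And>x i. (\<And>j. x j \<in> {0..1}) \<Longrightarrow> F x i \<in> {0..1}"
    and cont: "\<And>X x i. (\<And>n j. X n j \<in> {0..1}) \<Longrightarrow> (\<And>j. (\<lambda>n. X n j) \<longlonglongrightarrow> x j) \<Longrightarrow>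
                 (\<lambda>n. F (X n) i) \<longlonglongrightarrow> F x i"
  obtains x where "\<And>j. x j \<in> {0..1}" "F x = x"
proof -
  define cut where "cut n z = (\<lambda>j. if j < n then min 1 (real (z j) / real n) else 0)" for n and z :: "nat \<Rightarrow> nat"
  \<comment> \<open>Label 0 means that \<open>F\<close> does not push coordinate \<open>i\<close>
    down, label 1 that it does not push it up. The first two cases force the boundary labels which
    Kuhn's lemma demands; they agree with this reading because \<open>F\<close> has values in the
    unit interval.\<close>
  define lab where "lab n z i =
      (if z i = 0 then 0 else if z i = n then 1 else if cut n z i \<le> F (cut n z) i then 0 else (1::nat))" for n z i
  have cut01: "cut n z j \<in> {0..1}" for n z j
    by (auto simp: cut_def)
  have lab0: "cut n z i \<le> F (cut n z) i" if "i < n" "lab n z i = 0" "z i \<le> n" for n z i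
    using that F01[of "cut n z" i] cut01[of n z] by (auto simp: lab_def cut_def split: if_splits)
  have lab1: "F (cut n z) i \<le> cut n z i" if "i < n" "lab n z i = 1" "z i \<le> n" for n z i
    using that F01[of "cut n z" i] cut01[of n z] by (auto simp: lab_def cut_def split: if_splits)
  have "\<exists>q. (\<forall>i<n. q i < n) \<and> (\<forall>i<n. \<exists>r s. (\<forall>j<n. q j \<le> r j \<and> r j \<le> q j + 1) \<and>
           (\<forall>j<n. q j \<le> s j \<and> s j \<le> q j + 1) \<and> lab n r i = 0 \<and> lab n s i = 1)" if "0 < n" for n
  proof -
    have *: "lab n x i = 0 \<or> lab n x i = 1" for x i by (auto simp: lab_def)
    obtain q where q: "\<forall>i<n. q i < n" "\<forall>i<n. \<exists>r s. (\<forall>j<n. q j \<le> r j \<and> r j \<le> q j + 1) \<and>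
           (\<forall>j<n. q j \<le> s j \<and> s j \<le> q j + 1) \<and> lab n r i \<noteq> lab n s i"
      by (rule kuhn_lemma[of n n "lab n"]) (use \<open>0 < n\<close> in \<open>auto simp: lab_def\<close>)
    show ?thesis
    proof (rule exI[of _ q], intro conjI allI impI)
      fix i assume "i < n"
      then obtain r s where rs: "\<forall>j<n. q j \<le> r j \<and> r j \<le> q j + 1"
           "\<forall>j<n. q j \<le> s j \<and> s j \<le> q j + 1" "lab n r i \<noteq> lab n s i"
        using q(2) by blast
      show "\<exists>r s. (\<forall>j<n. q j \<le> r j \<and> r j \<le> q j + 1) \<and>
           (\<forall>j<n. q j \<le> s j \<and> s j \<le> q j + 1) \<and> lab n r i = 0 \<and> lab n s i = 1"
      proof (cases "lab n r i = 0")
        case True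
        with rs *[of s i] show ?thesis by (intro exI[of _ r] exI[of _ s]) auto
      next
        case False
        with rs *[of s i] *[of r i] show ?thesis by (intro exI[of _ s] exI[of _ r]) auto
      qed
    qed (use q in auto)
  qed
  then have "\<forall>n. \<exists>q. 0 < n \<longrightarrow> (\<forall>i<n. q i < n) \<and> (\<forall>i<n. \<exists>r s. (\<forall>j<n. q j \<le> r j \<and> r j \<le> q j + 1) \<and>
           (\<forall>j<n. q j \<le> s j \<and> s j \<le> q j + 1) \<and> lab n r i = 0 \<and> lab n s i = 1)" by blast
  then obtain q where q0: "\<forall>n. 0 < n \<longrightarrow> (\<forall>i<n. q n i < n) \<and> (\<forall>i<n. \<exists>r s. (\<forall>j<n. q n j \<le> r j \<and> r j \<le> q n j + 1) \<and>
           (\<forall>j<n. q n j \<le> s j \<and> s j \<le> q n j + 1) \<and> lab n r i = 0 \<and> lab n s i = 1)"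
    by (rule choice[THEN exE])
  have q: "q n i < n" if "i < n" for n i using q0 that by auto
  have "\<exists>r s. i < n \<longrightarrow> (\<forall>j<n. q n j \<le> r j \<and> r j \<le> q n j + 1) \<and>
           (\<forall>j<n. q n j \<le> s j \<and> s j \<le> q n j + 1) \<and> lab n r i = 0 \<and> lab n s i = 1" for n i
    using q0[rule_format, of n] by (cases "i < n") auto
  then have "\<forall>n i. \<exists>r s. i < n \<longrightarrow> (\<forall>j<n. q n j \<le> r j \<and> r j \<le> q n j + 1) \<and>
           (\<forall>j<n. q n j \<le> s j \<and> s j \<le> q n j + 1) \<and> lab n r i = 0 \<and> lab n s i = 1" by blast
  then obtain r s where rs: "\<forall>n i. i < n \<longrightarrow> (\<forall>j<n. q n j \<le> r n i j \<and> r n i j \<le> q n j + 1) \<and>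
           (\<forall>j<n. q n j \<le> s n i j \<and> s n i j \<le> q n j + 1) \<and> lab n (r n i) i = 0 \<and> lab n (s n i) i = 1"
    unfolding choice_iff by blast
  have r: "q n j \<le> r n i j \<and> r n i j \<le> q n j + 1" and s: "q n j \<le> s n i j \<and> s n i j \<le> q n j + 1"
    and lr: "lab n (r n i) i = 0" and ls: "lab n (s n i) i = 1" if "i < n" "j < n" for n i j
    using rs that by blast+
  obtain k where k: "strict_mono (k::nat\<Rightarrow>nat)" "\<And>j. j \<in> UNIV \<Longrightarrow> \<exists>l. (\<lambda>n. cut (k n) (q (k n)) j) \<longlonglongrightarrow> l"
    by (rule function_convergent_subsequence[of UNIV "\<lambda>n. cut n (q n)" 1])
       (auto simp: cut_def)
  have "\<forall>j. \<exists>l. (\<lambda>n. cut (k n) (q (k n)) j) \<longlonglongrightarrow> l" using k(2) by simp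
  then obtain x where x: "\<And>j. (\<lambda>n. cut (k n) (q (k n)) j) \<longlonglongrightarrow> x j" unfolding choice_iff by blast
  have x01: "x j \<in> {0..1}" for j
    by (rule closed_sequentially[OF closed_atLeastAtMost _ x]) (rule cut01)
  \<comment> \<open>All vertices of the chosen cells share one coordinatewise limit, since the mesh
    is \<open>1 / n\<close>. The index \<open>i\<close> is carried along because the vertices for
    direction \<open>i\<close> exist only once \<open>i < n\<close>.\<close>
  have near: "(\<lambda>n. cut (k n) (z (k n)) j) \<longlonglongrightarrow> x j"
    if z: "\<And>n. j < n \<Longrightarrow> i < n \<Longrightarrow> q n j \<le> z n j \<and> z n j \<le> q n j + 1" for z j and i :: nat
  proof -
    have 1: "\<bar>cut n (z n) j - cut n (q n) j\<bar> \<le> 1 / real n" if "i + j < n" for n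
    proof -
      have "real (q n j) / real n \<le> real (z n j) / real n" "real (z n j) / real n \<le> real (q n j) / real n + 1 / real n"
        using z[of n] that by (auto simp: divide_right_mono simp flip: add_divide_distrib)
      then show ?thesis using that by (auto simp: cut_def)
    qed
    have "(\<lambda>n. cut (k n) (z (k n)) j - cut (k n) (q (k n)) j) \<longlonglongrightarrow> 0"
    proof (rule Lim_null_comparison)
      show "\<forall>\<^sub>F n in sequentially. norm (cut (k n) (z (k n)) j - cut (k n) (q (k n)) j) \<le> 1 / real (k n)"
        using eventually_gt_at_top[of "i+j"]
      proof eventually_elim
        case (elim n)
        then have "i + j < k n" using seq_suble[OF k(1), of n] by linarith
        then show ?case using 1 by simp
      qed
      show "(\<lambda>n. 1 / real (k n)) \<longlonglongrightarrow> 0"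
        using LIMSEQ_subseq_LIMSEQ[OF lim_1_over_n k(1)] by (simp add: o_def)
    qed
    from tendsto_add[OF this x[of j]] show ?thesis by simp
  qed
  have "F x i = x i" for i
  proof (rule antisym)
    have ev: "\<forall>\<^sub>F n in sequentially. i < k n"
      using eventually_gt_at_top[of i] 
      by eventually_elim (meson seq_suble[OF k(1)] order_less_le_trans)
    have ub: "r n i i \<le> n" "s n i i \<le> n" if "i < n" for n
      using r[OF that that] s[OF that that] q[OF that] by linarith+
    have R: "(\<lambda>n. cut (k n) (r (k n) i) j) \<longlonglongrightarrow> x j" for j
      by (rule near[where i=i]) (use r in auto)
    have S: "(\<lambda>n. cut (k n) (s (k n) i) j) \<longlonglongrightarrow> x j" for j
      by (rule near[where i=i]) (use s in auto)
    have "(\<lambda>n. F (cut (k n) (r (k n) i)) i) \<longlonglongrightarrow> F x i"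
      by (rule cont[OF cut01 R])
    moreover have "\<forall>\<^sub>F n in sequentially. cut (k n) (r (k n) i) i \<le> F (cut (k n) (r (k n) i)) i"
      using ev by eventually_elim (simp add: lab0 lr[of i _ i] ub)
    ultimately show "x i \<le> F x i" by (intro tendsto_le[OF trivial_limit_sequentially _ R])
    have "(\<lambda>n. F (cut (k n) (s (k n) i)) i) \<longlonglongrightarrow> F x i"
      by (rule cont[OF cut01 S])
    moreover have "\<forall>\<^sub>F n in sequentially. F (cut (k n) (s (k n) i)) i \<le> cut (k n) (s (k n) i) i"
      using ev by eventually_elim (simp add: lab1 ls[of i _ i] ub)
    ultimately show "F x i \<le> x i" by (intro tendsto_le[OF trivial_limit_sequentially S])
  qed
  then show thesis using that x01 by blast
qed

text \<open>Arzela-Ascoli with a pointwise bound: a diagonal subsequence on the rationals, extended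
  by equicontinuity. Pointwise convergence is all that is recorded, since limits of the equation are
  taken by dominated convergence.\<close>

lemma equicontinuous_convergent_subsequence:
  fixes F :: "nat \<Rightarrow> real \<Rightarrow> real"
  assumes bd: "\<And>n t. \<bar>F n t\<bar> \<le> \<beta> t"
    and eqc: "\<And>t e. 0 < e \<Longrightarrow> \<exists>d>0. \<forall>n s. \<bar>s - t\<bar> < d \<longrightarrow> \<bar>F n s - F n t\<bar> < e"
  obtains k f where "strict_mono (k :: nat \<Rightarrow> nat)" "\<And>t. (\<lambda>n. F (k n) t) \<longlonglongrightarrow> f t" "continuous_on UNIV f"
proof -
  have pos: "0 < 1 + \<beta> t" for t using bd[of 0 t] by linarith
  \<comment> \<open>Dividing by \<open>1 + \<beta> t\<close> provides the single bound for all
    points which the diagonal argument expects.\<close>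
  have "norm (F n t / (1 + \<beta> t)) \<le> 1" for n t
    using bd[of n t] pos[of t] by (auto simp: abs_divide divide_simps)
  then obtain k where k: "strict_mono (k::nat\<Rightarrow>nat)"
      "\<And>t. t \<in> \<rat> \<Longrightarrow> \<exists>l. (\<lambda>n. F (k n) t / (1 + \<beta> t)) \<longlonglongrightarrow> l"
    using function_convergent_subsequence[of "\<rat> :: real set" "\<lambda>n t. F n t / (1 + \<beta> t)" 1, OF countable_rat]
    by blast
  have conv: "convergent (\<lambda>n. F (k n) t)" if t: "t \<in> \<rat>" for t
  proof -
    obtain l where l: "(\<lambda>n. F (k n) t / (1 + \<beta> t)) \<longlonglongrightarrow> l" using k(2)[OF t] by blast
    from tendsto_mult_right[OF l, of "1 + \<beta> t"] pos[of t] show ?thesis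
      by (auto simp: convergent_def)
  qed
  have "Cauchy (\<lambda>n. F (k n) t)" for t
  proof (rule metric_CauchyI)
    fix e :: real assume "0 < e"
    then obtain d where d: "d > 0" "\<And>n s. \<bar>s - t\<bar> < d \<Longrightarrow> \<bar>F n s - F n t\<bar> < e/3"
      using eqc[of "e/3" t] by auto
    obtain q where q: "q \<in> \<rat>" "t < q" "q < t + d" using Rats_dense_in_real[of t "t+d"] d(1) by auto
    have "Cauchy (\<lambda>n. F (k n) q)" using conv[OF q(1)] by (simp add: Cauchy_convergent_iff)
    from metric_CauchyD[OF this, of "e/3"] \<open>0 < e\<close>
    obtain N where N: "\<And>m n. m \<ge> N \<Longrightarrow> n \<ge> N \<Longrightarrow> \<bar>F (k m) q - F (k n) q\<bar> < e/3"
      by (auto simp: dist_real_def)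
    have "\<bar>F (k m) t - F (k n) t\<bar> < e" if "m \<ge> N" "n \<ge> N" for m n
      using N[OF that] d(2)[of q "k m"] d(2)[of q "k n"] q by linarith
    then show "\<exists>M. \<forall>m\<ge>M. \<forall>n\<ge>M. dist (F (k m) t) (F (k n) t) < e"
      by (auto simp: dist_real_def)
  qed
  then obtain f where f: "\<And>t. (\<lambda>n. F (k n) t) \<longlonglongrightarrow> f t"
    unfolding Cauchy_convergent_iff convergent_def choice_iff[symmetric] by metis
  have "isCont f t" for t
    unfolding continuous_at_eps_delta
  proof (intro allI impI)
    fix e :: real assume "0 < e"
    then obtain d where d: "d > 0" "\<And>n s. \<bar>s - t\<bar> < d \<Longrightarrow> \<bar>F n s - F n t\<bar> < e/2"
      using eqc[of "e/2" t] by auto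
    have "\<bar>f s - f t\<bar> < e" if "\<bar>s - t\<bar> < d" for s
    proof -
      have "(\<lambda>n. \<bar>F (k n) s - F (k n) t\<bar>) \<longlonglongrightarrow> \<bar>f s - f t\<bar>" by (intro tendsto_intros f)
      then have "\<bar>f s - f t\<bar> \<le> e/2"
        by (rule tendsto_upperbound[OF _ always_eventually trivial_limit_sequentially])
           (intro allI less_imp_le d(2)[OF that])
      then show ?thesis using \<open>0 < e\<close> by linarith
    qed
    then show "\<exists>d>0. \<forall>s. dist s t < d \<longrightarrow> dist (f s) (f t) < e"
      using d(1) by (auto simp: dist_real_def)
  qed
  then show thesis using that[OF k(1) f] by (simp add: continuous_on_eq_continuous_at)
qed

section \<open>Green's function of the linear part\<close>

text \<open>The two roots of \<open>z\<^sup>2 - c * z - a\<close>; the resolvent solves \<open>\<phi>'' - c * \<phi>' - a * \<phi> = - H\<close>.\<close>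

definition lam :: "real \<Rightarrow> real \<Rightarrow> real" where "lam c a = (c - sqrt (c\<^sup>2 + 4 * a)) / 2"
definition mu :: "real \<Rightarrow> real \<Rightarrow> real" where "mu c a = (c + sqrt (c\<^sup>2 + 4 * a)) / 2"

text \<open>The argument is the offset of the integration point from the point of evaluation, so
  positive \<open>u\<close> look ahead and are weighted through the positive root. At 0 the branches
  meet and the derivative jumps by -1.\<close>

definition green :: "real \<Rightarrow> real \<Rightarrow> real \<Rightarrow> real" where
  "green c a u = (if 0 \<le> u then exp (- mu c a * u) else exp (- lam c a * u)) / (mu c a - lam c a)"

definition resolv :: "real \<Rightarrow> real \<Rightarrow> (real \<Rightarrow> real) \<Rightarrow> real \<Rightarrow> real" where
  "resolv c a H t = (\<integral>u. green c a u * H (t + u) \<partial>lborel)"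

lemma lam_plus_mu: "lam c a + mu c a = c"
  by (simp add: lam_def mu_def field_simps)

lemma lam_neg: "0 < a \<Longrightarrow> lam c a < 0"
  unfolding lam_def using real_less_rsqrt[of c "c\<^sup>2 + 4 * a"] by auto

lemma mu_pos: "0 < a \<Longrightarrow> 0 < mu c a"
  unfolding mu_def using real_less_rsqrt[of "-c" "c\<^sup>2 + 4 * a"] by auto

lemma lam_mult_mu: "0 < a \<Longrightarrow> lam c a * mu c a = - a"
  unfolding lam_def mu_def by (simp add: algebra_simps power2_eq_square)

lemma char_factor:
  assumes "0 < a" shows "a + c * z - z\<^sup>2 = (mu c a - z) * (z - lam c a)"
proof -
  have "c * z = lam c a * z + mu c a * z" by (metis lam_plus_mu distrib_right)
  then show ?thesis using lam_mult_mu[OF assms, of c] by (simp add: algebra_simps power2_eq_square)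
qed

lemma char_pos_iff:
  assumes "0 < a" shows "0 < a + c * z - z\<^sup>2 \<longleftrightarrow> lam c a < z \<and> z < mu c a"
  using lam_neg[OF assms, of c] mu_pos[OF assms, of c]
  by (auto simp: char_factor[OF assms] zero_less_mult_iff)

lemma lam_less: "0 < a \<Longrightarrow> a < b \<Longrightarrow> lam c b < lam c a" and mu_less: "0 < a \<Longrightarrow> a < b \<Longrightarrow> mu c a < mu c b"
  by (auto simp: lam_def mu_def)

section \<open>Laplace transform of the Green's function\<close>

lemma has_bochner_integral_exp_atLeast:
  fixes s :: real assumes "0 < s"
  shows "has_bochner_integral lborel (\<lambda>u. indicator {0..} u * exp (- s * u)) (1 / s)"
proof (rule has_bochner_integral_nn_integral)
  have "(\<integral>\<^sup>+ u. ennreal (exp (- s * u)) * indicator {0..} u \<partial>lborel) = ennreal (0 - (- exp (- s * 0) / s))"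
  proof (rule nn_integral_FTC_atLeast)
    show "((\<lambda>u. - exp (- s * u) / s) \<longlongrightarrow> 0) at_top" using assms by real_asymp
    show "((\<lambda>u. - exp (- s * u) / s) has_real_derivative exp (- s * x)) (at x)" for x
      using assms by (auto intro!: derivative_eq_intros)
  qed auto
  then show "(\<integral>\<^sup>+ u. ennreal (indicator {0..} u * exp (- s * u)) \<partial>lborel) = ennreal (1 / s)"
    by (simp add: indicator_mult_ennreal mult.commute)
qed (use assms in auto)

lemma has_bochner_integral_exp_lessThan:
  fixes s :: real assumes "0 < s"
  shows "has_bochner_integral lborel (\<lambda>u. indicator {..<0} u * exp (s * u)) (1 / s)"
proof -
  have 1: "has_bochner_integral lborel (\<lambda>u. indicator {0..} (0 + (-1) * u) * exp (- s * (0 + (-1) * u))) (1 / s)"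
    using has_bochner_integral_exp_atLeast[OF assms]
    by (subst (asm) lborel_has_bochner_integral_real_affine_iff[of "-1" _ _ 0]) simp_all
  show ?thesis
  proof (rule has_bochner_integral_cong_AE[THEN iffD1, OF _ _ _ 1])
    show "AE x in lborel. indicator {0..} (0 + - 1 * x) * exp (- s * (0 + - 1 * x)) = indicator {..<0} x * exp (s * x)"
      using AE_lborel_singleton[of 0] by eventually_elim (auto simp: indicator_def)
  qed auto
qed

lemma green_alt: "green c a u = (indicator {0..} u * exp (- mu c a * u) + indicator {..<0} u * exp (- lam c a * u)) / (mu c a - lam c a)"
  by (auto simp: green_def indicator_def)

lemma measurable_green [measurable]: "green c a \<in> borel_measurable borel"
  unfolding green_alt[abs_def] by measurable

lemma green_pos: "0 < a \<Longrightarrow> 0 < green c a u"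
  using lam_neg[of a c] mu_pos[of a c] by (auto simp: green_def)

text \<open>Exponentials with exponent strictly between the two roots are eigenfunctions of the
  resolvent, with the reciprocal of the characteristic polynomial as eigenvalue. This is how the
  characteristic inequalities enter the comparison arguments.\<close>

lemma has_bochner_integral_green_exp:
  assumes a: "0 < a" and z: "lam c a < z" "z < mu c a"
  shows "has_bochner_integral lborel (\<lambda>u. green c a u * exp (z * u)) (1 / (a + c * z - z\<^sup>2))"
proof -
  have "has_bochner_integral lborel (\<lambda>u. (indicator {0..} u * exp (- (mu c a - z) * u)
      + indicator {..<0} u * exp ((z - lam c a) * u)) / (mu c a - lam c a))
      ((1 / (mu c a - z) + 1 / (z - lam c a)) / (mu c a - lam c a))"
    using z by (intro has_bochner_integral_divide_zero has_bochner_integral_add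
        has_bochner_integral_exp_atLeast has_bochner_integral_exp_lessThan) auto
  also have "(\<lambda>u. (indicator {0..} u * exp (- (mu c a - z) * u)
      + indicator {..<0} u * exp ((z - lam c a) * u)) / (mu c a - lam c a)) = (\<lambda>u. green c a u * exp (z * u))"
    by (auto simp: green_def indicator_def fun_eq_iff algebra_simps simp flip: exp_add)
  also have "(1 / (mu c a - z) + 1 / (z - lam c a)) / (mu c a - lam c a) = 1 / (a + c * z - z\<^sup>2)"
    using z by (auto simp: char_factor[OF a] divide_simps)
  finally show ?thesis .
qed

lemma integrable_green_exp:
  "0 < a \<Longrightarrow> lam c a < z \<Longrightarrow> z < mu c a \<Longrightarrow> integrable lborel (\<lambda>u. green c a u * exp (z * u))"
  using has_bochner_integral_green_exp by (auto simp: has_bochner_integral_iff)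

lemma has_bochner_integral_green:
  assumes "0 < a" shows "has_bochner_integral lborel (green c a) (1 / a)"
  using has_bochner_integral_green_exp[OF assms, of c 0] lam_neg[OF assms, of c] mu_pos[OF assms, of c] by simp

lemma integrable_green_bounded:
  assumes "0 < a" and [measurable]: "H \<in> borel_measurable borel" and "\<And>t. \<bar>H t\<bar> \<le> B"
  shows "integrable lborel (\<lambda>u. green c a u * H (t + u))"
proof (rule Bochner_Integration.integrable_bound)
  show "integrable lborel (\<lambda>u. green c a u * B)"
    using has_bochner_integral_green[OF assms(1), of c] by (auto simp: has_bochner_integral_iff)
  show "AE u in lborel. norm (green c a u * H (t + u)) \<le> norm (green c a u * B)"
  proof (rule AE_I2)
    fix u show "norm (green c a u * H (t + u)) \<le> norm (green c a u * B)"
      using assms(3)[of "t+u"] green_pos[OF assms(1), of c u] by (auto simp: abs_mult intro!: mult_left_mono)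
  qed
qed measurable

lemma resolv_exp:
  assumes "0 < a" "lam c a < z" "z < mu c a"
  shows "resolv c a (\<lambda>t. k * exp (z * t)) t = k * exp (z * t) / (a + c * z - z\<^sup>2)"
proof -
  have "resolv c a (\<lambda>t. k * exp (z * t)) t = (\<integral>u. (k * exp (z * t)) * (green c a u * exp (z * u)) \<partial>lborel)"
    unfolding resolv_def by (intro Bochner_Integration.integral_cong) (auto simp: algebra_simps exp_add)
  also have "\<dots> = k * exp (z * t) / (a + c * z - z\<^sup>2)"
    using has_bochner_integral_green_exp[OF assms] by (simp add: has_bochner_integral_iff)
  finally show ?thesis .
qed

lemma resolv_const: "0 < a \<Longrightarrow> resolv c a (\<lambda>t. k) t = k / a"
  using resolv_exp[of a c 0 k t] lam_neg[of a c] mu_pos[of a c] by simp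

lemma resolv_mono:
  assumes "integrable lborel (\<lambda>u. green c a u * H (t + u))" "integrable lborel (\<lambda>u. green c a u * H' (t + u))"
    and "0 < a" "\<And>t. H t \<le> H' t"
  shows "resolv c a H t \<le> resolv c a H' t"
  unfolding resolv_def using assms green_pos[of a c]
  by (intro integral_mono) (auto intro: mult_left_mono less_imp_le)

section \<open>The resolvent as the unique bounded solution of the linear equation\<close>

lemma lborel_integral_lessThan_has_real_derivative:
  fixes f :: "real \<Rightarrow> real"
  assumes cont: "continuous_on UNIV f" and int: "\<And>b. integrable lborel (\<lambda>s. indicator {..<b} s * f s)"
  shows "((\<lambda>t. \<integral>s. indicator {..<t} s * f s \<partial>lborel) has_real_derivative f t) (at t)"
proof -
  define a where "a = t - 1"
  have seg: "integrable lborel (\<lambda>s. indicator {a..<x} s * f s)"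
      "(\<integral>s. indicator {a..<x} s * f s \<partial>lborel) = integral {a..x} f" for x
  proof -
    have 1: "set_integrable lborel {a..x} f"
      using cont by (intro borel_integrable_atLeastAtMost') (rule continuous_on_subset, auto)
    have 2: "AE s in lborel. indicator {a..x} s * f s = indicator {a..<x} s * f s"
      using AE_lborel_singleton[of x] by eventually_elim (auto simp: indicator_def)
    have [measurable]: "f \<in> borel_measurable borel" using cont by (rule borel_measurable_continuous_onI)
    show "integrable lborel (\<lambda>s. indicator {a..<x} s * f s)"
      using 1 integrable_cong_AE[OF _ _ 2] by (simp add: set_integrable_def)
    have "(\<integral>s. indicator {a..<x} s * f s \<partial>lborel) = (LINT s:{a..x}|lborel. f s)"
      using integral_cong_AE[OF _ _ 2] by (simp add: set_lebesgue_integral_def)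
    then show "(\<integral>s. indicator {a..<x} s * f s \<partial>lborel) = integral {a..x} f"
      using set_borel_integral_eq_integral(2)[OF 1] by simp
  qed
  have eq: "(\<integral>s. indicator {..<x} s * f s \<partial>lborel) = (\<integral>s. indicator {..<a} s * f s \<partial>lborel) + integral {a..x} f"
    if "x \<in> {a..t+1}" for x
  proof -
    have "(\<lambda>s. indicator {..<x} s * f s) = (\<lambda>s. indicator {..<a} s * f s + indicator {a..<x} s * f s)"
      using that by (auto simp: fun_eq_iff indicator_def)
    then show ?thesis using int[of a] seg[of x] by simp
  qed
  have "((\<lambda>x. integral {a..x} f) has_real_derivative f t) (at t within {a..t+1})"
    by (rule integral_has_real_derivative) (auto simp: a_def intro: continuous_on_subset[OF cont])
  then have "((\<lambda>x. (\<integral>s. indicator {..<a} s * f s \<partial>lborel) + integral {a..x} f) has_real_derivative f t) (at t within {a..t+1})"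
    by (auto intro!: derivative_eq_intros)
  then have "((\<lambda>t. \<integral>s. indicator {..<t} s * f s \<partial>lborel) has_real_derivative f t) (at t within {a..t+1})"
    by (rule has_field_derivative_transform_within[OF _ zero_less_one _ eq[symmetric]]) (simp_all add: a_def)
  then show ?thesis by (simp add: a_def at_within_Icc_at)
qed

lemma lborel_integral_atLeast_has_real_derivative:
  fixes f :: "real \<Rightarrow> real"
  assumes cont: "continuous_on UNIV f" and int: "\<And>b. integrable lborel (\<lambda>s. indicator {b..} s * f s)"
  shows "((\<lambda>t. \<integral>s. indicator {t..} s * f s \<partial>lborel) has_real_derivative - f t) (at t)"
proof -
  have refl: "(\<integral>s. indicator {x..} s * f s \<partial>lborel) = (\<integral>s. indicator {..<-x} s * f (-s) \<partial>lborel)" for x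
  proof -
    have "(\<integral>s. indicator {x..} s * f s \<partial>lborel) = (\<integral>s. indicator {x..} (-s) * f (-s) \<partial>lborel)"
      using lborel_integral_real_affine[of "-1" "\<lambda>s. indicator {x..} s * f s" 0] by simp
    also have "\<dots> = (\<integral>s. indicator {..<-x} s * f (-s) \<partial>lborel)"
    proof (rule integral_cong_AE)
      have [measurable]: "f \<in> borel_measurable borel" using cont by (rule borel_measurable_continuous_onI)
      show "AE s in lborel. indicator {x..} (-s) * f (-s) = indicator {..<-x} s * f (-s)"
        using AE_lborel_singleton[of "-x"] by eventually_elim (auto simp: indicator_def)
      show "(\<lambda>s. indicator {x..} (-s) * f (-s)) \<in> borel_measurable lborel" by measurable
      show "(\<lambda>s. indicator {..<-x} s * f (-s)) \<in> borel_measurable lborel" by measurable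
    qed
    finally show ?thesis .
  qed
  have int': "integrable lborel (\<lambda>s. indicator {..<b} s * f (-s))" for b
  proof -
    have *: "integrable lborel (\<lambda>s. indicator {-b..} (0 + (-1) * s) * f (0 + (-1) * s))"
      using int[of "-b"] lborel_integrable_real_affine_iff[of "-1" "\<lambda>s. indicator {-b..} s * f s" 0] by simp
    then have "integrable lborel (\<lambda>s. indicator {..<b} s * (indicator {-b..} (0 + (-1) * s) * f (0 + (-1) * s)))"
      using integrable_mult_indicator[of "{..<b}" lborel, OF _ *] by simp
    then show ?thesis by (rule Bochner_Integration.integrable_cong[THEN iffD1, rotated -1]) (auto simp: indicator_def)
  qed
  have "((\<lambda>x. \<integral>s. indicator {..<x} s * f (-s) \<partial>lborel) has_real_derivative f (- (- t))) (at (- t))"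
    by (rule lborel_integral_lessThan_has_real_derivative[OF _ int'])
       (intro continuous_on_compose2[OF cont] continuous_intros, auto)
  then have "((\<lambda>x. \<integral>s. indicator {..<- x} s * f (-s) \<partial>lborel) has_real_derivative f t * (- 1)) (at t)"
    by (intro DERIV_chain'[where f="uminus" and g="\<lambda>x. \<integral>s. indicator {..<x} s * f (-s) \<partial>lborel"])
       (auto intro!: derivative_eq_intros)
  then show ?thesis by (simp add: refl)
qed

lemma resolv_shift: "resolv c a H t = (\<integral>s. green c a (s - t) * H s \<partial>lborel)"
  using lborel_integral_real_affine[of 1 "\<lambda>s. green c a (s - t) * H s" t] by (simp add: resolv_def)

lemma integrable_green_shift:
  assumes "0 < a" "H \<in> borel_measurable borel" "\<And>t. \<bar>H t\<bar> \<le> B"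
  shows "integrable lborel (\<lambda>s. green c a (s - t) * H s)"
  using integrable_green_bounded[OF assms, of c t]
    lborel_integrable_real_affine_iff[of 1 "\<lambda>s. green c a (s - t) * H s" t] by simp

lemma abs_resolv_le:
  assumes "0 < a" "H \<in> borel_measurable borel" "\<And>t. \<bar>H t\<bar> \<le> B"
  shows "\<bar>resolv c a H t\<bar> \<le> B / a"
proof -
  have 1: "integrable lborel (\<lambda>u. green c a u * H (t + u))"
    by (rule integrable_green_bounded[OF assms])
  have 2: "integrable lborel (\<lambda>u. green c a u * k)" for k
    using has_bochner_integral_green[OF assms(1), of c] by (auto simp: has_bochner_integral_iff)
  have "resolv c a H t \<le> resolv c a (\<lambda>t. B) t"
    using assms(3) by (intro resolv_mono assms 1 2) (simp add: abs_le_iff)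
  moreover have "resolv c a (\<lambda>t. - B) t \<le> resolv c a H t"
    using assms(3) by (intro resolv_mono assms 1 2) (simp add: abs_le_iff minus_le_iff)
  ultimately show ?thesis using resolv_const[OF assms(1)] by (simp add: abs_le_iff)
qed

text \<open>Variation of constants: splitting at \<open>s = t\<close> pulls the dependence of the
  kernel on \<open>t\<close> out of the integrals, so differentiation needs only the fundamental
  theorem of calculus and \<open>H\<close> need only be continuous.\<close>

lemma resolv_split:
  assumes a: "0 < a" and H: "H \<in> borel_measurable borel" "\<And>t. \<bar>H t\<bar> \<le> B"
  shows "integrable lborel (\<lambda>s. indicator {..<t} s * (exp (- lam c a * s) * H s))"
    and "integrable lborel (\<lambda>s. indicator {t..} s * (exp (- mu c a * s) * H s))"
    and "resolv c a H t =
      (exp (lam c a * t) * (\<integral>s. indicator {..<t} s * (exp (- lam c a * s) * H s) \<partial>lborel)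
       + exp (mu c a * t) * (\<integral>s. indicator {t..} s * (exp (- mu c a * s) * H s) \<partial>lborel)) / (mu c a - lam c a)"
proof -
  have d: "0 < mu c a - lam c a" using lam_neg[OF a, of c] mu_pos[OF a, of c] by simp
  have g: "integrable lborel (\<lambda>s. green c a (s - t) * H s)"
    by (rule integrable_green_shift[OF assms])
  have gl: "indicator {..<t} s * (exp (- lam c a * s) * H s) =
      (mu c a - lam c a) * exp (- lam c a * t) * (indicator {..<t} s *\<^sub>R (green c a (s - t) * H s))" for s
  proof -
    have "exp (- lam c a * s) = exp (- lam c a * t) * exp (- lam c a * (s - t))"
      by (simp add: algebra_simps flip: exp_add)
    then show ?thesis using d by (auto simp: green_def indicator_def)
  qed
  have gr: "indicator {t..} s * (exp (- mu c a * s) * H s) =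
      (mu c a - lam c a) * exp (- mu c a * t) * (indicator {t..} s *\<^sub>R (green c a (s - t) * H s))" for s
  proof -
    have "exp (- mu c a * s) = exp (- mu c a * t) * exp (- mu c a * (s - t))"
      by (simp add: algebra_simps flip: exp_add)
    then show ?thesis using d by (auto simp: green_def indicator_def)
  qed
  show 1: "integrable lborel (\<lambda>s. indicator {..<t} s * (exp (- lam c a * s) * H s))"
    unfolding gl by (intro integrable_mult_right integrable_mult_indicator g) auto
  show 2: "integrable lborel (\<lambda>s. indicator {t..} s * (exp (- mu c a * s) * H s))"
    unfolding gr by (intro integrable_mult_right integrable_mult_indicator g) auto
  have "green c a (s - t) * H s = (exp (lam c a * t) * (indicator {..<t} s * (exp (- lam c a * s) * H s))
       + exp (mu c a * t) * (indicator {t..} s * (exp (- mu c a * s) * H s))) / (mu c a - lam c a)" for s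
  proof -
    have "exp (lam c a * t) * exp (- lam c a * s) = exp (- lam c a * (s - t))"
      "exp (mu c a * t) * exp (- mu c a * s) = exp (- mu c a * (s - t))"
      by (simp_all add: algebra_simps flip: exp_add)
    then show ?thesis by (auto simp: green_def indicator_def simp flip: mult.assoc)
  qed
  then show "resolv c a H t =
      (exp (lam c a * t) * (\<integral>s. indicator {..<t} s * (exp (- lam c a * s) * H s) \<partial>lborel)
       + exp (mu c a * t) * (\<integral>s. indicator {t..} s * (exp (- mu c a * s) * H s) \<partial>lborel)) / (mu c a - lam c a)"
    unfolding resolv_shift using 1 2 by simp
qed

lemma resolv_ode:
  assumes a: "0 < a" and H: "continuous_on UNIV H" "\<And>t. \<bar>H t\<bar> \<le> B"
  obtains \<phi>1 where "\<And>t. (resolv c a H has_real_derivative \<phi>1 t) (at t)"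
    "\<And>t. (\<phi>1 has_real_derivative c * \<phi>1 t + a * resolv c a H t - H t) (at t)"
proof -
  define l m where "l = lam c a" and "m = mu c a"
  have lm: "l + m = c" "l * m = - a" "m - l \<noteq> 0"
    using lam_plus_mu lam_mult_mu[OF a] lam_neg[OF a, of c] mu_pos[OF a, of c] by (auto simp: l_def m_def)
  have Hm: "H \<in> borel_measurable borel" using H(1) by (rule borel_measurable_continuous_onI)
  define A where "A t = (\<integral>s. indicator {..<t} s * (exp (- l * s) * H s) \<partial>lborel)" for t
  define C where "C t = (\<integral>s. indicator {t..} s * (exp (- m * s) * H s) \<partial>lborel)" for t
  note sp = resolv_split[OF a Hm H(2), where c=c, folded l_def m_def]
  have A: "(A has_real_derivative exp (- l * t) * H t) (at t)" for t
    unfolding A_def[abs_def]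
    by (intro lborel_integral_lessThan_has_real_derivative continuous_intros H sp)
  have C: "(C has_real_derivative - (exp (- m * t) * H t)) (at t)" for t
    unfolding C_def[abs_def]
    by (intro lborel_integral_atLeast_has_real_derivative continuous_intros H sp)
  have R: "resolv c a H = (\<lambda>t. (exp (l * t) * A t + exp (m * t) * C t) / (m - l))"
    using sp(3) by (auto simp: A_def C_def)
  have e: "exp (l * t) * (exp (- l * t) * x) = x" "exp (m * t) * (exp (- m * t) * x) = x" for x t
    by (simp_all add: exp_minus)
  define \<phi>1 where "\<phi>1 t = (l * exp (l * t) * A t + m * exp (m * t) * C t) / (m - l)" for t
  show thesis
  proof (rule that)
    fix t
    have "((\<lambda>t. (exp (l * t) * A t + exp (m * t) * C t) / (m - l)) has_real_derivative
        ((exp (l * t) * l * A t + exp (l * t) * (exp (- l * t) * H t))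
         + (exp (m * t) * m * C t + exp (m * t) * - (exp (- m * t) * H t))) / (m - l)) (at t)"
      using lm(3) by (auto intro!: derivative_eq_intros A C)
    \<comment> \<open>The boundary terms of the two integrals cancel here because the Green's
      function is continuous at 0; in the second derivative they carry the factors \<open>l\<close>
      and \<open>m\<close> and leave \<open>- H t\<close>.\<close>
    also have "(exp (l * t) * l * A t + exp (l * t) * (exp (- l * t) * H t))
         + (exp (m * t) * m * C t + exp (m * t) * - (exp (- m * t) * H t)) =
        l * exp (l * t) * A t + m * exp (m * t) * C t"
      unfolding mult_minus_right e by simp
    finally show "(resolv c a H has_real_derivative \<phi>1 t) (at t)"
      unfolding R \<phi>1_def .
    have "((\<lambda>t. l * exp (l * t) * A t + m * exp (m * t) * C t) has_real_derivative
        l * (exp (l * t) * l * A t + exp (l * t) * (exp (- l * t) * H t))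
         + m * (exp (m * t) * m * C t + exp (m * t) * - (exp (- m * t) * H t))) (at t)"
      by (auto intro!: derivative_eq_intros A C simp: algebra_simps)
    from DERIV_cdivide[OF this, of "m - l"] have "(\<phi>1 has_real_derivative
        (l * (exp (l * t) * l * A t + exp (l * t) * (exp (- l * t) * H t))
         + m * (exp (m * t) * m * C t + exp (m * t) * - (exp (- m * t) * H t))) / (m - l)) (at t)"
      unfolding \<phi>1_def[abs_def] .
    also have "(l * (exp (l * t) * l * A t + exp (l * t) * (exp (- l * t) * H t))
         + m * (exp (m * t) * m * C t + exp (m * t) * - (exp (- m * t) * H t))) / (m - l)
       = (l * l * (exp (l * t) * A t) + m * m * (exp (m * t) * C t)) / (m - l) - H t"
      unfolding mult_minus_right e using lm(3) by (simp add: field_simps)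
    also have "\<dots> = c * \<phi>1 t + a * resolv c a H t - H t"
    proof -
      define X Y where "X = exp (l * t) * A t" and "Y = exp (m * t) * C t"
      have "l * l * X + m * m * Y = c * (l * X + m * Y) + a * (X + Y)"
        using lm(2) unfolding lm(1)[symmetric] by algebra
      then show ?thesis unfolding R \<phi>1_def by (simp add: X_def Y_def add_divide_distrib distrib_left mult.assoc)
    qed
    finally show "(\<phi>1 has_real_derivative c * \<phi>1 t + a * resolv c a H t - H t) (at t)" .
  qed
qed

lemma exp_combination_unbounded:
  fixes l m p q :: real
  assumes "l < 0" "0 < m" and bd: "\<And>t. \<bar>p * exp (m * t) + q * exp (l * t)\<bar> \<le> B"
  shows "p = 0 \<and> q = 0"
proof -
  have "((\<lambda>t. (p * exp (m * t) + q * exp (l * t)) * exp (- m * t)) \<longlongrightarrow> p) at_top"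
    using assms(1,2) by real_asymp
  moreover have "((\<lambda>t. (p * exp (m * t) + q * exp (l * t)) * exp (- m * t)) \<longlongrightarrow> 0) at_top"
  proof (rule Lim_null_comparison)
    show "\<forall>\<^sub>F t in at_top. norm ((p * exp (m * t) + q * exp (l * t)) * exp (- m * t)) \<le> B * exp (- m * t)"
      using bd by (auto simp: abs_mult intro!: always_eventually mult_right_mono)
    show "((\<lambda>t. B * exp (- m * t)) \<longlongrightarrow> 0) at_top" using assms(2) by real_asymp
  qed
  ultimately have p: "p = 0" using tendsto_unique[OF trivial_limit_at_top_linorder] by blast
  have "((\<lambda>t. (p * exp (m * t) + q * exp (l * t)) * exp (- l * t)) \<longlongrightarrow> q) at_bot"
    using assms(1,2) unfolding p by real_asymp
  moreover have "((\<lambda>t. (p * exp (m * t) + q * exp (l * t)) * exp (- l * t)) \<longlongrightarrow> 0) at_bot"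
  proof (rule Lim_null_comparison)
    show "\<forall>\<^sub>F t in at_bot. norm ((p * exp (m * t) + q * exp (l * t)) * exp (- l * t)) \<le> B * exp (- l * t)"
      using bd by (auto simp: abs_mult intro!: always_eventually mult_right_mono)
    show "((\<lambda>t. B * exp (- l * t)) \<longlongrightarrow> 0) at_bot" using assms(1) by real_asymp
  qed
  ultimately have "q = 0" using tendsto_unique[OF trivial_limit_at_bot_linorder] by blast
  with p show ?thesis by simp
qed

text \<open>The operator factors into two first-order ones, so \<open>v1 - l * v\<close> and
  \<open>v1 - m * v\<close> are pure exponentials. Their difference writes
  \<open>(m - l) * v\<close> as a combination of a growing and a decaying exponential, which is
  bounded only if it vanishes.\<close>

lemma bounded_homogeneous_ode_zero:
  assumes a: "0 < a" and v: "\<And>t. (v has_real_derivative v1 t) (at t)"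
    "\<And>t. (v1 has_real_derivative c * v1 t + a * v t) (at t)" "\<And>t. \<bar>v t\<bar> \<le> B"
  shows "v t = 0"
proof -
  define l m where "l = lam c a" and "m = mu c a"
  have lm: "c = l + m" "a = - (l * m)" "l < 0" "0 < m"
    using lam_plus_mu lam_mult_mu[OF a] lam_neg[OF a, of c] mu_pos[OF a, of c] by (auto simp: l_def m_def)
  have "((\<lambda>t. exp (- m * t) * (v1 t - l * v t)) has_real_derivative 0) (at t)" for t
    by (auto intro!: derivative_eq_intros v) (simp add: lm(1,2) algebra_simps)
  then obtain p where p: "\<And>t. exp (- m * t) * (v1 t - l * v t) = p"
    using DERIV_isconst_all by blast
  have "((\<lambda>t. exp (- l * t) * (v1 t - m * v t)) has_real_derivative 0) (at t)" for t
    by (auto intro!: derivative_eq_intros v) (simp add: lm(1,2) algebra_simps)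
  then obtain q where q: "\<And>t. exp (- l * t) * (v1 t - m * v t) = q"
    using DERIV_isconst_all by blast
  have pq: "v1 t - l * v t = p * exp (m * t)" "v1 t - m * v t = q * exp (l * t)" for t
    using p[of t] q[of t] by (auto simp: exp_minus field_simps)
  have eq: "p * exp (m * t) + (- q) * exp (l * t) = (m - l) * v t" for t
    using pq[of t] by (simp add: algebra_simps)
  have "p = 0 \<and> - q = 0"
  proof (rule exp_combination_unbounded[OF lm(3,4), where B="(m - l) * B"])
    show "\<bar>p * exp (m * t) + (- q) * exp (l * t)\<bar> \<le> (m - l) * B" for t
      unfolding eq abs_mult using lm(3,4) v(3)[of t] by (auto intro!: mult_left_mono)
  qed
  then show ?thesis using eq[of t] lm(3,4) by simp
qed

text \<open>Lets a bounded function known only through its differential equation be treated as a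
  convolution; this is how an arbitrary semi-wavefront becomes a profile.\<close>

lemma resolv_unique:
  assumes a: "0 < a" and H: "continuous_on UNIV H" "\<And>t. \<bar>H t\<bar> \<le> B"
    and \<phi>: "\<And>t. (\<phi> has_real_derivative \<phi>1 t) (at t)"
    "\<And>t. (\<phi>1 has_real_derivative c * \<phi>1 t + a * \<phi> t - H t) (at t)" "\<And>t. \<bar>\<phi> t\<bar> \<le> B'"
  shows "\<phi> t = resolv c a H t"
proof -
  obtain \<psi>1 where \<psi>: "\<And>t. (resolv c a H has_real_derivative \<psi>1 t) (at t)"
    "\<And>t. (\<psi>1 has_real_derivative c * \<psi>1 t + a * resolv c a H t - H t) (at t)"
    using resolv_ode[OF a H] by blast
  have "\<phi> t - resolv c a H t = 0"
  proof (rule bounded_homogeneous_ode_zero[OF a, where v="\<lambda>t. \<phi> t - resolv c a H t" and ?v1.0="\<lambda>t. \<phi>1 t - \<psi>1 t"])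
    show "((\<lambda>t. \<phi> t - resolv c a H t) has_real_derivative \<phi>1 t - \<psi>1 t) (at t)" for t
      by (intro derivative_intros \<phi> \<psi>)
    show "((\<lambda>t. \<phi>1 t - \<psi>1 t) has_real_derivative c * (\<phi>1 t - \<psi>1 t) + a * (\<phi> t - resolv c a H t)) (at t)" for t
      by (auto intro!: derivative_eq_intros \<phi> \<psi> simp: algebra_simps)
    show "\<bar>\<phi> t - resolv c a H t\<bar> \<le> B' + B / a" for t
      using \<phi>(3)[of t] abs_resolv_le[OF a borel_measurable_continuous_onI[OF H(1)] H(2), of c t] by linarith
  qed
  then show ?thesis by simp
qed

text \<open>The resolvent for \<open>a\<close> also solves the equation with \<open>b\<close> once
  the multiple \<open>b - a\<close> of itself is added to the right-hand side; uniqueness does the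
  rest.\<close>

lemma resolvent_identity:
  assumes a: "0 < a" and b: "0 < b" and H: "continuous_on UNIV H" "\<And>t. \<bar>H t\<bar> \<le> B"
  shows "resolv c a H t = resolv c b (\<lambda>t. H t + (b - a) * resolv c a H t) t"
proof -
  obtain \<psi>1 where \<psi>: "\<And>t. (resolv c a H has_real_derivative \<psi>1 t) (at t)"
    "\<And>t. (\<psi>1 has_real_derivative c * \<psi>1 t + a * resolv c a H t - H t) (at t)"
    using resolv_ode[OF a H] by blast
  have bd: "\<bar>resolv c a H t\<bar> \<le> B / a" for t
    by (rule abs_resolv_le[OF a borel_measurable_continuous_onI[OF H(1)] H(2)])
  show ?thesis
  proof (rule resolv_unique[OF b _ _ \<psi>(1) _ bd])
    show "continuous_on UNIV (\<lambda>t. H t + (b - a) * resolv c a H t)"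
      using \<psi>(1) by (intro continuous_intros H continuous_at_imp_continuous_on ballI) (rule DERIV_isCont)
    show "\<bar>H t + (b - a) * resolv c a H t\<bar> \<le> B + \<bar>b - a\<bar> * (B / a)" for t
    proof -
      have "\<bar>(b - a) * resolv c a H t\<bar> \<le> \<bar>b - a\<bar> * (B / a)"
        unfolding abs_mult by (intro mult_left_mono bd) auto
      then show ?thesis using H(2)[of t] by linarith
    qed
    show "(\<psi>1 has_real_derivative c * \<psi>1 t + b * resolv c a H t - (H t + (b - a) * resolv c a H t)) (at t)" for t
      using \<psi>(2)[of t] by (simp add: algebra_simps)
  qed
qed

section \<open>The Harnack inequality inherited from the Green's function\<close>

definition harnack :: "real \<Rightarrow> (real \<Rightarrow> real) \<Rightarrow> bool" where
  "harnack c \<phi> \<longleftrightarrow> (\<forall>t r. 0 \<le> r \<longrightarrow>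
     exp (lam c 1 * r) * \<phi> t \<le> \<phi> (t + r) \<and> exp (- mu c 1 * r) * \<phi> t \<le> \<phi> (t - r))"

text \<open>\<open>ln (green c a x)\<close> is piecewise linear with slopes \<open>- lam c a\<close>
  and \<open>- mu c a\<close>, so a shift changes the kernel by a controlled factor. After
  integration, \<open>exp (- lam c 1 * t) * \<phi> t\<close> is nondecreasing and
  \<open>exp (- mu c 1 * t) * \<phi> t\<close> nonincreasing, which is another form of
  \<open>harnack\<close>.\<close>

lemma green_shift_ge:
  assumes "0 < a" "0 \<le> r"
  shows "exp (lam c a * r) * green c a x \<le> green c a (x - r)" "exp (- mu c a * r) * green c a x \<le> green c a (x + r)"
proof -
  have neg: "lam c a * y \<le> 0" "0 \<le> mu c a * y" if "0 \<le> y" for y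
    using that lam_neg[OF assms(1), of c] mu_pos[OF assms(1), of c] by (auto simp: mult_le_0_iff)
  have 1: "lam c a * x \<le> mu c a * x" if "0 \<le> x" for x using neg[OF that] by linarith
  have 2: "mu c a * x \<le> lam c a * x" if "x < 0" for x using neg[of "-x"] that by linarith
  have d: "0 < mu c a - lam c a" using lam_neg[OF assms(1), of c] mu_pos[OF assms(1), of c] by simp
  show "exp (lam c a * r) * green c a x \<le> green c a (x - r)"
    using d 1[of x] neg[OF assms(2)] assms(2) by (auto simp: green_def algebra_simps divide_right_mono simp flip: exp_add)
  show "exp (- mu c a * r) * green c a x \<le> green c a (x + r)"
    using d 2[of x] neg[OF assms(2)] assms(2) by (auto simp: green_def algebra_simps divide_right_mono simp flip: exp_add)
qed

lemma harnack_resolv: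
  assumes H: "H \<in> borel_measurable borel" "\<And>t. \<bar>H t\<bar> \<le> B" "\<And>t. 0 \<le> H t"
  shows "harnack c (resolv c 1 H)"
  unfolding harnack_def
proof (intro allI impI conjI)
  fix t r :: real assume r: "0 \<le> r"
  have int: "integrable lborel (\<lambda>s. green c 1 (s - t) * H s)" for t
    by (rule integrable_green_shift[OF zero_less_one H(1,2)])
  have "exp (lam c 1 * r) * resolv c 1 H t = (\<integral>s. exp (lam c 1 * r) * (green c 1 (s - t) * H s) \<partial>lborel)"
    unfolding resolv_shift by simp
  also have "\<dots> \<le> resolv c 1 H (t + r)"
    unfolding resolv_shift
  proof (rule integral_mono)
    show "exp (lam c 1 * r) * (green c 1 (s - t) * H s) \<le> green c 1 (s - (t + r)) * H s" for s
      using mult_right_mono[OF green_shift_ge(1)[OF zero_less_one r, of c "s - t"] H(3)[of s]]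
      by (simp add: algebra_simps)
  qed (intro integrable_mult_right int)+
  finally show "exp (lam c 1 * r) * resolv c 1 H t \<le> resolv c 1 H (t + r)" .
  have "exp (- mu c 1 * r) * resolv c 1 H t = (\<integral>s. exp (- mu c 1 * r) * (green c 1 (s - t) * H s) \<partial>lborel)"
    unfolding resolv_shift by simp
  also have "\<dots> \<le> resolv c 1 H (t - r)"
    unfolding resolv_shift
  proof (rule integral_mono)
    show "exp (- mu c 1 * r) * (green c 1 (s - t) * H s) \<le> green c 1 (s - (t - r)) * H s" for s
      using mult_right_mono[OF green_shift_ge(2)[OF zero_less_one r, of c "s - t"] H(3)[of s]]
      by (simp add: algebra_simps)
  qed (intro integrable_mult_right int)+
  finally show "exp (- mu c 1 * r) * resolv c 1 H t \<le> resolv c 1 H (t - r)" .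
qed

text \<open>A sum rather than a maximum of the bounds for the two directions: its integrals against
  \<open>P\<close> and against the Green's function are explicit.\<close>

definition growth :: "real \<Rightarrow> real \<Rightarrow> real" where
  "growth c x = exp (mu c 1 * x) + exp (lam c 1 * x)"

lemma harnack_growth:
  assumes "harnack c \<phi>" "0 \<le> \<phi> t" shows "\<phi> (t + x) \<le> growth c x * \<phi> t"
proof (cases "0 \<le> x")
  case True
  then have "exp (- mu c 1 * x) * \<phi> (t + x) \<le> \<phi> (t + x - x)" using assms(1) unfolding harnack_def by blast
  then have "\<phi> (t + x) \<le> exp (mu c 1 * x) * \<phi> t" by (simp add: exp_minus field_simps)
  also have "\<dots> \<le> growth c x * \<phi> t" unfolding growth_def using assms(2) by (intro mult_right_mono) auto
  finally show ?thesis .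
next
  case False
  then have "0 \<le> - x" by simp
  then have "exp (lam c 1 * - x) * \<phi> (t + x) \<le> \<phi> (t + x + - x)" using assms(1) unfolding harnack_def by blast
  then have "\<phi> (t + x) \<le> exp (lam c 1 * x) * \<phi> t" by (simp add: exp_minus field_simps)
  also have "\<dots> \<le> growth c x * \<phi> t" unfolding growth_def using assms(2) by (intro mult_right_mono) auto
  finally show ?thesis .
qed

text \<open>The modulus is proportional to \<open>\<phi> t\<close> and hence survives division by
  arbitrarily small values. It gives compactness of rescaled profiles without any estimate of
  derivatives.\<close>

lemma harnack_modulus:
  assumes h: "harnack c \<phi>" and "0 \<le> \<phi> t"
  shows "\<bar>\<phi> s - \<phi> t\<bar> \<le> (exp ((mu c 1 - lam c 1) * \<bar>s - t\<bar>) - 1) * \<phi> t"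
proof -
  define r where "r = \<bar>s - t\<bar>"
  define k where "k = mu c 1 - lam c 1"
  have r: "0 \<le> r" by (simp add: r_def)
  have lm: "lam c 1 < 0" "0 < mu c 1" by (simp_all add: lam_neg mu_pos)
  have k: "lam c 1 * r \<ge> - (k * r)" "- mu c 1 * r \<ge> - (k * r)" "mu c 1 * r \<le> k * r" "- lam c 1 * r \<le> k * r"
    using lm r by (auto simp: k_def algebra_simps mult_le_0_iff)
  have "exp (- (k * r)) * \<phi> t \<le> \<phi> s \<and> \<phi> s \<le> exp (k * r) * \<phi> t"
  proof (cases "t \<le> s")
    case True
    then have s: "s = t + r" "t = s - r" by (auto simp: r_def)
    have 1: "exp (lam c 1 * r) * \<phi> t \<le> \<phi> s" "exp (- mu c 1 * r) * \<phi> s \<le> \<phi> t"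
      using h r unfolding harnack_def s(1) by (blast, metis add_diff_cancel_right')
    have "exp (- (k * r)) * \<phi> t \<le> exp (lam c 1 * r) * \<phi> t"
      using k(1) assms(2) by (intro mult_right_mono) auto
    moreover have "\<phi> s \<le> exp (mu c 1 * r) * \<phi> t" using 1(2) by (simp add: exp_minus field_simps)
    moreover have "\<dots> \<le> exp (k * r) * \<phi> t"
      using k(3) assms(2) by (intro mult_right_mono) auto
    ultimately show ?thesis using 1 by linarith
  next
    case False
    then have s: "s = t - r" "t = s + r" by (auto simp: r_def)
    have 1: "exp (- mu c 1 * r) * \<phi> t \<le> \<phi> s" "exp (lam c 1 * r) * \<phi> s \<le> \<phi> t"
      using h r unfolding harnack_def s(1) by (blast, metis diff_add_cancel)
    have "exp (- (k * r)) * \<phi> t \<le> exp (- mu c 1 * r) * \<phi> t"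
      using k(2) assms(2) by (intro mult_right_mono) auto
    moreover have "\<phi> s \<le> exp (- lam c 1 * r) * \<phi> t" using 1(2) by (simp add: exp_minus field_simps)
    moreover have "\<dots> \<le> exp (k * r) * \<phi> t"
      using k(4) assms(2) by (intro mult_right_mono) auto
    ultimately show ?thesis using 1 by linarith
  qed
  \<comment> \<open>A number and its reciprocal sum to at least 2, so the lower bound obeys the same
    modulus as the upper one.\<close>
  moreover have "2 - exp (k * r) \<le> exp (- (k * r))"
    using zero_le_power2[of "exp (k * r) - 1"]
    by (simp add: power2_eq_square field_simps exp_minus)
  then have "(2 - exp (k * r)) * \<phi> t \<le> exp (- (k * r)) * \<phi> t" using assms(2) by (rule mult_right_mono)
  ultimately show ?thesis unfolding r_def[symmetric] k_def[symmetric] by (auto simp: abs_le_iff algebra_simps)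
qed

lemma harnack_equicontinuous:
  assumes "\<And>n. harnack c (F n)" "\<And>n t. 0 \<le> F n t" "\<And>n t. F n t \<le> \<beta> t" "0 < e"
  shows "\<exists>d>0. \<forall>n s. \<bar>s - t\<bar> < d \<longrightarrow> \<bar>F n s - F n t\<bar> < (e::real)"
proof -
  define k where "k = mu c 1 - lam c 1"
  have "((\<lambda>r. (exp (k * \<bar>r\<bar>) - 1) * \<beta> t) \<longlongrightarrow> (exp (k * \<bar>0\<bar>) - 1) * \<beta> t) (at 0)"
    by (intro tendsto_intros)
  then have "\<forall>\<^sub>F r in at 0. (exp (k * \<bar>r\<bar>) - 1) * \<beta> t < e"
    using \<open>0 < e\<close> by (intro order_tendstoD(2)[where y = "(exp (k * \<bar>0\<bar>) - 1) * \<beta> t"]) auto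
  then obtain d where d: "d > 0" "\<And>r. r \<noteq> 0 \<Longrightarrow> \<bar>r\<bar> < d \<Longrightarrow> (exp (k * \<bar>r\<bar>) - 1) * \<beta> t < e"
    unfolding eventually_at by (auto simp: dist_real_def)
  have "\<bar>F n s - F n t\<bar> < e" if "\<bar>s - t\<bar> < d" for n s
  proof (cases "s = t")
    case False
    have "0 \<le> k * \<bar>s - t\<bar>" using lam_neg[of 1 c] mu_pos[of 1 c] by (simp add: k_def)
    then have "\<bar>F n s - F n t\<bar> \<le> (exp (k * \<bar>s - t\<bar>) - 1) * \<beta> t"
      using harnack_modulus[OF assms(1,2), of n s t] assms(3)[of n t]
      by (elim order_trans) (auto simp: k_def intro!: mult_left_mono)
    then show ?thesis using d(2)[of "s - t"] that False by linarith
  qed (use \<open>0 < e\<close> in simp)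
  then show ?thesis using d(1) by blast
qed

lemma harnack_continuous:
  assumes "harnack c \<phi>" "\<And>t. 0 \<le> \<phi> t" shows "continuous_on UNIV \<phi>"
proof (rule continuous_at_imp_continuous_on, rule ballI)
  fix t show "isCont \<phi> t"
    unfolding continuous_at_eps_delta
    using harnack_equicontinuous[of c "\<lambda>_. \<phi>" \<phi>, OF assms order_refl] by (auto simp: dist_real_def)
qed

lemma resolv_cong: "(\<And>t. H t = H' t) \<Longrightarrow> resolv c a H t = resolv c a H' t"
  by presburger

section \<open>The profile equation\<close>

text \<open>\<open>P\<close> is the law of the shift and \<open>B\<close> a bound of the
  nonlinearity. Two slopes are kept apart: \<open>g0\<close> at the origin, for the linearisation,
  and the global \<open>p\<close>, for the supersolution with exponent \<open>w\<close>; they may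
  differ. The nonlinearity is taken continuous and nonnegative on the whole line, so that averages
  need no condition on the sign of the profile.\<close>

locale profile_equation = prob_space P for P :: "real measure" +
  fixes c :: real and g :: "real \<Rightarrow> real" and B p g0 w :: real
  assumes c_pos: "0 < c" and sets_P [measurable_cong]: "sets P = sets borel"
    and exp_moment: "\<And>l. integrable P (\<lambda>r. exp (l * r))"
    and g_cont: "continuous_on UNIV g" and g_nonneg: "\<And>s. 0 \<le> g s" and g_pos: "\<And>s. 0 < s \<Longrightarrow> 0 < g s"
    and g_le_B: "\<And>s. g s \<le> B" and g_le: "\<And>s. 0 \<le> s \<Longrightarrow> g s \<le> p * s"
    and g_deriv: "((\<lambda>s. g s / s) \<longlongrightarrow> g0) (at_right 0)"
    and char_pos: "\<And>z. z \<le> 0 \<Longrightarrow> 0 < z\<^sup>2 - c * z - 1 + g0 * (\<integral>r. exp (z * r) \<partial>P)"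
    and w_pos: "0 < w" and char_w: "w\<^sup>2 - c * w - 1 + p * (\<integral>r. exp (w * r) \<partial>P) \<le> 0"
begin

definition E :: "real \<Rightarrow> real" where "E z = (\<integral>r. exp (z * r) \<partial>P)"

definition act :: "(real \<Rightarrow> real) \<Rightarrow> real \<Rightarrow> real" where
  "act \<phi> t = (\<integral>r. g (\<phi> (t + r)) \<partial>P)"

text \<open>Covers both the true profiles (\<theta> = 1 and no forcing) and the approximating
  problems, so that one growth estimate serves for both. Monotonicity of the forcing keeps its share
  in \<open>\<phi> (t + 1) - q * \<phi> t\<close> nonnegative for \<open>q \<le> 1\<close>.\<close>

definition forced :: "real \<Rightarrow> (real \<Rightarrow> real) \<Rightarrow> bool" where
  "forced \<theta> \<phi> \<longleftrightarrow> (\<forall>t. 0 < \<phi> t) \<and> \<phi> \<in> borel_measurable borel \<and>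
     (\<exists>f C. continuous_on UNIV f \<and> mono f \<and> (\<forall>t. 0 \<le> f t \<and> f t \<le> C) \<and>
       (\<forall>t. \<phi> t = resolv c 1 (\<lambda>s. \<theta> * act \<phi> s + f s) t))"

lemma g_measurable [measurable]: "g \<in> borel_measurable borel"
  using g_cont by (rule borel_measurable_continuous_onI)

lemma B_pos: "0 < B"
  using g_pos[of 1] g_le_B[of 1] by simp

lemma p_pos: "0 < p"
  using g_pos[of 1] g_le[of 1] by simp

lemma E_pos: "0 < E z"
proof -
  have "0 \<le> E z" unfolding E_def by (intro integral_nonneg_AE) auto
  moreover have "E z \<noteq> 0"
  proof
    assume "E z = 0"
    then have "AE r in P. exp (z * r) = 0"
      unfolding E_def using exp_moment[of z] by (subst (asm) integral_nonneg_eq_0_iff_AE) auto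
    then show False by (simp add: AE_False prob_space)
  qed
  ultimately show ?thesis by simp
qed

lemma g0_gt_1: "1 < g0"
  using char_pos[of 0] by (simp add: prob_space)

lemma integrable_act:
  assumes [measurable]: "\<phi> \<in> borel_measurable borel"
  shows "integrable P (\<lambda>r. g (\<phi> (t + r)))"
  by (rule integrable_const_bound[where B=B]) (use g_nonneg g_le_B in auto)

lemma act_measurable [measurable]:
  assumes [measurable]: "\<phi> \<in> borel_measurable borel"
  shows "act \<phi> \<in> borel_measurable borel"
  unfolding act_def[abs_def] by measurable

lemma act_bounds:
  assumes "\<phi> \<in> borel_measurable borel"
  shows "0 \<le> act \<phi> t" "act \<phi> t \<le> B"
proof -
  show "0 \<le> act \<phi> t" unfolding act_def using g_nonneg by (intro integral_nonneg_AE) auto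
  have "act \<phi> t \<le> (\<integral>r. B \<partial>P)"
    unfolding act_def using integrable_act[OF assms] g_le_B by (intro integral_mono) auto
  then show "act \<phi> t \<le> B" by (simp add: prob_space)
qed

lemma act_tendsto:
  assumes [measurable]: "\<And>n. \<Phi> n \<in> borel_measurable borel" "\<phi> \<in> borel_measurable borel"
    and lim: "\<And>r. (\<lambda>n. \<Phi> n (X n + r)) \<longlonglongrightarrow> \<phi> (t + r)"
  shows "(\<lambda>n. act (\<Phi> n) (X n)) \<longlonglongrightarrow> act \<phi> t"
  unfolding act_def
proof (rule integral_dominated_convergence[where w="\<lambda>_. B"])
  show "AE r in P. (\<lambda>n. g (\<Phi> n (X n + r))) \<longlonglongrightarrow> g (\<phi> (t + r))"
  proof (rule AE_I2)
    fix r
    have "isCont g (\<phi> (t + r))" using g_cont by (simp add: continuous_on_eq_continuous_at)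
    then show "(\<lambda>n. g (\<Phi> n (X n + r))) \<longlonglongrightarrow> g (\<phi> (t + r))"
      using lim isCont_tendsto_compose by blast
  qed
qed (use g_nonneg g_le_B in auto)

lemma act_continuous:
  assumes "continuous_on UNIV \<phi>" shows "continuous_on UNIV (act \<phi>)"
proof (rule continuous_at_imp_continuous_on, rule ballI)
  fix t
  have [measurable]: "\<phi> \<in> borel_measurable borel" using assms by (rule borel_measurable_continuous_onI)
  show "isCont (act \<phi>) t"
    unfolding continuous_within_sequentially o_def
  proof (intro allI impI, elim conjE)
    fix X assume X: "X \<longlonglongrightarrow> t"
    show "(\<lambda>n. act \<phi> (X n)) \<longlonglongrightarrow> act \<phi> t"
    proof (rule act_tendsto)
      fix r
      have "isCont \<phi> (t + r)" using assms by (simp add: continuous_on_eq_continuous_at)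
      then show "(\<lambda>n. \<phi> (X n + r)) \<longlonglongrightarrow> \<phi> (t + r)"
        by (rule isCont_tendsto_compose) (intro tendsto_intros X)
    qed auto
  qed
qed

end

lemma resolv_tendsto:
  assumes a: "0 < a" and m: "\<And>n. H n \<in> borel_measurable borel" "H' \<in> borel_measurable borel"
    and d: "\<And>n t. \<bar>H n t\<bar> \<le> D t" and int: "\<And>t. integrable lborel (\<lambda>u. green c a u * D (t + u))"
    and lim: "\<And>t. (\<lambda>n. H n t) \<longlonglongrightarrow> H' t"
  shows "(\<lambda>n. resolv c a (H n) t) \<longlonglongrightarrow> resolv c a H' t"
  unfolding resolv_def
proof (rule integral_dominated_convergence[where w="\<lambda>u. green c a u * D (t + u)"])
  note [measurable] = m
  show "(\<lambda>u. green c a u * H' (t + u)) \<in> borel_measurable lborel" by measurable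
  show "(\<lambda>u. green c a u * H n (t + u)) \<in> borel_measurable lborel" for n by measurable
  show "AE u in lborel. (\<lambda>n. green c a u * H n (t + u)) \<longlonglongrightarrow> green c a u * H' (t + u)"
    by (intro AE_I2 tendsto_intros lim)
  show "AE u in lborel. norm (green c a u * H n (t + u)) \<le> green c a u * D (t + u)" for n
    using d[of n] green_pos[OF a, of c] by (auto simp: abs_mult less_imp_le intro!: mult_left_mono)
qed (rule int)

lemma resolv_tendsto_bounded:
  assumes a: "0 < a" and m: "\<And>n. H n \<in> borel_measurable borel" "H' \<in> borel_measurable borel"
    and d: "\<And>n t. \<bar>H n t\<bar> \<le> C" and lim: "\<And>t. (\<lambda>n. H n t) \<longlonglongrightarrow> H' t"
  shows "(\<lambda>n. resolv c a (H n) t) \<longlonglongrightarrow> resolv c a H' t"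
  using has_bochner_integral_green[OF a, of c]
  by (intro resolv_tendsto[OF a m d _ lim]) (auto simp: has_bochner_integral_iff)

lemma resolv_translate: "resolv c a (\<lambda>s. H (t0 + s)) t = resolv c a H (t0 + t)"
  by (simp add: resolv_def add.assoc)

lemma resolv_add:
  assumes "integrable lborel (\<lambda>u. green c a u * H (t + u))" "integrable lborel (\<lambda>u. green c a u * H' (t + u))"
  shows "resolv c a (\<lambda>s. H s + H' s) t = resolv c a H t + resolv c a H' t"
  unfolding resolv_def using assms by (simp add: distrib_left)

lemma resolv_mult: "resolv c a (\<lambda>s. k * H s) t = k * resolv c a H t"
  by (simp add: resolv_def mult.left_commute[of _ k])

lemma continuous_AE_zero:
  fixes v :: "real \<Rightarrow> real"
  assumes cont: "continuous_on UNIV v" and ae: "AE x in lborel. v x = 0"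
  shows "v x = 0"
proof (rule ccontr)
  assume "v x \<noteq> 0"
  have "open {x. v x \<noteq> 0}" using cont by (simp add: open_Collect_neq)
  then obtain e where e: "0 < e" "ball x e \<subseteq> {x. v x \<noteq> 0}" using \<open>v x \<noteq> 0\<close> unfolding open_contains_ball by blast
  have "emeasure lborel {x. v x \<noteq> 0} = 0"
    using ae by (subst (asm) AE_iff_measurable[OF _ refl]) (use \<open>open _\<close> in auto)
  moreover have "emeasure lborel {x - e<..<x + e} \<le> emeasure lborel {x. v x \<noteq> 0}"
    using e(2) \<open>open _\<close> by (intro emeasure_mono) (auto simp: ball_eq_greaterThanLessThan)
  ultimately show False using e(1) by simp
qed

context profile_equation begin

lemma forcedD:
  assumes "forced \<theta> \<phi>" "0 \<le> \<theta>" "\<theta> \<le> 1"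
  shows "0 < \<phi> t" "\<phi> \<in> borel_measurable borel" "harnack c \<phi>" "continuous_on UNIV \<phi>"
proof -
  from assms(1) obtain f C where f: "continuous_on UNIV f" "\<And>t. 0 \<le> f t" "\<And>t. f t \<le> C"
    and eq: "\<And>t. \<phi> t = resolv c 1 (\<lambda>s. \<theta> * act \<phi> s + f s) t"
    and pos: "\<And>t. 0 < \<phi> t" and m [measurable]: "\<phi> \<in> borel_measurable borel"
    unfolding forced_def by blast
  have [measurable]: "f \<in> borel_measurable borel" using f(1) by (rule borel_measurable_continuous_onI)
  have b: "0 \<le> \<theta> * act \<phi> s" "\<theta> * act \<phi> s \<le> B" for s
    using act_bounds[OF m, of s] assms(2,3) mult_left_le_one_le[of "act \<phi> s" \<theta>] by auto
  have "\<bar>\<theta> * act \<phi> s + f s\<bar> \<le> B + C" "0 \<le> \<theta> * act \<phi> s + f s" for s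
    using b[of s] f(2,3)[of s] by linarith+
  then have "harnack c (resolv c 1 (\<lambda>s. \<theta> * act \<phi> s + f s))"
    by (intro harnack_resolv[where B="B + C"]) auto
  then show h: "harnack c \<phi>" by (rule iffD2[OF arg_cong[OF ext[OF eq], of "harnack c"]])
  show "0 < \<phi> t" "\<phi> \<in> borel_measurable borel" by fact+
  show "continuous_on UNIV \<phi>" by (rule harnack_continuous[OF h less_imp_le[OF pos]])
qed

text \<open>Raising the zeroth-order coefficient from 1 to 2 gives a kernel which decays faster than the
  growth rates allowed by the Harnack inequality; this is what makes dominated convergence applicable
  to rescaled profiles.\<close>

lemma forced_two:
  assumes fo: "forced \<theta> \<phi>" and \<theta>: "0 \<le> \<theta>" "\<theta> \<le> 1" and q: "0 \<le> q" "q \<le> 1"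
  defines "N \<equiv> (\<lambda>s. \<phi> s + \<theta> * act \<phi> s)"
  shows "resolv c 2 N t \<le> \<phi> t"
    and "resolv c 2 N (t + 1) - q * resolv c 2 N t \<le> \<phi> (t + 1) - q * \<phi> t"
proof -
  from fo obtain f C where f: "continuous_on UNIV f" "mono f" "\<And>t. 0 \<le> f t" "\<And>t. f t \<le> C"
    and eq: "\<And>t. \<phi> t = resolv c 1 (\<lambda>s. \<theta> * act \<phi> s + f s) t"
    unfolding forced_def by blast
  note D = forcedD[OF fo \<theta>]
  note [measurable] = D(2) borel_measurable_continuous_onI[OF f(1)]
  have b: "0 \<le> \<theta> * act \<phi> s" "\<theta> * act \<phi> s \<le> B" for s
    using act_bounds[OF D(2), of s] \<theta> mult_left_le_one_le[of "act \<phi> s" \<theta>] by auto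
  have bH: "\<bar>\<theta> * act \<phi> s + f s\<bar> \<le> B + C" for s using b[of s] f(3,4)[of s] by linarith
  have b\<phi>: "\<bar>\<phi> s\<bar> \<le> B + C" for s
    using abs_resolv_le[OF zero_less_one _ bH, where c=c and t=s] eq by auto
  have \<phi>2: "\<phi> t = resolv c 2 (\<lambda>s. (\<theta> * act \<phi> s + f s) + (2 - 1) * resolv c 1 (\<lambda>s. \<theta> * act \<phi> s + f s) s) t" for t
    unfolding eq[of t] by (rule resolvent_identity[OF _ _ _ bH])
      (auto intro!: continuous_intros act_continuous D f)
  have \<phi>2': "\<phi> t = resolv c 2 (\<lambda>s. N s + f s) t" for t
    unfolding \<phi>2[of t] by (rule resolv_cong) (simp add: N_def flip: eq)
  have fC: "\<bar>f s\<bar> \<le> C" for s using f(3,4)[of s] by simp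
  have bN: "\<bar>N s\<bar> \<le> B + C + B" for s unfolding N_def using b[of s] b\<phi>[of s] by linarith
  have iN: "integrable lborel (\<lambda>u. green c 2 u * N (t + u))" for t
    by (rule integrable_green_bounded[OF _ _ bN]) (auto simp: N_def)
  have if': "integrable lborel (\<lambda>u. green c 2 u * f (t + u))" for t
    by (rule integrable_green_bounded[OF _ _ fC]) auto
  have dec: "\<phi> t = resolv c 2 N t + resolv c 2 f t" for t
    unfolding \<phi>2'[of t] by (rule resolv_add[OF iN if'])
  have f0: "0 \<le> resolv c 2 f t" for t
    using green_pos[of 2 c] f(3) unfolding resolv_def by (intro integral_nonneg_AE) (auto simp: less_imp_le)
  show "resolv c 2 N t \<le> \<phi> t" using dec f0[of t] by simp
  have "resolv c 2 f t \<le> resolv c 2 (\<lambda>s. f (1 + s)) t"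
    using if'[of "1 + t"] f(2) by (intro resolv_mono if') (auto simp: add.assoc mono_def)
  then have "resolv c 2 f t \<le> resolv c 2 f (t + 1)" unfolding resolv_translate by (simp add: add.commute)
  moreover have "q * resolv c 2 f t \<le> resolv c 2 f t" using q f0[of t] by (intro mult_left_le_one_le)
  ultimately show "resolv c 2 N (t + 1) - q * resolv c 2 N t \<le> \<phi> (t + 1) - q * \<phi> t"
    using dec[of t] dec[of "t + 1"] by (simp add: algebra_simps)
qed

end

section \<open>Exponential growth of small profiles\<close>

context profile_equation begin

text \<open>The envelope of a normalised profile plus \<open>p\<close> times its average. Its
  exponents \<open>lam c 1\<close> and \<open>mu c 1\<close> are borderline for
  \<open>green c 1\<close>, but lie strictly inside the strip of \<open>green c 2\<close>.\<close>

definition dominant :: "real \<Rightarrow> real" where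
  "dominant x = (1 + p * E (mu c 1)) * exp (mu c 1 * x) + (1 + p * E (lam c 1)) * exp (lam c 1 * x)"

lemma has_integral_growth:
  "has_bochner_integral P (\<lambda>r. growth c (x + r)) (exp (mu c 1 * x) * E (mu c 1) + exp (lam c 1 * x) * E (lam c 1))"
proof -
  have "has_bochner_integral P (\<lambda>r. exp (mu c 1 * x) * exp (mu c 1 * r) + exp (lam c 1 * x) * exp (lam c 1 * r))
     (exp (mu c 1 * x) * E (mu c 1) + exp (lam c 1 * x) * E (lam c 1))"
    unfolding E_def using exp_moment
    by (intro has_bochner_integral_add has_bochner_integral_mult_right has_bochner_integral_integrable)
  then show ?thesis by (simp add: growth_def distrib_left flip: exp_add)
qed

lemma dominant_eq: "dominant x = growth c x + p * (\<integral>r. growth c (x + r) \<partial>P)"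
  using has_integral_growth[of x] by (simp add: dominant_def growth_def has_bochner_integral_iff algebra_simps)

lemma integrable_green2_dominant: "integrable lborel (\<lambda>u. green c 2 u * dominant (t + u))"
proof -
  have lt: "lam c 2 < lam c 1" "lam c 1 < mu c 2" "lam c 2 < mu c 1" "mu c 1 < mu c 2"
    using lam_less[of 1 2 c] mu_less[of 1 2 c] lam_neg[of 1 c] mu_pos[of 2 c] lam_neg[of 2 c] mu_pos[of 1 c] by auto
  define C1 C2 where "C1 = (1 + p * E (mu c 1)) * exp (mu c 1 * t)" and "C2 = (1 + p * E (lam c 1)) * exp (lam c 1 * t)"
  have eq: "(\<lambda>u. green c 2 u * dominant (t + u)) =
     (\<lambda>u. C1 * (green c 2 u * exp (mu c 1 * u)) + C2 * (green c 2 u * exp (lam c 1 * u)))"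
    by (simp add: dominant_def C1_def C2_def fun_eq_iff algebra_simps exp_add)
  show ?thesis unfolding eq using lt
    by (intro Bochner_Integration.integrable_add integrable_mult_right integrable_green_exp) auto
qed

text \<open>Linearisation at 0. By Harnack the translates remain small on compact sets, so
  \<open>g s / s\<close> may be replaced by its limit \<open>g0\<close>, while the global slope
  \<open>p\<close> supplies the majorant. Only inequalities survive, because of the forcing nothing
  is known but its sign and its monotonicity; these give the first and the second
  inequality.\<close>

lemma rescaled_limit:
  assumes fo: "\<And>n. forced (\<theta> n) (\<Phi> n)" and \<theta>: "\<And>n. 0 \<le> \<theta> n" "\<And>n. \<theta> n \<le> 1" "\<theta> \<longlonglongrightarrow> 1"
    and zero: "(\<lambda>n. \<Phi> n (T n)) \<longlonglongrightarrow> 0"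
    and lim: "\<And>x. (\<lambda>n. \<Phi> n (T n + x) / \<Phi> n (T n)) \<longlonglongrightarrow> y x" and ycont: "continuous_on UNIV y"
  defines "N \<equiv> (\<lambda>x. y x + g0 * (\<integral>r. y (x + r) \<partial>P))"
  shows "resolv c 2 N x \<le> y x"
    and "\<And>q. 0 \<le> q \<Longrightarrow> q \<le> 1 \<Longrightarrow> resolv c 2 N (x + 1) - q * resolv c 2 N x \<le> y (x + 1) - q * y x"
    and "\<And>x. 0 \<le> y x" and "\<And>x. y x \<le> growth c x"
    and "\<And>x. integrable P (\<lambda>r. y (x + r))"
    and "integrable lborel (\<lambda>u. green c 2 u * N (x + u))"
proof -
  note D = forcedD[OF fo \<theta>(1,2)]
  have pos: "0 < \<Phi> n t" for n t by (rule D(1))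
  note [measurable] = D(2) borel_measurable_continuous_onI[OF ycont]
  define Y where "Y n x = \<Phi> n (T n + x) / \<Phi> n (T n)" for n x
  have Y: "0 < Y n x" "Y n x \<le> growth c x" for n x
    using pos harnack_growth[OF D(3), of n "T n" x] by (auto simp: Y_def less_imp_le pos_divide_le_eq)
  have Ym [measurable]: "Y n \<in> borel_measurable borel" for n unfolding Y_def[abs_def] by measurable
  have Ylim: "(\<lambda>n. Y n x) \<longlonglongrightarrow> y x" for x unfolding Y_def by (rule lim)
  show y0: "0 \<le> y x" for x using Y(1) by (intro tendsto_lowerbound[OF Ylim]) (auto intro: always_eventually less_imp_le)
  show yg: "y x \<le> growth c x" for x using Y(2) by (intro tendsto_upperbound[OF Ylim]) (auto intro: always_eventually)
  have gi: "integrable P (\<lambda>r. growth c (x + r))" for x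
    using has_integral_growth by (auto simp: has_bochner_integral_iff)
  show yi: "integrable P (\<lambda>r. y (x + r))" for x
    by (rule Bochner_Integration.integrable_bound[OF gi[of x]]) (use y0 yg in \<open>auto intro!: AE_I2 order_trans[OF _ abs_ge_self]\<close>)
  define G where "G n x = act (\<Phi> n) (T n + x) / \<Phi> n (T n)" for n x
  have Geq: "G n x = (\<integral>r. g (\<Phi> n (T n + x + r)) / \<Phi> n (T n) \<partial>P)" for n x
    by (simp add: G_def act_def)
  have Gb: "g (\<Phi> n (T n + x + r)) / \<Phi> n (T n) \<le> p * growth c (x + r)" for n x r
  proof -
    have "g (\<Phi> n (T n + x + r)) / \<Phi> n (T n) \<le> p * \<Phi> n (T n + x + r) / \<Phi> n (T n)"
      using g_le[OF less_imp_le[OF pos]] pos[of n "T n"] by (intro divide_right_mono) (auto simp: less_imp_le)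
    also have "\<dots> = p * Y n (x + r)" by (simp add: Y_def add.assoc)
    also have "\<dots> \<le> p * growth c (x + r)" using Y(2) p_pos by (intro mult_left_mono) auto
    finally show ?thesis .
  qed
  have Glim: "(\<lambda>n. G n x) \<longlonglongrightarrow> g0 * (\<integral>r. y (x + r) \<partial>P)" for x
  proof -
    have "(\<lambda>n. G n x) \<longlonglongrightarrow> (\<integral>r. g0 * y (x + r) \<partial>P)"
      unfolding Geq
    proof (rule integral_dominated_convergence[where w="\<lambda>r. p * growth c (x + r)"])
      show "AE r in P. (\<lambda>n. g (\<Phi> n (T n + x + r)) / \<Phi> n (T n)) \<longlonglongrightarrow> g0 * y (x + r)"
      proof (rule AE_I2)
        fix r
        have s0: "(\<lambda>n. \<Phi> n (T n + x + r)) \<longlonglongrightarrow> 0"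
        proof -
          have "(\<lambda>n. Y n (x + r) * \<Phi> n (T n)) \<longlonglongrightarrow> y (x + r) * 0" by (intro tendsto_intros Ylim zero)
          then show ?thesis using pos[of _ "T _"] by (simp add: Y_def add.assoc less_imp_neq[THEN not_sym])
        qed
        have "filterlim (\<lambda>n. \<Phi> n (T n + x + r)) (at_right 0) sequentially"
          using s0 pos by (intro filterlim_atI tendsto_imp_filterlim_at_right always_eventually) auto
        then have "(\<lambda>n. g (\<Phi> n (T n + x + r)) / \<Phi> n (T n + x + r)) \<longlonglongrightarrow> g0"
          using g_deriv by (rule filterlim_compose[rotated])
        then have "(\<lambda>n. g (\<Phi> n (T n + x + r)) / \<Phi> n (T n + x + r) * Y n (x + r)) \<longlonglongrightarrow> g0 * y (x + r)"
          by (intro tendsto_intros Ylim)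
        then show "(\<lambda>n. g (\<Phi> n (T n + x + r)) / \<Phi> n (T n)) \<longlonglongrightarrow> g0 * y (x + r)"
          using pos by (simp add: Y_def add.assoc less_imp_neq[THEN not_sym])
      qed
      show "AE r in P. norm (g (\<Phi> n (T n + x + r)) / \<Phi> n (T n)) \<le> p * growth c (x + r)" for n
        using Gb g_nonneg pos[of n "T n"] by (auto simp: less_imp_le)
      show "integrable P (\<lambda>r. p * growth c (x + r))" by (intro integrable_mult_right gi)
    qed measurable
    then show ?thesis by simp
  qed
  have G0: "0 \<le> G n x" for n x
    using act_bounds(1)[OF D(2)] pos[of n "T n"] by (simp add: G_def less_imp_le)
  have Gd: "G n x \<le> p * (\<integral>r. growth c (x + r) \<partial>P)" for n x
  proof -
    have "G n x \<le> (\<integral>r. p * growth c (x + r) \<partial>P)"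
      unfolding Geq using integrable_act[OF D(2), of n "T n + x"]
      by (intro integral_mono integrable_mult_right gi Gb) simp
    then show ?thesis by simp
  qed
  define M where "M n x = Y n x + \<theta> n * G n x" for n x
  have "0 \<le> \<theta> n * G n x" "\<theta> n * G n x \<le> G n x" for n x
    using G0[of n x] \<theta>(1,2)[of n] by (auto intro: mult_left_le_one_le)
  then have Md: "\<bar>M n x\<bar> \<le> dominant x" for n x
    unfolding M_def dominant_eq using Y[of n x] Gd[of n x] by (smt (verit))
  have Mm: "M n \<in> borel_measurable borel" for n
    unfolding M_def[abs_def] G_def[abs_def] by measurable
  have Mlim: "(\<lambda>n. M n x) \<longlonglongrightarrow> N x" for x
    unfolding M_def N_def using tendsto_add[OF Ylim tendsto_mult[OF \<theta>(3) Glim]] by simp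
  have Nm: "N \<in> borel_measurable borel"
    unfolding N_def by measurable
  have Rlim: "(\<lambda>n. resolv c 2 (M n) x) \<longlonglongrightarrow> resolv c 2 N x" for x
    by (rule resolv_tendsto[OF _ Mm Nm Md integrable_green2_dominant Mlim]) simp
  have Req: "resolv c 2 (M n) x = resolv c 2 (\<lambda>s. \<Phi> n s + \<theta> n * act (\<Phi> n) s) (T n + x) / \<Phi> n (T n)" for n x
  proof -
    have "M n = (\<lambda>s. 1 / \<Phi> n (T n) * (\<Phi> n (T n + s) + \<theta> n * act (\<Phi> n) (T n + s)))"
      by (simp add: M_def Y_def G_def fun_eq_iff add_divide_distrib)
    then show ?thesis
      using resolv_translate[of c 2 "\<lambda>s. \<Phi> n s + \<theta> n * act (\<Phi> n) s" "T n" x]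
      by (simp only: resolv_mult) simp
  qed
  show "resolv c 2 N x \<le> y x"
  proof (rule tendsto_le[OF trivial_limit_sequentially Ylim Rlim])
    show "\<forall>\<^sub>F n in sequentially. resolv c 2 (M n) x \<le> Y n x"
      unfolding Req Y_def using forced_two(1)[OF fo \<theta>(1,2), of 1] pos
      by (intro always_eventually allI divide_right_mono) (auto simp: less_imp_le)
  qed
  show "resolv c 2 N (x + 1) - q * resolv c 2 N x \<le> y (x + 1) - q * y x" if q: "0 \<le> q" "q \<le> 1" for q
  proof (rule tendsto_le[OF trivial_limit_sequentially])
    show "(\<lambda>n. Y n (x + 1) - q * Y n x) \<longlonglongrightarrow> y (x + 1) - q * y x" by (intro tendsto_intros Ylim)
    show "(\<lambda>n. resolv c 2 (M n) (x + 1) - q * resolv c 2 (M n) x) \<longlonglongrightarrow> resolv c 2 N (x + 1) - q * resolv c 2 N x"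
      by (intro tendsto_intros Rlim)
    have "(resolv c 2 (\<lambda>s. \<Phi> n s + \<theta> n * act (\<Phi> n) s) (T n + x + 1) - q * resolv c 2 (\<lambda>s. \<Phi> n s + \<theta> n * act (\<Phi> n) s) (T n + x)) / \<Phi> n (T n)
      \<le> (\<Phi> n (T n + x + 1) - q * \<Phi> n (T n + x)) / \<Phi> n (T n)" for n
      using forced_two(2)[OF fo \<theta>(1,2) q] pos by (intro divide_right_mono) (auto simp: less_imp_le)
    then show "\<forall>\<^sub>F n in sequentially. resolv c 2 (M n) (x + 1) - q * resolv c 2 (M n) x \<le> Y n (x + 1) - q * Y n x"
      unfolding Req Y_def by (intro always_eventually allI) (simp add: diff_divide_distrib add.assoc)
  qed
  have Nd: "\<bar>N x\<bar> \<le> dominant x" for x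
    using Md by (intro tendsto_upperbound[OF tendsto_rabs[OF Mlim]]) (auto intro: always_eventually)
  show "integrable lborel (\<lambda>u. green c 2 u * N (x + u))"
  proof (rule Bochner_Integration.integrable_bound[OF integrable_green2_dominant[of x]])
    show "AE u in lborel. norm (green c 2 u * N (x + u)) \<le> norm (green c 2 u * dominant (x + u))"
      using Nd by (intro AE_I2) (auto simp: abs_mult intro!: mult_left_mono order_trans[OF Nd abs_ge_self])
  qed (use Nm in measurable)
qed

text \<open>Dividing \<open>y\<close> by \<open>exp (\<sigma> * x)\<close> with
  \<open>\<sigma> = ln \<rho>\<close> leaves a positive function of period 1. At its minimum
  \<open>y\<close> touches an exponential from above; testing the supersolution inequality at that
  point bounds the eigenvalue of the exponential and contradicts \<open>char_pos\<close>.\<close>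

lemma resolv2_periodic_bound:
  assumes y: "continuous_on UNIV y" "\<And>x. y (x + 1) = \<rho> * y x" "\<And>x. 0 < y x" and \<rho>: "0 < \<rho>" "\<rho> \<le> 1" "exp (lam c 1) \<le> \<rho>"
    and yi: "\<And>x. integrable P (\<lambda>r. y (x + r))"
    and Ni: "\<And>x. integrable lborel (\<lambda>u. green c 2 u * (y (x + u) + g0 * (\<integral>r. y (x + u + r) \<partial>P)))"
    and le: "\<And>x. resolv c 2 (\<lambda>x. y x + g0 * (\<integral>r. y (x + r) \<partial>P)) x \<le> y x"
  shows False
proof -
  define \<sigma> where "\<sigma> = ln \<rho>"
  have \<sigma>: "exp \<sigma> = \<rho>" "\<sigma> \<le> 0" "lam c 1 \<le> \<sigma>" using \<rho> by (auto simp: \<sigma>_def ln_ge_iff)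
  \<comment> \<open>The lower bound on \<rho>, a consequence of Harnack, is what puts \<sigma> in
    the strip where exponentials are eigenfunctions.\<close>
  have \<sigma>2: "lam c 2 < \<sigma>" "\<sigma> < mu c 2" using lam_less[of 1 2 c] mu_pos[of 2 c] \<sigma> by auto
  define \<pi> where "\<pi> x = exp (- \<sigma> * x) * y x" for x
  have per: "\<pi> (x + 1) = \<pi> x" for x
  proof -
    have "\<pi> (x + 1) = exp (- \<sigma> * (x + 1)) * exp \<sigma> * y x" by (simp add: \<pi>_def y(2) \<sigma>(1))
    also have "exp (- \<sigma> * (x + 1)) * exp \<sigma> = exp (- \<sigma> * x)" by (simp add: algebra_simps flip: exp_add)
    finally show ?thesis by (simp add: \<pi>_def)
  qed
  have pern: "\<pi> (x + real n) = \<pi> x" for x n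
  proof (induction n)
    case (Suc n) then show ?case using per[of "x + real n"] by (simp add: algebra_simps)
  qed simp
  have cont: "continuous_on UNIV \<pi>" unfolding \<pi>_def by (intro continuous_intros y)
  obtain x0 where x0: "\<forall>x\<in>{0..1}. \<pi> x0 \<le> \<pi> x"
    using continuous_attains_inf[of "{0..1::real}" \<pi>] continuous_on_subset[OF cont, of "{0..1}"] by auto
  have min: "\<pi> x0 \<le> \<pi> x" for x
  proof -
    define n where "n = nat \<lceil>\<bar>x\<bar>\<rceil>"
    define z where "z = x + real n"
    have z: "0 \<le> z" unfolding z_def n_def by linarith
    have "\<pi> x = \<pi> z" unfolding z_def by (simp add: pern)
    also have "z = frac z + real (nat \<lfloor>z\<rfloor>)" using z by (simp add: frac_def)
    also have "\<pi> (frac z + real (nat \<lfloor>z\<rfloor>)) = \<pi> (frac z)" by (rule pern)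
    finally show ?thesis using x0 by (simp add: frac_lt_1 less_imp_le)
  qed
  define k where "k = \<pi> x0"
  have k: "0 < k" unfolding k_def \<pi>_def using y(3) by simp
  have yk: "k * exp (\<sigma> * x) \<le> y x" for x
    using mult_right_mono[OF min[of x], of "exp (\<sigma> * x)"] by (simp add: k_def \<pi>_def exp_minus field_simps)
  have yx0: "y x0 = k * exp (\<sigma> * x0)"
    by (simp add: k_def \<pi>_def exp_minus)
  have inner: "k * exp (\<sigma> * x) * E \<sigma> \<le> (\<integral>r. y (x + r) \<partial>P)" for x
  proof -
    have "k * exp (\<sigma> * x) * E \<sigma> = (\<integral>r. k * exp (\<sigma> * x) * exp (\<sigma> * r) \<partial>P)" by (simp add: E_def)
    also have "\<dots> \<le> (\<integral>r. y (x + r) \<partial>P)"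
      using yk[of "x + _"] by (intro integral_mono yi integrable_mult_right exp_moment) (simp add: algebra_simps exp_add)
    finally show ?thesis .
  qed
  have "k * (1 + g0 * E \<sigma>) * exp (\<sigma> * x0) / (2 + c * \<sigma> - \<sigma>\<^sup>2) = resolv c 2 (\<lambda>x. k * (1 + g0 * E \<sigma>) * exp (\<sigma> * x)) x0"
    using resolv_exp[OF _ \<sigma>2] by simp
  also have "\<dots> \<le> resolv c 2 (\<lambda>x. y x + g0 * (\<integral>r. y (x + r) \<partial>P)) x0"
  proof (rule resolv_mono[OF _ Ni])
    show "k * (1 + g0 * E \<sigma>) * exp (\<sigma> * x) \<le> y x + g0 * (\<integral>r. y (x + r) \<partial>P)" for x
      using add_mono[OF yk[of x] mult_left_mono[OF inner[of x], of g0]] g0_gt_1 by (simp add: algebra_simps)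
    have "integrable lborel (\<lambda>u. k * (1 + g0 * E \<sigma>) * exp (\<sigma> * x0) * (green c 2 u * exp (\<sigma> * u)))"
      using \<sigma>2 by (intro integrable_mult_right integrable_green_exp) auto
    then show "integrable lborel (\<lambda>u. green c 2 u * (k * (1 + g0 * E \<sigma>) * exp (\<sigma> * (x0 + u))))"
      by (simp add: algebra_simps exp_add)
  qed simp
  also have "\<dots> \<le> k * exp (\<sigma> * x0)" using le[of x0] yx0 by simp
  finally have "k * (1 + g0 * E \<sigma>) * exp (\<sigma> * x0) / (2 + c * \<sigma> - \<sigma>\<^sup>2) \<le> k * exp (\<sigma> * x0)" .
  moreover have "0 < 2 + c * \<sigma> - \<sigma>\<^sup>2" using \<sigma>2 char_pos_iff[of 2 c \<sigma>] by simp
  ultimately have "k * exp (\<sigma> * x0) * (1 + g0 * E \<sigma>) \<le> k * exp (\<sigma> * x0) * (2 + c * \<sigma> - \<sigma>\<^sup>2)"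
    by (simp add: pos_divide_le_eq mult.assoc mult.commute[of "1 + g0 * E \<sigma>"])
  \<comment> \<open>Rearranged, this says that the characteristic function is nonpositive at
    \<sigma>.\<close>
  then have "1 + g0 * E \<sigma> \<le> 2 + c * \<sigma> - \<sigma>\<^sup>2" using k by (simp add: mult_le_cancel_left_pos)
  then show False using char_pos[OF \<sigma>(2)] by (simp add: E_def)
qed

lemma harnack_rescale:
  assumes "harnack c \<phi>" "0 < k" shows "harnack c (\<lambda>x. \<phi> (t0 + x) / k)"
  unfolding harnack_def
proof (intro allI impI)
  fix t r :: real assume "0 \<le> r"
  then have "exp (lam c 1 * r) * \<phi> (t0 + t) \<le> \<phi> (t0 + t + r)" "exp (- mu c 1 * r) * \<phi> (t0 + t) \<le> \<phi> (t0 + t - r)"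
    using assms(1) unfolding harnack_def by blast+
  from this[THEN divide_right_mono, of k]
  show "exp (lam c 1 * r) * (\<phi> (t0 + t) / k) \<le> \<phi> (t0 + (t + r)) / k \<and>
      exp (- mu c 1 * r) * (\<phi> (t0 + t) / k) \<le> \<phi> (t0 + (t - r)) / k"
    using assms(2) by (simp add: add.assoc add_diff_eq)
qed

text \<open>The single index controls both the distance of \<theta> from 1 and the smallness of the
  profile, so these sets decrease and their infima increase. The set ranges over all forced profiles
  at once, which is the source of the uniformity.\<close>

definition ratios :: "nat \<Rightarrow> real set" where
  "ratios n = {\<phi> (t + 1) / \<phi> t | \<phi> \<theta> t. 1 - 1 / real (Suc n) \<le> \<theta> \<and> \<theta> \<le> 1 \<and> forced \<theta> \<phi> \<and> \<phi> t < 1 / real (Suc n)}"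

lemma ratios_bounds:
  assumes "x \<in> ratios n" shows "exp (lam c 1) \<le> x" "x \<le> exp (mu c 1)"
proof -
  from assms obtain \<phi> \<theta> t where x: "x = \<phi> (t + 1) / \<phi> t" and \<theta>: "1 - 1 / real (Suc n) \<le> \<theta>" "\<theta> \<le> 1" "forced \<theta> \<phi>"
    unfolding ratios_def by blast
  have "0 \<le> 1 - 1 / real (Suc n)" by simp
  then have \<theta>0: "0 \<le> \<theta>" using \<theta>(1) by linarith
  note D = forcedD[OF \<theta>(3) \<theta>0 \<theta>(2)]
  have "exp (lam c 1 * 1) * \<phi> t \<le> \<phi> (t + 1)" "exp (- mu c 1 * 1) * \<phi> (t + 1) \<le> \<phi> (t + 1 - 1)"
    using D(3) unfolding harnack_def by (metis zero_le_one)+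
  then show "exp (lam c 1) \<le> x" "x \<le> exp (mu c 1)"
    unfolding x using D(1)[of t] by (auto simp: field_simps exp_minus)
qed

lemma ratios_mono: "m \<le> n \<Longrightarrow> ratios n \<subseteq> ratios m"
proof -
  assume "m \<le> n"
  then have "1 / real (Suc n) \<le> 1 / real (Suc m)" by (intro divide_left_mono) auto
  then have "1 - 1 / real (Suc m) \<le> \<theta>" "x < 1 / real (Suc m)"
    if "1 - 1 / real (Suc n) \<le> \<theta>" "x < 1 / real (Suc n)" for \<theta> x using that by linarith+
  then show ?thesis unfolding ratios_def by blast
qed

text \<open>The key estimate. Take the smallest asymptotic ratio \<open>\<rho>\<close> of \<open>\<phi> (t + 1)\<close> to \<open>\<phi> t\<close> where \<open>\<phi>\<close> is
  small. In a rescaled limit \<open>y\<close> realising it, \<open>y (x + 1) - \<rho> * y x\<close> is nonnegative with a zero, so the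
  strong maximum principle makes \<open>y\<close> an exponential times a periodic function, whose minimum forces the
  characteristic function at \<open>ln \<rho>\<close> to be nonpositive; hence \<open>\<rho> > 1\<close>.\<close>

lemma growth_where_small:
  obtains q \<delta> \<theta>0 where "1 < q" "0 < \<delta>" "0 \<le> \<theta>0" "\<theta>0 < 1"
    "\<And>\<theta> \<phi> t. \<theta>0 \<le> \<theta> \<Longrightarrow> \<theta> \<le> 1 \<Longrightarrow> forced \<theta> \<phi> \<Longrightarrow> \<phi> t < \<delta> \<Longrightarrow> q * \<phi> t \<le> \<phi> (t + 1)"
proof -
  note goal = that
  have conclude: thesis if q: "1 < q" "\<And>x. x \<in> ratios n \<Longrightarrow> q \<le> x" for q n
  proof (rule goal[OF q(1)])
    show "0 < 1 / real (Suc n)" "0 \<le> 1 - 1 / real (Suc n)" "1 - 1 / real (Suc n) < 1" by auto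
    fix \<theta> \<phi> t assume *: "1 - 1 / real (Suc n) \<le> \<theta>" "\<theta> \<le> 1" "forced \<theta> \<phi>" "\<phi> t < 1 / real (Suc n)"
    then have "\<phi> (t + 1) / \<phi> t \<in> ratios n" unfolding ratios_def by blast
    then have "q \<le> \<phi> (t + 1) / \<phi> t" by (rule q(2))
    moreover have "0 < \<phi> t" using *(3) unfolding forced_def by blast
    ultimately show "q * \<phi> t \<le> \<phi> (t + 1)" by (simp add: field_simps)
  qed
  show thesis
  proof (rule ccontr)
    assume contra: "\<not> thesis"
    \<comment> \<open>If the set were empty, the claim would hold vacuously with
      \<open>q = 2\<close>.\<close>
    have ne: "ratios n \<noteq> {}" for n
      using conclude[of 2 n] contra by auto
    have bdd: "bdd_below (ratios n)" for n using ratios_bounds(1) by (meson bdd_belowI)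
    define R where "R n = Inf (ratios n)" for n
    have R_le1: "R n \<le> 1" for n
      using conclude[of "R n" n] contra cInf_lower[OF _ bdd] unfolding R_def by (meson not_le)
    have R_inc: "incseq R"
      unfolding R_def by (intro monoI cInf_superset_mono ne bdd ratios_mono)
    have R_lam: "exp (lam c 1) \<le> R n" for n
      unfolding R_def using ratios_bounds(1) by (intro cInf_greatest ne)
    obtain \<rho> where \<rho>: "R \<longlonglongrightarrow> \<rho>" "\<And>n. R n \<le> \<rho>"
      using incseq_convergent[OF R_inc, of 1] R_le1 by blast
    have \<rho>1: "\<rho> \<le> 1" using R_le1 \<rho>(1) by (intro tendsto_upperbound[OF \<rho>(1)]) auto
    have \<rho>l: "exp (lam c 1) \<le> \<rho>" using R_lam[of 0] \<rho>(2)[of 0] by linarith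
    have \<rho>0: "0 < \<rho>" using \<rho>l exp_gt_zero order_less_le_trans by blast
    have "\<exists>\<phi> \<theta> t. 1 - 1 / real (Suc n) \<le> \<theta> \<and> \<theta> \<le> 1 \<and> forced \<theta> \<phi> \<and> \<phi> t < 1 / real (Suc n)
        \<and> \<phi> (t + 1) / \<phi> t < R n + 1 / real (Suc n)" for n
    proof -
      have "Inf (ratios n) < R n + 1 / real (Suc n)" by (simp add: R_def)
      then obtain x where "x \<in> ratios n" "x < R n + 1 / real (Suc n)"
        using cInf_lessD[OF ne] by blast
      then show ?thesis unfolding ratios_def by blast
    qed
    then obtain \<Phi> \<theta> T where \<theta>: "\<And>n. 1 - 1 / real (Suc n) \<le> \<theta> n" "\<And>n. \<theta> n \<le> (1::real)"
      and fo: "\<And>n. forced (\<theta> n) (\<Phi> n)" and small: "\<And>n. \<Phi> n (T n) < 1 / real (Suc n)"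
      and ratio: "\<And>n. \<Phi> n (T n + 1) / \<Phi> n (T n) < R n + 1 / real (Suc n)" by metis
    have \<theta>0: "0 \<le> \<theta> n" for n
    proof -
      have "0 \<le> 1 - 1 / real (Suc n)" by simp
      then show ?thesis using \<theta>(1)[of n] by linarith
    qed
    have inv0: "(\<lambda>n. 1 / real (Suc n)) \<longlonglongrightarrow> 0" by real_asymp
    have \<theta>lim: "\<theta> \<longlonglongrightarrow> 1"
      by (rule tendsto_sandwich[where f="\<lambda>n. 1 - 1 / real (Suc n)" and h="\<lambda>_. 1"])
         (use \<theta> in \<open>auto intro: always_eventually\<close>, real_asymp)
    note D = forcedD[OF fo \<theta>0 \<theta>(2)]
    have \<Phi>lim: "(\<lambda>n. \<Phi> n (T n)) \<longlonglongrightarrow> 0"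
      by (rule tendsto_sandwich[OF _ _ tendsto_const inv0])
         (use D(1) small in \<open>auto intro!: always_eventually less_imp_le\<close>)
    define Y where "Y n x = \<Phi> n (T n + x) / \<Phi> n (T n)" for n x
    have Y0: "0 < Y n x" for n x using D(1) by (simp add: Y_def)
    have Yh: "harnack c (Y n)" for n
      unfolding Y_def by (rule harnack_rescale[OF D(3) D(1)])
    have Yg: "Y n x \<le> growth c x" for n x
      using harnack_growth[OF Yh, of n 0 x] Y0[of n 0] D(1)[of n "T n"] by (simp add: Y_def less_imp_le)
    have Yb: "\<bar>Y n x\<bar> \<le> growth c x" for n x using Yg[of n x] Y0[of n x] by simp
    obtain k y where k: "strict_mono (k::nat\<Rightarrow>nat)" and ylim: "\<And>x. (\<lambda>n. Y (k n) x) \<longlonglongrightarrow> y x" and ycont: "continuous_on UNIV y"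
      by (rule equicontinuous_convergent_subsequence[of Y "growth c", OF Yb])
         (use harnack_equicontinuous[of c Y "growth c", OF Yh less_imp_le[OF Y0] Yg] in blast)+
    note sub = LIMSEQ_subseq_LIMSEQ[OF _ k, unfolded o_def]
    define N where "N x = y x + g0 * (\<integral>r. y (x + r) \<partial>P)" for x
    note L = rescaled_limit[of "\<lambda>n. \<theta> (k n)" "\<lambda>n. \<Phi> (k n)" "\<lambda>n. T (k n)" y,
        OF fo \<theta>0 \<theta>(2) sub[OF \<theta>lim] sub[OF \<Phi>lim] ylim[unfolded Y_def] ycont, folded N_def]
    have y0: "y 0 = 1"
      using ylim[of 0] D(1) by (simp add: Y_def less_imp_neq[THEN not_sym] LIMSEQ_const_iff)
    have ypos: "0 < y x" for x
    proof -
      have "1 \<le> growth c (- x) * Y n x" for n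
        using harnack_growth[OF Yh[of n], of x "- x"] Y0[of n x] D(1)[of n "T n"] by (simp add: Y_def less_imp_le)
      then have "1 \<le> growth c (- x) * y x"
        by (intro tendsto_lowerbound[OF tendsto_mult[OF tendsto_const ylim]]) auto
      then show ?thesis using L(3)[of x] by (cases "y x = 0") auto
    qed
    \<comment> \<open>For fixed \<open>x\<close> the profiles also tend to 0 at
      \<open>T n + x\<close>, so their ratios there eventually belong to every
      \<open>ratios m\<close>. The smallest ratio, attained at \<open>x = 0\<close>, thus bounds all
      ratios of the limit.\<close>
    have yshift: "\<rho> * y x \<le> y (x + 1)" for x
    proof -
      have "R m * y x \<le> y (x + 1)" for m
      proof (rule tendsto_le[OF trivial_limit_sequentially ylim tendsto_mult[OF tendsto_const ylim]])
        have "(\<lambda>n. Y (k n) x * \<Phi> (k n) (T (k n))) \<longlonglongrightarrow> y x * 0"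
          by (intro tendsto_intros ylim sub[OF \<Phi>lim])
        then have "(\<lambda>n. \<Phi> (k n) (T (k n) + x)) \<longlonglongrightarrow> 0"
          using D(1) by (simp add: Y_def less_imp_neq[THEN not_sym])
        then have "\<forall>\<^sub>F n in sequentially. \<Phi> (k n) (T (k n) + x) < 1 / real (Suc m)"
          by (rule order_tendstoD) simp
        then show "\<forall>\<^sub>F n in sequentially. R m * Y (k n) x \<le> Y (k n) (x + 1)"
          using eventually_ge_at_top[of m]
        proof eventually_elim
          case (elim n)
          have "m \<le> k n" using elim(2) seq_suble[OF k, of n] by simp
          then have "1 / real (Suc (k n)) \<le> 1 / real (Suc m)" by (intro divide_left_mono) auto
          then have "1 - 1 / real (Suc m) \<le> \<theta> (k n)" using \<theta>(1)[of "k n"] by linarith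
          then have "\<Phi> (k n) (T (k n) + x + 1) / \<Phi> (k n) (T (k n) + x) \<in> ratios m"
            unfolding ratios_def using \<theta>(2) fo elim(1) by blast
          then have "R m \<le> \<Phi> (k n) (T (k n) + x + 1) / \<Phi> (k n) (T (k n) + x)"
            unfolding R_def by (rule cInf_lower[OF _ bdd])
          then have "R m * \<Phi> (k n) (T (k n) + x) \<le> \<Phi> (k n) (T (k n) + x + 1)"
            using D(1) by (simp add: pos_le_divide_eq)
          then show ?case unfolding Y_def using D(1)[of "k n" "T (k n)"]
            by (simp add: divide_right_mono add.assoc less_imp_le)
        qed
      qed
      then show ?thesis
        by (intro tendsto_upperbound[OF tendsto_mult[OF \<rho>(1) tendsto_const]]) auto
    qed
    have y1: "y 1 = \<rho>"
    proof (rule LIMSEQ_unique[OF ylim])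
      have lo: "R (k n) \<le> Y (k n) 1" for n
      proof -
        have "Y (k n) 1 \<in> ratios (k n)"
          unfolding ratios_def Y_def using \<theta> fo small by blast
        then show ?thesis unfolding R_def by (rule cInf_lower[OF _ bdd])
      qed
      have hi: "Y (k n) 1 \<le> R (k n) + 1 / real (Suc (k n))" for n
        using ratio[of "k n"] by (simp add: Y_def less_imp_le)
      have "(\<lambda>n. R (k n) + 1 / real (Suc (k n))) \<longlonglongrightarrow> \<rho>"
        using tendsto_add[OF sub[OF \<rho>(1)] sub[OF inv0]] by simp
      then show "(\<lambda>n. Y (k n) 1) \<longlonglongrightarrow> \<rho>"
        by (rule tendsto_sandwich[OF always_eventually[OF allI[OF lo]] always_eventually[OF allI[OF hi]] sub[OF \<rho>(1)]])
    qed
    have inner: "\<rho> * N x + (y (x + 1) - \<rho> * y x) \<le> N (x + 1)" for x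
    proof -
      have "\<rho> * (\<integral>r. y (x + r) \<partial>P) = (\<integral>r. \<rho> * y (x + r) \<partial>P)" by simp
      also have "\<dots> \<le> (\<integral>r. y (x + 1 + r) \<partial>P)"
        using yshift[of "x + _"] by (intro integral_mono integrable_mult_right L(5)) (simp add: algebra_simps)
      finally have "g0 * (\<rho> * (\<integral>r. y (x + r) \<partial>P)) \<le> g0 * (\<integral>r. y (x + 1 + r) \<partial>P)"
        using g0_gt_1 by (intro mult_left_mono) auto
      then show ?thesis by (simp add: N_def algebra_simps)
    qed
    have v0: "y (u + 1) - \<rho> * y u = 0" for u
    proof (rule continuous_AE_zero[where v="\<lambda>u. y (u + 1) - \<rho> * y u"])
      \<comment> \<open>The integrand of the resolvent difference between 1 and 0. The second limit
        inequality with \<open>q = \<rho>\<close> bounds its integral by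
        \<open>y 1 - \<rho> * y 0 = 0\<close>; being nonnegative, it vanishes almost everywhere, and
        positivity of the kernel passes this on to \<open>y\<close>.\<close>
      define V where "V u = green c 2 u * N (1 + u) - \<rho> * (green c 2 u * N (0 + u))" for u
      have iV: "integrable lborel V"
        unfolding V_def[abs_def] by (intro Bochner_Integration.integrable_diff integrable_mult_right L(6))
      have Vv: "green c 2 u * (y (u + 1) - \<rho> * y u) \<le> V u" for u
        using mult_left_mono[OF inner[of u] less_imp_le[OF green_pos[of 2 c u]]] by (simp add: V_def algebra_simps)
      have V0: "0 \<le> V u" for u
        using Vv[of u] yshift[of u] mult_nonneg_nonneg[OF less_imp_le[OF green_pos[of 2 c u]], of "y (u + 1) - \<rho> * y u"] by simp
      have "(\<integral>u. V u \<partial>lborel) = resolv c 2 N (0 + 1) - \<rho> * resolv c 2 N 0"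
        unfolding V_def resolv_def using L(6)[of 1] L(6)[of 0] by simp
      also have "\<dots> \<le> y (0 + 1) - \<rho> * y 0" using \<rho>0 \<rho>1 by (intro L(2)) auto
      also have "\<dots> = 0" by (simp add: y0 y1)
      finally have "(\<integral>u. V u \<partial>lborel) = 0"
        using V0 by (intro antisym integral_nonneg_AE) auto
      then have "AE u in lborel. V u = 0"
        using V0 iV by (subst (asm) integral_nonneg_eq_0_iff_AE) auto
      then show "AE u in lborel. y (u + 1) - \<rho> * y u = 0"
      proof eventually_elim
        case (elim u)
        then show ?case using Vv[of u] yshift[of u] green_pos[of 2 c u] by (simp add: mult_le_0_iff)
      qed
      show "continuous_on UNIV (\<lambda>u. y (u + 1) - \<rho> * y u)"
        by (intro continuous_intros ycont continuous_on_compose2[OF ycont]) auto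
    qed
    show False
      by (rule resolv2_periodic_bound[OF ycont _ ypos \<rho>0 \<rho>1 \<rho>l L(5) L(6)[unfolded N_def] L(1)[unfolded N_def]])
         (use v0 in simp)
  qed
qed

end

section \<open>Existence of semi-wavefront profiles and persistence\<close>

context profile_equation begin

lemma char_w_bounds: "0 < 1 + c * w - w\<^sup>2" "p * E w \<le> 1 + c * w - w\<^sup>2" "lam c 1 < w" "w < mu c 1"
proof -
  show 1: "p * E w \<le> 1 + c * w - w\<^sup>2" using char_w by (simp add: E_def)
  show 2: "0 < 1 + c * w - w\<^sup>2" using 1 mult_pos_pos[OF p_pos E_pos[of w]] by linarith
  show "lam c 1 < w" "w < mu c 1" using 2 char_pos_iff[of 1 c w] by auto
qed

definition upper :: "real \<Rightarrow> real" where "upper t = min B (exp (w * t))"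

text \<open>Replacing \<open>g\<close> by \<open>\<theta> * g\<close> with \<open>\<theta> < 1\<close> leaves room below the supersolution \<open>exp (w * t)\<close>, even at
  the critical speed, for a forcing which excludes the trivial solution.\<close>

definition forcing :: "real \<Rightarrow> real \<Rightarrow> real" where
  "forcing \<theta> t = (1 - \<theta>) * min 1 (1 + c * w - w\<^sup>2) * upper t"

definition wave_map :: "real \<Rightarrow> (real \<Rightarrow> real) \<Rightarrow> real \<Rightarrow> real" where
  "wave_map \<theta> \<phi> = resolv c 1 (\<lambda>s. \<theta> * act \<phi> s + forcing \<theta> s)"

lemma upper_pos: "0 < upper t" and upper_le: "upper t \<le> B" "upper t \<le> exp (w * t)"
  using B_pos by (auto simp: upper_def)

lemma upper_mono: "mono upper"
  using w_pos by (auto simp: upper_def mono_def min_le_iff_disj)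

lemma upper_continuous: "continuous_on UNIV upper"
  unfolding upper_def[abs_def] by (intro continuous_intros)

text \<open>The factor \<open>min 1 (1 + c * w - w\<^sup>2)\<close> fits the forcing under both
  parts of \<open>upper\<close>: together with \<theta> times the bound of the reaction term it
  reaches at most \<open>B\<close> and at most the exponential that the resolvent maps to
  \<open>exp (w * t)\<close>.\<close>

lemma forcing_bounds:
  assumes "\<theta> < 1"
  shows "0 < forcing \<theta> t" "forcing \<theta> t \<le> (1 - \<theta>) * B" "forcing \<theta> t \<le> (1 - \<theta>) * ((1 + c * w - w\<^sup>2) * exp (w * t))"
proof -
  define b where "b = min 1 (1 + c * w - w\<^sup>2)"
  have b: "0 < b" "b \<le> 1" "b \<le> 1 + c * w - w\<^sup>2" using char_w_bounds(1) by (auto simp: b_def)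
  have f: "forcing \<theta> t = (1 - \<theta>) * (b * upper t)" by (simp add: forcing_def b_def)
  show "0 < forcing \<theta> t" unfolding f using assms b upper_pos by simp
  have "b * upper t \<le> upper t" using b upper_pos[of t] by (intro mult_left_le_one_le) auto
  then have "b * upper t \<le> B" using upper_le(1)[of t] by linarith
  then show "forcing \<theta> t \<le> (1 - \<theta>) * B" unfolding f using assms by (intro mult_left_mono) auto
  have "b * upper t \<le> (1 + c * w - w\<^sup>2) * exp (w * t)"
    using b upper_le(2)[of t] upper_pos[of t] by (intro mult_mono) auto
  then show "forcing \<theta> t \<le> (1 - \<theta>) * ((1 + c * w - w\<^sup>2) * exp (w * t))"
    unfolding f using assms by (intro mult_left_mono) auto
qed

lemma forcing_continuous: "continuous_on UNIV (forcing \<theta>)"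
  unfolding forcing_def[abs_def] by (intro continuous_intros upper_continuous)

lemma forcing_mono: "\<theta> < 1 \<Longrightarrow> mono (forcing \<theta>)"
  unfolding forcing_def[abs_def] using upper_mono char_w_bounds(1)
  by (auto simp: mono_def intro!: mult_left_mono)

lemma resolv_pos:
  assumes a: "0 < a" and H: "H \<in> borel_measurable borel" "\<And>t. \<bar>H t\<bar> \<le> C" "\<And>t. 0 < H t"
  shows "0 < resolv c' a H t"
proof -
  have int: "integrable lborel (\<lambda>u. green c' a u * H (t + u))"
    by (rule integrable_green_bounded[OF a H(1,2)])
  have pos: "0 < green c' a u * H (t + u)" for u using green_pos[OF a, of c' u] H(3)[of "t + u"] by simp
  have "0 \<le> resolv c' a H t" unfolding resolv_def using pos by (intro integral_nonneg_AE) (auto intro: less_imp_le)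
  moreover have "resolv c' a H t \<noteq> 0"
  proof
    assume "resolv c' a H t = 0"
    then have "AE u in lborel. green c' a u * H (t + u) = 0"
      unfolding resolv_def using int pos
      by (subst (asm) integral_nonneg_eq_0_iff_AE) (auto intro!: AE_I2 less_imp_le)
    then have "AE u in lborel :: real measure. False"
      by eventually_elim (metis less_irrefl pos)
    then show False by (simp add: eventually_False ae_filter_eq_bot_iff)
  qed
  ultimately show ?thesis by simp
qed

lemma integrand_bounds:
  assumes \<theta>: "0 \<le> \<theta>" "\<theta> < 1" and \<phi>: "\<phi> \<in> borel_measurable borel"
  shows "0 < \<theta> * act \<phi> s + forcing \<theta> s" "\<theta> * act \<phi> s + forcing \<theta> s \<le> B" "\<bar>\<theta> * act \<phi> s + forcing \<theta> s\<bar> \<le> B"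
proof -
  have "0 \<le> \<theta> * act \<phi> s" "\<theta> * act \<phi> s \<le> \<theta> * B"
    using act_bounds[OF \<phi>, of s] \<theta> by (auto intro!: mult_left_mono)
  then show "0 < \<theta> * act \<phi> s + forcing \<theta> s" "\<theta> * act \<phi> s + forcing \<theta> s \<le> B"
      "\<bar>\<theta> * act \<phi> s + forcing \<theta> s\<bar> \<le> B"
    using forcing_bounds(1,2)[OF \<theta>(2), of s] by (auto simp: algebra_simps)
qed

lemma integrand_measurable:
  assumes [measurable]: "\<phi> \<in> borel_measurable borel"
  shows "(\<lambda>s. \<theta> * act \<phi> s + forcing \<theta> s) \<in> borel_measurable borel"
proof -
  note [measurable] = borel_measurable_continuous_onI[OF forcing_continuous]
  show ?thesis by measurable
qed

text \<open>Below \<open>exp (w * t)\<close> the reaction term is at most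
  \<open>p * E w * exp (w * t)\<close>, and \<open>char_w\<close> bounds that factor by the inverse
  eigenvalue \<open>1 + c * w - w\<^sup>2\<close> of this exponential. The constant bound
  \<open>B\<close> comes from the unit mass of the Green's function.\<close>

lemma wave_map_bounds:
  assumes \<theta>: "0 \<le> \<theta>" "\<theta> < 1" and \<phi>: "\<phi> \<in> borel_measurable borel" "\<And>t. 0 \<le> \<phi> t" "\<And>t. \<phi> t \<le> exp (w * t)"
  shows "0 < wave_map \<theta> \<phi> t" "wave_map \<theta> \<phi> t \<le> upper t"
proof -
  note b = integrand_bounds[OF \<theta> \<phi>(1)]
  note m = integrand_measurable[OF \<phi>(1)]
  show "0 < wave_map \<theta> \<phi> t" unfolding wave_map_def
    by (rule resolv_pos[OF _ m b(3,1)]) simp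
  have "\<bar>wave_map \<theta> \<phi> t\<bar> \<le> B / 1" unfolding wave_map_def
    by (rule abs_resolv_le[OF _ m b(3)]) simp
  moreover have "wave_map \<theta> \<phi> t \<le> exp (w * t)"
  proof -
    have act: "act \<phi> s \<le> (1 + c * w - w\<^sup>2) * exp (w * s)" for s
    proof -
      have "act \<phi> s \<le> (\<integral>r. p * exp (w * s) * exp (w * r) \<partial>P)"
        unfolding act_def
      proof (intro integral_mono integrable_act \<phi> integrable_mult_right exp_moment)
        fix r
        have "g (\<phi> (s + r)) \<le> p * \<phi> (s + r)" by (rule g_le[OF \<phi>(2)])
        also have "\<dots> \<le> p * exp (w * (s + r))" using \<phi>(3) p_pos by (intro mult_left_mono) auto
        finally show "g (\<phi> (s + r)) \<le> p * exp (w * s) * exp (w * r)" by (simp add: distrib_left exp_add)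
      qed
      also have "\<dots> = p * E w * exp (w * s)" by (simp add: E_def)
      also have "\<dots> \<le> (1 + c * w - w\<^sup>2) * exp (w * s)" using char_w_bounds(2) by (intro mult_right_mono) auto
      finally show ?thesis .
    qed
    have "wave_map \<theta> \<phi> t \<le> resolv c 1 (\<lambda>s. (1 + c * w - w\<^sup>2) * exp (w * s)) t"
      unfolding wave_map_def
    proof (rule resolv_mono)
      show "integrable lborel (\<lambda>u. green c 1 u * (\<theta> * act \<phi> (t + u) + forcing \<theta> (t + u)))"
        by (rule integrable_green_bounded[OF _ m b(3)]) simp
      have "integrable lborel (\<lambda>u. (1 + c * w - w\<^sup>2) * exp (w * t) * (green c 1 u * exp (w * u)))"
        using char_w_bounds by (intro integrable_mult_right integrable_green_exp) auto
      then show "integrable lborel (\<lambda>u. green c 1 u * ((1 + c * w - w\<^sup>2) * exp (w * (t + u))))"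
        by (simp add: algebra_simps exp_add)
      show "\<theta> * act \<phi> s + forcing \<theta> s \<le> (1 + c * w - w\<^sup>2) * exp (w * s)" for s
        using mult_left_mono[OF act[of s] \<theta>(1)] forcing_bounds(3)[OF \<theta>(2), of s] by (simp add: algebra_simps)
    qed simp
    also have "\<dots> = exp (w * t)" using resolv_exp[of 1 c w "1 + c * w - w\<^sup>2" t] char_w_bounds by simp
    finally show ?thesis .
  qed
  ultimately show "wave_map \<theta> \<phi> t \<le> upper t" by (simp add: upper_def)
qed

lemma wave_map_tendsto:
  assumes \<theta>: "0 \<le> \<theta>" "\<theta> < 1" and m: "\<And>n. \<Phi> n \<in> borel_measurable borel" "\<phi> \<in> borel_measurable borel"
    and lim: "\<And>t. (\<lambda>n. \<Phi> n t) \<longlonglongrightarrow> \<phi> t"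
  shows "(\<lambda>n. wave_map \<theta> (\<Phi> n) t) \<longlonglongrightarrow> wave_map \<theta> \<phi> t"
  unfolding wave_map_def
  by (rule resolv_tendsto_bounded[OF zero_less_one integrand_measurable[OF m(1)] integrand_measurable[OF m(2)]
        integrand_bounds(3)[OF \<theta> m(1)]])
     (intro tendsto_intros act_tendsto[where X="\<lambda>_. _"] m lim)

lemma wave_map_harnack:
  assumes \<theta>: "0 \<le> \<theta>" "\<theta> < 1" and \<phi>: "\<phi> \<in> borel_measurable borel"
  shows "harnack c (wave_map \<theta> \<phi>)"
  unfolding wave_map_def
  by (rule harnack_resolv[OF integrand_measurable[OF \<phi>] integrand_bounds(3)[OF \<theta> \<phi>] less_imp_le[OF integrand_bounds(1)[OF \<theta> \<phi>]]])

text \<open>Step functions on a grid of mesh \<open>1 / k\<close> are parametrised by the Hilbert cube, so that Schauder's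
  theorem is not needed.\<close>

lemma grid_solution:
  assumes \<theta>: "0 \<le> \<theta>" "\<theta> < 1" and k: "0 < (k::nat)"
  obtains \<phi> where "\<phi> \<in> borel_measurable borel" "\<And>t. 0 \<le> \<phi> t" "\<And>t. \<phi> t \<le> exp (w * t)"
    "\<And>t. \<phi> t = wave_map \<theta> \<phi> (of_int \<lfloor>real k * t\<rfloor> / real k)"
proof -
  define node where "node i = real_of_int i / real k" for i :: int
  \<comment> \<open>The unknowns are the fractions of \<open>upper\<close> attained at the grid
    points, so the cube constraint is the a priori bound. Sampling \<open>upper\<close> at the left
    end of a cell keeps the step function below the increasing \<open>exp (w * t)\<close>.\<close>
  define S where "S z t = z (int_encode \<lfloor>real k * t\<rfloor>) * upper (node \<lfloor>real k * t\<rfloor>)" for z :: "nat \<Rightarrow> real" and t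
  define F where "F z j = wave_map \<theta> (S z) (node (int_decode j)) / upper (node (int_decode j))" for z j
  have node: "node \<lfloor>real k * t\<rfloor> \<le> t" for t
    unfolding node_def using k by (simp add: divide_le_eq mult.commute)
  have Sm: "S z \<in> borel_measurable borel" for z
  proof -
    have "(\<lambda>i. z (int_encode i) * upper (node i)) \<in> borel_measurable (count_space UNIV)" by simp
    moreover have "(\<lambda>t. \<lfloor>real k * t\<rfloor>) \<in> borel \<rightarrow>\<^sub>M count_space UNIV" by measurable
    ultimately show ?thesis unfolding S_def[abs_def] by (rule measurable_compose[rotated])
  qed
  have S01: "0 \<le> S z t" "S z t \<le> exp (w * t)" if "\<And>j. z j \<in> {0..1}" for z t
  proof -
    have z: "0 \<le> z j" "z j \<le> 1" for j using that[of j] by auto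
    show "0 \<le> S z t" unfolding S_def using z upper_pos by (simp add: less_imp_le)
    have "S z t \<le> upper (node \<lfloor>real k * t\<rfloor>)"
      unfolding S_def using z upper_pos by (intro mult_left_le_one_le) (auto simp: less_imp_le)
    also have "\<dots> \<le> exp (w * node \<lfloor>real k * t\<rfloor>)" by (rule upper_le)
    also have "\<dots> \<le> exp (w * t)" using node[of t] w_pos by simp
    finally show "S z t \<le> exp (w * t)" .
  qed
  obtain z where z: "\<And>j. z j \<in> {0..1}" "F z = z"
  proof (rule hilbert_cube_fixed_point[of F])
    fix x :: "nat \<Rightarrow> real" and i assume x: "\<And>j. x j \<in> {0..1}"
    show "F x i \<in> {0..1}"
      unfolding F_def using wave_map_bounds[OF \<theta> Sm S01[of x, OF x], where t="node (int_decode i)"] upper_pos[of "node (int_decode i)"]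
      by (simp add: divide_le_eq)
  next
    fix X :: "nat \<Rightarrow> nat \<Rightarrow> real" and x i
    assume X: "\<And>n j. X n j \<in> {0..1}" "\<And>j. (\<lambda>n. X n j) \<longlonglongrightarrow> x j"
    show "(\<lambda>n. F (X n) i) \<longlonglongrightarrow> F x i"
      unfolding F_def using upper_pos[of "node (int_decode i)"]
      by (intro tendsto_divide tendsto_const wave_map_tendsto[OF \<theta>] Sm) (auto simp: S_def intro!: tendsto_intros X)
  qed blast
  show thesis
  proof (rule that[OF Sm S01[OF z(1)]])
    fix t
    have "z (int_encode \<lfloor>real k * t\<rfloor>) = F z (int_encode \<lfloor>real k * t\<rfloor>)" using z(2) by simp
    then show "S z t = wave_map \<theta> (S z) (of_int \<lfloor>real k * t\<rfloor> / real k)"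
      using upper_pos[of "node \<lfloor>real k * t\<rfloor>"] by (simp add: S_def[of z t] F_def node_def)
  qed
qed

text \<open>The step functions themselves are not continuous, but their images under
  \<open>wave_map\<close> satisfy Harnack and are equicontinuous. Since a step function samples its
  own image at a node within one mesh width, both sequences have the same limit.\<close>

lemma wave_map_fixed_point:
  assumes \<theta>: "0 \<le> \<theta>" "\<theta> < 1"
  obtains \<phi> where "continuous_on UNIV \<phi>" "\<And>t. 0 < \<phi> t" "\<And>t. \<phi> t \<le> upper t" "\<And>t. \<phi> t = wave_map \<theta> \<phi> t" "harnack c \<phi>"
proof -
  have "\<exists>\<phi>. \<phi> \<in> borel_measurable borel \<and> (\<forall>t. 0 \<le> \<phi> t) \<and> (\<forall>t. \<phi> t \<le> exp (w * t)) \<and>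
      (\<forall>t. \<phi> t = wave_map \<theta> \<phi> (of_int \<lfloor>real (Suc n) * t\<rfloor> / real (Suc n)))" for n
    by (rule grid_solution[OF \<theta>, of "Suc n"]) auto
  then obtain \<Phi> where \<Phi>: "\<And>n. \<Phi> n \<in> borel_measurable borel" "\<And>n t. 0 \<le> \<Phi> n t" "\<And>n t. \<Phi> n t \<le> exp (w * t)"
      "\<And>n t. \<Phi> n t = wave_map \<theta> (\<Phi> n) (of_int \<lfloor>real (Suc n) * t\<rfloor> / real (Suc n))"
    by metis
  define \<Psi> where "\<Psi> n = wave_map \<theta> (\<Phi> n)" for n
  have \<Psi>: "0 < \<Psi> n t" "\<Psi> n t \<le> upper t" for n t
    unfolding \<Psi>_def using wave_map_bounds[OF \<theta> \<Phi>(1-3)] by auto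
  have h: "harnack c (\<Psi> n)" for n unfolding \<Psi>_def by (rule wave_map_harnack[OF \<theta> \<Phi>(1)])
  note eqc = harnack_equicontinuous[of c \<Psi> upper, OF h less_imp_le[OF \<Psi>(1)] \<Psi>(2)]
  have ab: "\<bar>\<Psi> n t\<bar> \<le> upper t" for n t using \<Psi>[of n t] by simp
  obtain k \<phi> where k: "strict_mono (k::nat\<Rightarrow>nat)" and lim: "\<And>t. (\<lambda>n. \<Psi> (k n) t) \<longlonglongrightarrow> \<phi> t" and cont: "continuous_on UNIV \<phi>"
    by (rule equicontinuous_convergent_subsequence[of \<Psi> upper, OF ab]) (use eqc in blast)+
  have \<phi>0: "0 \<le> \<phi> t" for t using \<Psi>(1) by (intro tendsto_lowerbound[OF lim]) (auto intro: always_eventually less_imp_le)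
  have \<phi>u: "\<phi> t \<le> upper t" for t using \<Psi>(2) by (intro tendsto_upperbound[OF lim]) (auto intro: always_eventually)
  have \<phi>m: "\<phi> \<in> borel_measurable borel" using cont by (rule borel_measurable_continuous_onI)
  have lim': "(\<lambda>n. \<Phi> (k n) t) \<longlonglongrightarrow> \<phi> t" for t
  proof -
    have "(\<lambda>n. \<Phi> n t - \<Psi> n t) \<longlonglongrightarrow> 0"
    proof (rule LIMSEQ_I)
      fix e :: real assume "0 < e"
      then obtain d where d: "d > 0" "\<And>n s. \<bar>s - t\<bar> < d \<Longrightarrow> \<bar>\<Psi> n s - \<Psi> n t\<bar> < e" using eqc[of e t] by blast
      obtain M where M: "1 / real (Suc M) < d" using nat_approx_posE[OF d(1)] by blast
      have "norm (\<Phi> n t - \<Psi> n t - 0) < e" if "M \<le> n" for n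
      proof -
        define x where "x = real (Suc n) * t"
        have x: "t = x / real (Suc n)" by (simp add: x_def)
        have "\<bar>of_int \<lfloor>x\<rfloor> - x\<bar> \<le> 1" by linarith
        then have "\<bar>of_int \<lfloor>x\<rfloor> / real (Suc n) - t\<bar> \<le> 1 / real (Suc n)"
          unfolding x by (simp add: abs_divide divide_right_mono flip: diff_divide_distrib)
        also have "\<dots> \<le> 1 / real (Suc M)" using that by (intro divide_left_mono) auto
        finally have "\<bar>of_int \<lfloor>x\<rfloor> / real (Suc n) - t\<bar> < d" using M by linarith
        from d(2)[OF this, of n] show ?thesis using \<Phi>(4)[of n t] by (simp add: \<Psi>_def x_def)
      qed
      then show "\<exists>N. \<forall>n\<ge>N. norm (\<Phi> n t - \<Psi> n t - 0) < e" by blast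
    qed
    from LIMSEQ_subseq_LIMSEQ[OF this k] lim[of t] have "(\<lambda>n. (\<Phi> (k n) t - \<Psi> (k n) t) + \<Psi> (k n) t) \<longlonglongrightarrow> 0 + \<phi> t"
      by (intro tendsto_add) (auto simp: o_def)
    then show ?thesis by simp
  qed
  have fixp: "\<phi> t = wave_map \<theta> \<phi> t" for t
    using wave_map_tendsto[OF \<theta> \<Phi>(1) \<phi>m lim', of t] lim[of t] unfolding \<Psi>_def by (rule LIMSEQ_unique[rotated])
  have \<phi>e: "\<phi> t \<le> exp (w * t)" for t using \<phi>u[of t] upper_le(2)[of t] by linarith
  show thesis
  proof (rule that[OF cont _ \<phi>u fixp])
    show "0 < \<phi> t" for t unfolding fixp[of t] by (rule wave_map_bounds(1)[OF \<theta> \<phi>m \<phi>0 \<phi>e])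
    show "harnack c \<phi>"
      using wave_map_harnack[OF \<theta> \<phi>m] by (rule iffD2[OF arg_cong[OF ext[OF fixp], of "harnack c"]])
  qed
qed

lemma forced_wave_map:
  assumes "0 \<le> \<theta>" "\<theta> < 1" "continuous_on UNIV \<phi>" "\<And>t. 0 < \<phi> t" "\<And>t. \<phi> t = wave_map \<theta> \<phi> t"
  shows "forced \<theta> \<phi>"
  unfolding forced_def
proof (intro conjI allI exI)
  show "\<phi> \<in> borel_measurable borel" using assms(3) by (rule borel_measurable_continuous_onI)
  show "\<phi> t = resolv c 1 (\<lambda>s. \<theta> * act \<phi> s + forcing \<theta> s) t" for t
    using assms(5)[of t] unfolding wave_map_def .
  show "0 \<le> forcing \<theta> t" "forcing \<theta> t \<le> (1 - \<theta>) * B" for t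
    using forcing_bounds[OF assms(2), of t] by auto
qed (use assms forcing_continuous forcing_mono in auto)

lemma forced_one:
  assumes "\<phi> \<in> borel_measurable borel" "\<And>t. 0 < \<phi> t" "\<And>t. \<phi> t = resolv c 1 (act \<phi>) t"
  shows "forced 1 \<phi>"
  unfolding forced_def using assms
  by (intro conjI allI exI[of _ "\<lambda>_. 0"] exI[of _ 0]) (auto simp: mono_def)

section \<open>Persistence, and a profile that decays at minus infinity\<close>

lemma exceeds_threshold:
  assumes q: "1 < q" and step: "\<And>t. \<phi> t < \<delta> \<Longrightarrow> q * \<phi> t \<le> \<phi> (t + 1)" and pos: "\<And>t. 0 < \<phi> t"
  obtains s where "\<delta> \<le> (\<phi> :: real \<Rightarrow> real) s"
proof -
  have "\<exists>s. \<delta> \<le> \<phi> s"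
  proof (rule ccontr)
    assume "\<nexists>s. \<delta> \<le> \<phi> s"
    then have lt: "\<phi> t < \<delta>" for t by (meson not_le)
    have "q ^ n * \<phi> 0 \<le> \<phi> (real n)" for n
    proof (induction n)
      case (Suc n)
      have "q * (q ^ n * \<phi> 0) \<le> q * \<phi> (real n)" using Suc q by (intro mult_left_mono) auto
      then show ?case using step[OF lt, of "real n"] by (simp add: algebra_simps)
    qed simp
    moreover obtain n where "\<delta> / \<phi> 0 < q ^ n" using real_arch_pow[OF q] by blast
    then have "\<delta> < q ^ n * \<phi> 0" using pos[of 0] by (simp add: field_simps)
    ultimately show False using lt[of "real n"] by (meson less_asym less_le_trans)
  qed
  then show thesis using that by blast
qed

text \<open>In steps of length 1 the profile grows when it is below \<delta> and otherwise loses at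
  most the factor \<open>l\<close> of the Harnack inequality, so it never falls below
  \<open>l * \<delta>\<close>; the times in between cost one more factor \<open>l\<close>.\<close>

lemma uniform_persistence:
  assumes \<phi>: "\<phi> \<in> borel_measurable borel" "\<And>t. 0 < \<phi> t" "\<And>t. \<phi> t = resolv c 1 (act \<phi>) t"
  obtains s m where "0 < m" "\<And>t. s \<le> t \<Longrightarrow> m \<le> \<phi> t"
proof -
  note fo = forced_one[OF \<phi>]
  note D = forcedD[OF fo zero_le_one order_refl]
  obtain q \<delta> \<theta>0 where q: "1 < q" "0 < \<delta>" "\<theta>0 < 1"
    and step: "\<And>\<theta> \<phi> t. \<theta>0 \<le> \<theta> \<Longrightarrow> \<theta> \<le> 1 \<Longrightarrow> forced \<theta> \<phi> \<Longrightarrow> \<phi> t < \<delta> \<Longrightarrow> q * \<phi> t \<le> \<phi> (t + 1)"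
    by (rule growth_where_small) blast
  have st: "q * \<phi> t \<le> \<phi> (t + 1)" if "\<phi> t < \<delta>" for t
    by (rule step[OF _ _ fo that]) (use q in auto)
  obtain s where s: "\<delta> \<le> \<phi> s" by (rule exceeds_threshold[where \<phi>=\<phi> and \<delta>=\<delta>, OF q(1) st \<phi>(2)])
  define l where "l = exp (lam c 1)"
  have l: "0 < l" "l < 1" by (auto simp: l_def lam_neg)
  have up: "l powr r * \<phi> t \<le> \<phi> (t + r)" if "0 \<le> r" for r t
    using D(3) that unfolding harnack_def l_def by (simp add: powr_def mult.commute)
  have iter: "l * \<delta> \<le> \<phi> (s + real n)" for n
  proof (induction n)
    case 0
    have "l * \<delta> \<le> 1 * \<delta>" using l q by (intro mult_right_mono) auto
    then show ?case using s by simp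
  next
    case (Suc n)
    show ?case
    proof (cases "\<phi> (s + real n) < \<delta>")
      case True
      have "1 * \<phi> (s + real n) \<le> q * \<phi> (s + real n)" using q \<phi>(2)[of "s + real n"] by (intro mult_right_mono) auto
      then show ?thesis using Suc st[OF True] by (simp add: algebra_simps)
    next
      case False
      have "l * \<delta> \<le> l * \<phi> (s + real n)" using l False by (intro mult_left_mono) auto
      also have "l * \<phi> (s + real n) \<le> \<phi> (s + real n + 1)" using up[of 1 "s + real n"] l by simp
      finally show ?thesis by (simp add: algebra_simps)
    qed
  qed
  show thesis
  proof (rule that)
    show "0 < l * (l * \<delta>)" using l q by simp
    fix t assume t: "s \<le> t"
    define n where "n = nat \<lfloor>t - s\<rfloor>"
    define r where "r = t - s - real n"
    have r: "0 \<le> r" "r \<le> 1" unfolding r_def n_def using t by linarith+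
    have "l * (l * \<delta>) \<le> l powr r * (l * \<delta>)"
      using powr_mono'[OF r(2), of l] l q by (intro mult_right_mono) auto
    also have "\<dots> \<le> l powr r * \<phi> (s + real n)" using iter by (intro mult_left_mono) auto
    also have "\<dots> \<le> \<phi> (s + real n + r)" by (rule up[OF r(1)])
    also have "s + real n + r = t" by (simp add: r_def)
    finally show "l * (l * \<delta>) \<le> \<phi> t" .
  qed
qed

text \<open>Translating by \<open>T n\<close> prevents the limit from vanishing, but forfeits the
  bound by \<open>exp (w * t)\<close>, since nothing controls the size of \<open>T n\<close>. Decay
  at minus infinity is recovered from the growth estimate, read backwards in time.\<close>

lemma semi_wavefront_profile_exists:
  obtains \<phi> where "\<phi> \<in> borel_measurable borel" "\<And>t. 0 < \<phi> t" "\<And>t. \<phi> t \<le> B" "\<And>t. \<phi> t = resolv c 1 (act \<phi>) t"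
    "(\<phi> \<longlongrightarrow> 0) at_bot"
proof -
  obtain q \<delta> \<theta>0 where q: "1 < q" "0 < \<delta>" "0 \<le> \<theta>0" "\<theta>0 < 1"
    and step: "\<And>\<theta> \<phi> t. \<theta>0 \<le> \<theta> \<Longrightarrow> \<theta> \<le> 1 \<Longrightarrow> forced \<theta> \<phi> \<Longrightarrow> \<phi> t < \<delta> \<Longrightarrow> q * \<phi> t \<le> \<phi> (t + 1)"
    by (rule growth_where_small) blast
  define \<theta> where "\<theta> n = 1 - (1 - \<theta>0) / real (Suc n)" for n
  have "(1 - \<theta>0) / real (Suc n) \<le> 1 - \<theta>0" for n using q by (simp add: divide_le_eq)
  then have \<theta>: "\<theta>0 \<le> \<theta> n" "0 \<le> \<theta> n" "\<theta> n < 1" for n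
    using q by (auto simp: \<theta>_def algebra_simps intro: order_trans)
  have \<theta>lim: "\<theta> \<longlonglongrightarrow> 1" unfolding \<theta>_def by real_asymp
  have "\<exists>\<phi>. continuous_on UNIV \<phi> \<and> (\<forall>t. 0 < \<phi> t) \<and> (\<forall>t. \<phi> t \<le> upper t) \<and> (\<forall>t. \<phi> t = wave_map (\<theta> n) \<phi> t) \<and> harnack c \<phi>" for n
    by (rule wave_map_fixed_point[OF \<theta>(2,3)[of n]]) blast
  then obtain \<Phi> where \<Phi>: "\<And>n. continuous_on UNIV (\<Phi> n)" "\<And>n t. 0 < \<Phi> n t" "\<And>n t. \<Phi> n t \<le> upper t"
      "\<And>n t. \<Phi> n t = wave_map (\<theta> n) (\<Phi> n) t" "\<And>n. harnack c (\<Phi> n)" by metis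
  have fo: "forced (\<theta> n) (\<Phi> n)" for n by (rule forced_wave_map[OF \<theta>(2,3) \<Phi>(1,2,4)])
  \<comment> \<open>Strictly below \<delta>, because in the limit the strict bound by
    \<open>d\<close> on the half line becomes weak, while the growth estimate needs values strictly
    below \<delta>.\<close>
  define d where "d = \<delta> / 2"
  have d: "0 < d" "d < \<delta>" using q by (auto simp: d_def)
  \<comment> \<open>The first time at level \<open>d\<close>: the level is reached because small
    values keep growing, and a first time exists because the supersolution excludes times before
    \<open>ln d / w\<close>.\<close>
  have "\<exists>T. d \<le> \<Phi> n T \<and> (\<forall>t<T. \<Phi> n t < d)" for n
  proof -
    define A where "A = {t. d \<le> \<Phi> n t}"
    obtain s where "\<delta> \<le> \<Phi> n s"
      by (rule exceeds_threshold[where \<phi>="\<Phi> n" and \<delta>=\<delta>, OF q(1) _ \<Phi>(2)]) (use step[OF \<theta>(1) less_imp_le[OF \<theta>(3)] fo] in blast)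
    then have ne: "A \<noteq> {}" using d by (auto simp: A_def intro!: exI[of _ s])
    have bd: "ln d / w \<le> t" if "t \<in> A" for t
    proof -
      have "d \<le> exp (w * t)" using that \<Phi>(3)[of n t] upper_le(2)[of t] by (simp add: A_def)
      then have "ln d \<le> ln (exp (w * t))" using d(1) by (subst ln_le_cancel_iff) auto
      then show ?thesis using w_pos by (simp add: divide_le_eq mult.commute)
    qed
    then have bb: "bdd_below A" by (rule bdd_belowI)
    have "closed A" unfolding A_def using \<Phi>(1)[of n] by (intro closed_Collect_le continuous_on_const) auto
    then have "Inf A \<in> A" using ne bb by (rule closed_contains_Inf[rotated 2])
    moreover have "\<Phi> n t < d" if "t < Inf A" for t
      using cInf_lower[OF _ bb, of t] that by (force simp: A_def)
    ultimately show ?thesis unfolding A_def by blast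
  qed
  then obtain T where T: "\<And>n. d \<le> \<Phi> n (T n)" "\<And>n t. t < T n \<Longrightarrow> \<Phi> n t < d" by metis
  define Y where "Y n x = \<Phi> n (T n + x)" for n x
  have Y: "0 < Y n x" "Y n x \<le> B" for n x
    using \<Phi>(2)[of n "T n + x"] \<Phi>(3)[of n "T n + x"] upper_le(1)[of "T n + x"] by (auto simp: Y_def)
  have Yh: "harnack c (Y n)" for n
    using harnack_rescale[OF \<Phi>(5)[of n] zero_less_one, of "T n"] by (simp add: Y_def[abs_def])
  have Ym: "Y n \<in> borel_measurable borel" for n
    by (intro borel_measurable_continuous_onI harnack_continuous[OF Yh]) (simp add: Y less_imp_le)
  have ab: "\<bar>Y n x\<bar> \<le> B" for n x using Y[of n x] by simp
  obtain k y where k: "strict_mono (k::nat\<Rightarrow>nat)" and lim: "\<And>t. (\<lambda>n. Y (k n) t) \<longlonglongrightarrow> y t" and cont: "continuous_on UNIV y"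
    by (rule equicontinuous_convergent_subsequence[of Y "\<lambda>_. B", OF ab])
       (use harnack_equicontinuous[of c Y "\<lambda>_. B", OF Yh less_imp_le[OF Y(1)] Y(2)] in blast)+
  have ym: "y \<in> borel_measurable borel" using cont by (rule borel_measurable_continuous_onI)
  have yB: "y t \<le> B" for t using Y(2) by (intro tendsto_upperbound[OF lim]) (auto intro: always_eventually)
  have y0: "d \<le> y 0" using T(1) by (intro tendsto_lowerbound[OF lim]) (auto simp: Y_def intro: always_eventually)
  have ypos: "0 < y x" for x
  proof -
    have "d \<le> growth c (- x) * Y n x" for n
      using harnack_growth[OF Yh[of n], of x "- x"] Y(1)[of n x] T(1)[of n] by (simp add: Y_def less_imp_le)
    then have "d \<le> growth c (- x) * y x"
      by (intro tendsto_lowerbound[OF tendsto_mult[OF tendsto_const lim]]) auto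
    moreover have "0 \<le> growth c (- x)" by (simp add: growth_def)
    ultimately show ?thesis using d(1) by (metis less_le_trans mult_nonneg_nonpos not_le)
  qed
  have yneg: "y t \<le> d" if "t < 0" for t
    using T(2)[of "T _ + t"] that by (intro tendsto_upperbound[OF lim]) (auto simp: Y_def intro!: always_eventually less_imp_le)
  have eq: "y t = resolv c 1 (act y) t" for t
  proof -
    define H where "H n s = \<theta> (k n) * act (Y (k n)) s + forcing (\<theta> (k n)) (T (k n) + s)" for n s
    have sh: "act (Y n) s = act (\<Phi> n) (T n + s)" for n s by (simp add: act_def Y_def add.assoc)
    have Yeq: "Y (k n) t = resolv c 1 (H n) t" for n
      using \<Phi>(4)[of "k n" "T (k n) + t"] by (simp add: Y_def H_def[abs_def] wave_map_def sh flip: resolv_translate)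
    have Hlim: "(\<lambda>n. H n s) \<longlonglongrightarrow> act y s" for s
    proof -
      note \<theta>k = LIMSEQ_subseq_LIMSEQ[OF \<theta>lim k, unfolded o_def]
      have "(\<lambda>n. (1 - \<theta> (k n)) * B) \<longlonglongrightarrow> (1 - 1) * B" by (intro tendsto_intros \<theta>k)
      then have up: "(\<lambda>n. (1 - \<theta> (k n)) * B) \<longlonglongrightarrow> 0" by simp
      have fb: "0 \<le> forcing (\<theta> (k n)) (T (k n) + s)" "forcing (\<theta> (k n)) (T (k n) + s) \<le> (1 - \<theta> (k n)) * B" for n
        using forcing_bounds(1,2)[OF \<theta>(3)] less_imp_le by blast+
      have 0: "(\<lambda>n. forcing (\<theta> (k n)) (T (k n) + s)) \<longlonglongrightarrow> 0"
        by (rule tendsto_sandwich[OF always_eventually[OF allI[OF fb(1)]] always_eventually[OF allI[OF fb(2)]] tendsto_const up])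
      have 1: "(\<lambda>n. act (Y (k n)) s) \<longlonglongrightarrow> act y s"
        by (rule act_tendsto[OF Ym ym lim])
      show ?thesis unfolding H_def using tendsto_add[OF tendsto_mult[OF \<theta>k 1] 0] by simp
    qed
    have Hb: "\<bar>H n s\<bar> \<le> B" for n s
      unfolding H_def sh by (rule integrand_bounds(3)[OF \<theta>(2,3) borel_measurable_continuous_onI[OF \<Phi>(1)]])
    have Hm: "H n \<in> borel_measurable borel" for n
    proof -
      note [measurable] = borel_measurable_continuous_onI[OF forcing_continuous] Ym
      show ?thesis unfolding H_def by measurable
    qed
    have "(\<lambda>n. resolv c 1 (H n) t) \<longlonglongrightarrow> resolv c 1 (act y) t"
      by (rule resolv_tendsto_bounded[OF zero_less_one Hm act_measurable[OF ym] Hb Hlim])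
    then show ?thesis using lim[of t] unfolding Yeq by (rule LIMSEQ_unique[rotated])
  qed
  note fo1 = forced_one[OF ym ypos eq]
  \<comment> \<open>On the negative half line the limit never leaves the range of the growth
    estimate, so going back \<open>n\<close> steps divides the bound \<open>B\<close> by
    \<open>q ^ n\<close>.\<close>
  have backward: "q ^ n * y t \<le> y (t + real n)" if "t + real n \<le> 0" for n t
    using that
  proof (induction n)
    case (Suc n)
    then have "t + real n < 0" by simp
    then have "y (t + real n) < \<delta>" using yneg d(2) by fastforce
    then have "q * y (t + real n) \<le> y (t + real n + 1)"
      by (intro step[OF _ _ fo1]) (use q in auto)
    moreover have "q * (q ^ n * y t) \<le> q * y (t + real n)" using Suc q by (intro mult_left_mono) auto
    ultimately show ?case by (simp add: algebra_simps)
  qed simp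
  have "(y \<longlongrightarrow> 0) at_bot"
  proof (rule tendstoI)
    fix e :: real assume e: "0 < e"
    obtain n where n: "B / e < q ^ n"
      using real_arch_pow[OF q(1)] by blast
    have "dist (y t) 0 < e" if "t \<le> - real n" for t
    proof -
      have "q ^ n * y t \<le> B" using backward[of t n] that yB[of "t + real n"] by linarith
      also have "\<dots> < q ^ n * e" using n e by (simp add: field_simps)
      finally show ?thesis using q ypos[of t] by (simp add: dist_real_def)
    qed
    then show "\<forall>\<^sub>F t in at_bot. dist (y t) 0 < e" unfolding eventually_at_bot_linorder by blast
  qed
  then show thesis using that[OF ym ypos yB eq] by blast
qed

end

section \<open>Negative Schwarzian derivative and the delay estimate\<close>

text \<open>A negative Schwarzian derivative makes \<open>u = (- g')\<^bsup>-1/2\<^esup>\<close> strictly convex; the estimate comes from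
  comparing \<open>u\<close> with its tangent at \<open>\<kappa>\<close>.\<close>

lemma schwarzian_estimate_right:
  fixes g g1 g2 g3 :: "real \<Rightarrow> real"
  assumes less: "\<kappa> < y" and cont: "continuous_on {\<kappa>..y} g"
    and g: "\<And>t. t \<in> {\<kappa>..<y} \<Longrightarrow> (g has_real_derivative g1 t) (at t)"
      "\<And>t. t \<in> {\<kappa>..<y} \<Longrightarrow> (g1 has_real_derivative g2 t) (at t)"
      "\<And>t. t \<in> {\<kappa>..<y} \<Longrightarrow> (g2 has_real_derivative g3 t) (at t)"
    and neg: "\<And>t. t \<in> {\<kappa>..<y} \<Longrightarrow> g1 t < 0"
    and S: "\<And>t. t \<in> {\<kappa>..<y} \<Longrightarrow> g3 t / g1 t - 3 / 2 * (g2 t / g1 t)\<^sup>2 < 0"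
  shows "(g \<kappa> - g y) * (1 / (y - \<kappa>) - g2 \<kappa> / (2 * g1 \<kappa>)) < - g1 \<kappa>"
proof -
  define u where "u t = 1 / sqrt (- g1 t)" for t
  define u1 where "u1 t = - u t * g2 t / (2 * g1 t)" for t
  define b where "b = - g2 \<kappa> / (2 * g1 \<kappa>)"
  have upos: "0 < u t" if "t \<in> {\<kappa>..<y}" for t using neg[OF that] by (simp add: u_def)
  have usq: "- g1 t = 1 / (u t)\<^sup>2" if "t \<in> {\<kappa>..<y}" for t
    using neg[OF that] by (simp add: u_def power_divide)
  have u: "(u has_real_derivative u1 t) (at t)" if t: "t \<in> {\<kappa>..<y}" for t
  proof -
    have "(u has_real_derivative - (- g2 t * (inverse (sqrt (- g1 t)) / 2)) / (sqrt (- g1 t) * sqrt (- g1 t))) (at t)"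
      unfolding u_def[abs_def] using neg[OF t]
      by (auto intro!: derivative_eq_intros g(2)[OF t])
    also have "- (- g2 t * (inverse (sqrt (- g1 t)) / 2)) / (sqrt (- g1 t) * sqrt (- g1 t)) = u1 t"
      using neg[OF t] by (simp add: u1_def u_def field_simps)
    finally show ?thesis .
  qed
  have aux: "((- (- v * a / (2 * G)) * a + d * - v) * (2 * G) - (- v * a) * (2 * a)) / ((2 * G) * (2 * G))
        = (v / 2) * (3 / 2 * (a / G)\<^sup>2 - d / G)" if "G < 0" for v a d G :: real
    using that by (simp add: divide_simps power2_eq_square) (simp add: algebra_simps)
  have u1: "(u1 has_real_derivative (u t / 2) * (3 / 2 * (g2 t / g1 t)\<^sup>2 - g3 t / g1 t)) (at t)"
    if t: "t \<in> {\<kappa>..<y}" for t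
  proof -
    have "(u1 has_real_derivative ((- u1 t * g2 t + g3 t * - u t) * (2 * g1 t) - (- u t * g2 t) * (2 * g2 t)) / ((2 * g1 t) * (2 * g1 t))) (at t)"
      unfolding u1_def[abs_def]
      by (rule DERIV_divide[OF DERIV_mult[OF DERIV_minus[OF u[OF t, unfolded u1_def]] g(3)[OF t]] DERIV_cmult[OF g(2)[OF t]]])
        (use neg[OF t] in simp)
    also have "((- u1 t * g2 t + g3 t * - u t) * (2 * g1 t) - (- u t * g2 t) * (2 * g2 t)) / ((2 * g1 t) * (2 * g1 t))
        = (u t / 2) * (3 / 2 * (g2 t / g1 t)\<^sup>2 - g3 t / g1 t)"
      unfolding u1_def by (rule aux[OF neg[OF t]])
    finally show ?thesis .
  qed
  have u1_less: "u1 \<kappa> < u1 t" if t: "t \<in> {\<kappa><..<y}" for t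
  proof (rule DERIV_pos_imp_increasing[of \<kappa> t u1])
    fix s assume "\<kappa> \<le> s" "s \<le> t"
    then have s: "s \<in> {\<kappa>..<y}" using t by auto
    have "0 < (u s / 2) * (3 / 2 * (g2 s / g1 s)\<^sup>2 - g3 s / g1 s)"
      using upos[OF s] S[OF s] by (intro mult_pos_pos) auto
    then show "\<exists>v. (u1 has_real_derivative v) (at s) \<and> 0 < v" using u1[OF s] by blast
  qed (use t in auto)
  have R: "u \<kappa> * (1 + b * (t - \<kappa>)) < u t" if t: "t \<in> {\<kappa><..<y}" for t
  proof -
    have "u \<kappa> - u1 \<kappa> * (\<kappa> - \<kappa>) < u t - u1 \<kappa> * (t - \<kappa>)"
    proof (rule DERIV_pos_imp_increasing_open[of \<kappa> t])
      fix s assume "\<kappa> < s" "s < t"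
      then have s: "s \<in> {\<kappa><..<y}" using t by auto
      have "((\<lambda>s. u s - u1 \<kappa> * (s - \<kappa>)) has_real_derivative u1 s - u1 \<kappa>) (at s)"
        using s by (auto intro!: derivative_eq_intros u)
      then show "\<exists>v. ((\<lambda>s. u s - u1 \<kappa> * (s - \<kappa>)) has_real_derivative v) (at s) \<and> 0 < v"
        using u1_less[OF s] by (intro exI[of _ "u1 s - u1 \<kappa>"]) simp
    next
      have "continuous_on {\<kappa>..t} u"
        using t by (intro continuous_at_imp_continuous_on ballI DERIV_isCont[OF u]) auto
      then show "continuous_on {\<kappa>..t} (\<lambda>s. u s - u1 \<kappa> * (s - \<kappa>))" by (intro continuous_intros)
    qed (use t in auto)
    moreover have "u1 \<kappa> = u \<kappa> * b" by (simp add: u1_def b_def)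
    ultimately show ?thesis by (simp add: algebra_simps)
  qed
  have gdec: "g y < g \<kappa>"
  proof (rule DERIV_neg_imp_decreasing_open[where f=g, OF less _ cont])
    fix x assume "\<kappa> < x" "x < y"
    then have "x \<in> {\<kappa>..<y}" by simp
    then show "\<exists>v. (g has_real_derivative v) (at x) \<and> v < 0" using g(1) neg by blast
  qed
  have \<kappa>: "\<kappa> \<in> {\<kappa>..<y}" using less by simp
  have "(g \<kappa> - g y) * (1 / (y - \<kappa>) + b) < - g1 \<kappa>"
  proof (cases "1 + b * (y - \<kappa>) \<le> 0")
    case True
    then have "1 / (y - \<kappa>) + b \<le> 0" using less by (simp add: field_simps)
    then have "(g \<kappa> - g y) * (1 / (y - \<kappa>) + b) \<le> 0" using gdec by (intro mult_nonneg_nonpos) auto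
    then show ?thesis using neg[OF \<kappa>] by linarith
  next
    case False
    have lin: "0 < 1 + b * (t - \<kappa>)" if "t \<in> {\<kappa>..y}" for t
    proof (cases "0 \<le> b")
      case True
      then show ?thesis using that by (intro add_pos_nonneg) auto
    next
      case b: False
      have "b * (y - \<kappa>) \<le> b * (t - \<kappa>)" using b that by (intro mult_left_mono_neg) auto
      then show ?thesis using False by linarith
    qed
    \<comment> \<open>The subtracted Moebius map has zero Schwarzian derivative and the same first
      two derivatives as \<open>g\<close> at \<kappa>; the tangent bound for \<open>u\<close> says
      that \<open>g\<close> falls more slowly than it does. Its pole is excluded here: if
      \<open>1 + b * (y - \<kappa>) \<le> 0\<close>, the claim was trivial by sign.\<close>
    define Z where "Z t = g t - g1 \<kappa> * ((t - \<kappa>) / (1 + b * (t - \<kappa>)))" for t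
    have "Z \<kappa> < Z y"
    proof (rule DERIV_pos_imp_increasing_open[OF less])
      fix t assume "\<kappa> < t" "t < y"
      then have t: "t \<in> {\<kappa><..<y}" "t \<in> {\<kappa>..<y}" "t \<in> {\<kappa>..y}" by auto
      have "((\<lambda>t. (t - \<kappa>) / (1 + b * (t - \<kappa>))) has_real_derivative
          (1 * (1 + b * (t - \<kappa>)) - (t - \<kappa>) * b) / ((1 + b * (t - \<kappa>)) * (1 + b * (t - \<kappa>)))) (at t)"
        using lin[OF t(3)] by (auto intro!: derivative_eq_intros)
      also have "(1 * (1 + b * (t - \<kappa>)) - (t - \<kappa>) * b) / ((1 + b * (t - \<kappa>)) * (1 + b * (t - \<kappa>))) = 1 / (1 + b * (t - \<kappa>))\<^sup>2"
        by (simp add: power2_eq_square algebra_simps)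
      finally have "(Z has_real_derivative g1 t - g1 \<kappa> * (1 / (1 + b * (t - \<kappa>))\<^sup>2)) (at t)"
        unfolding Z_def[abs_def] by (intro derivative_intros g t DERIV_cmult)
      moreover have "- g1 t < - g1 \<kappa> * (1 / (1 + b * (t - \<kappa>))\<^sup>2)"
      proof -
        have "(u \<kappa> * (1 + b * (t - \<kappa>)))\<^sup>2 < (u t)\<^sup>2"
          using R[OF t(1)] lin[OF t(3)] upos[OF \<kappa>] by (intro power_strict_mono) auto
        then have "1 / (u t)\<^sup>2 < 1 / (u \<kappa> * (1 + b * (t - \<kappa>)))\<^sup>2"
          using lin[OF t(3)] upos[OF \<kappa>] upos[OF t(2)]
          by (intro divide_strict_left_mono mult_pos_pos zero_less_power) auto
        then show ?thesis unfolding usq[OF t(2)] usq[OF \<kappa>] by (simp add: power_mult_distrib)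
      qed
      ultimately show "\<exists>v. (Z has_real_derivative v) (at t) \<and> 0 < v" by (intro exI conjI) (assumption, simp)
    next
      show "continuous_on {\<kappa>..y} Z"
        unfolding Z_def[abs_def] using lin by (intro continuous_intros cont) (force simp: less_imp_neq[THEN not_sym])
    qed
    have pe: "1 / (y - \<kappa>) + b = (1 + b * (y - \<kappa>)) / (y - \<kappa>)" using less by (simp add: add_divide_distrib)
    have pp: "0 < 1 / (y - \<kappa>) + b" unfolding pe using less lin[of y] by (intro divide_pos_pos) auto
    have "g \<kappa> - g y < - g1 \<kappa> * ((y - \<kappa>) / (1 + b * (y - \<kappa>)))"
      using \<open>Z \<kappa> < Z y\<close> by (simp add: Z_def)
    then have "(g \<kappa> - g y) * (1 / (y - \<kappa>) + b) < - g1 \<kappa> * ((y - \<kappa>) / (1 + b * (y - \<kappa>))) * (1 / (y - \<kappa>) + b)"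
      using pp by (rule mult_strict_right_mono)
    also have "\<dots> = - g1 \<kappa> * (((y - \<kappa>) / (1 + b * (y - \<kappa>))) * (1 / (y - \<kappa>) + b))"
      by (rule mult.assoc)
    also have "((y - \<kappa>) / (1 + b * (y - \<kappa>))) * (1 / (y - \<kappa>) + b) = 1"
      unfolding pe using less lin[of y] by auto
    finally show ?thesis by simp
  qed
  then show ?thesis by (simp add: b_def)
qed

text \<open>The conjugation \<open>- g (- s)\<close> exchanges the sides, keeps the first derivative
  and the Schwarzian derivative, and changes only the sign of the second derivative.\<close>

lemma schwarzian_estimate_left:
  fixes g g1 g2 g3 :: "real \<Rightarrow> real"
  assumes less: "x < \<kappa>" and cont: "continuous_on {x..\<kappa>} g"
    and g: "\<And>t. t \<in> {x<..\<kappa>} \<Longrightarrow> (g has_real_derivative g1 t) (at t)"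
      "\<And>t. t \<in> {x<..\<kappa>} \<Longrightarrow> (g1 has_real_derivative g2 t) (at t)"
      "\<And>t. t \<in> {x<..\<kappa>} \<Longrightarrow> (g2 has_real_derivative g3 t) (at t)"
    and neg: "\<And>t. t \<in> {x<..\<kappa>} \<Longrightarrow> g1 t < 0"
    and S: "\<And>t. t \<in> {x<..\<kappa>} \<Longrightarrow> g3 t / g1 t - 3 / 2 * (g2 t / g1 t)\<^sup>2 < 0"
  shows "(g x - g \<kappa>) * (1 / (\<kappa> - x) + g2 \<kappa> / (2 * g1 \<kappa>)) < - g1 \<kappa>"
proof -
  have mirror: "((\<lambda>s. f (- s)) has_real_derivative - f' (- t)) (at t)"
    if "t \<in> {-\<kappa>..<-x}" "\<And>t. t \<in> {x<..\<kappa>} \<Longrightarrow> (f has_real_derivative f' t) (at t)" for f f' :: "real \<Rightarrow> real" and t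
  proof -
    have "(f has_real_derivative f' (- t)) (at (- t))" using that by auto
    then have "((\<lambda>s. f (- s)) has_real_derivative f' (- t) * (- 1)) (at t)"
      by (intro DERIV_chain'[where f=uminus and g=f]) (auto intro!: derivative_eq_intros)
    then show ?thesis by simp
  qed
  have "(- g (- (- \<kappa>)) - - g (- (- x))) * (1 / (- x - (- \<kappa>)) - - g2 (- (- \<kappa>)) / (2 * g1 (- (- \<kappa>)))) < - g1 (- (- \<kappa>))"
  proof (rule schwarzian_estimate_right[where g="\<lambda>s. - g (- s)" and ?g1.0="\<lambda>s. g1 (- s)" and ?g2.0="\<lambda>s. - g2 (- s)" and ?g3.0="\<lambda>s. g3 (- s)"])
    show "continuous_on {- \<kappa>..- x} (\<lambda>s. - g (- s))"
      by (intro continuous_intros continuous_on_compose2[OF cont]) auto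
    fix t assume t: "t \<in> {- \<kappa>..<- x}"
    show "((\<lambda>s. - g (- s)) has_real_derivative g1 (- t)) (at t)"
      using DERIV_minus[OF mirror[OF t g(1)]] by simp
    show "((\<lambda>s. g1 (- s)) has_real_derivative - g2 (- t)) (at t)"
      by (rule mirror[OF t g(2)])
    show "((\<lambda>s. - g2 (- s)) has_real_derivative g3 (- t)) (at t)"
      using DERIV_minus[OF mirror[OF t g(3)]] by simp
    show "g1 (- t) < 0" "g3 (- t) / g1 (- t) - 3 / 2 * (- g2 (- t) / g1 (- t))\<^sup>2 < 0"
      using neg[of "- t"] S[of "- t"] t by auto
  qed (use less in simp)
  then show ?thesis by simp
qed

text \<open>The second derivative at \<kappa> enters the two one-sided estimates through the same
  number \<open>b\<close> with opposite signs. The cycle inequalities and the slope condition give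
  \<open>1 / (y - \<kappa>) - b < 1 / (\<kappa> - x)\<close> and
  \<open>1 / (\<kappa> - x) + b < 1 / (y - \<kappa>)\<close>, which contradict each other.\<close>

lemma no_two_cycle:
  fixes g g1 g2 g3 :: "real \<Rightarrow> real"
  assumes xy: "x < \<kappa>" "\<kappa> < y" and cont: "continuous_on {x..y} g"
    and g: "\<And>t. t \<in> {x<..<y} \<Longrightarrow> (g has_real_derivative g1 t) (at t)"
      "\<And>t. t \<in> {x<..<y} \<Longrightarrow> (g1 has_real_derivative g2 t) (at t)"
      "\<And>t. t \<in> {x<..<y} \<Longrightarrow> (g2 has_real_derivative g3 t) (at t)"
    and neg: "\<And>t. t \<in> {x<..<y} \<Longrightarrow> g1 t < 0"
    and S: "\<And>t. t \<in> {x<..<y} \<Longrightarrow> g3 t / g1 t - 3 / 2 * (g2 t / g1 t)\<^sup>2 < 0"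
    and fixp: "g \<kappa> = \<kappa>" and slope: "- 1 \<le> (1 - \<xi>) * g1 \<kappa>" and \<xi>: "\<xi> \<le> 1"
    and cycle: "y \<le> (1 - \<xi>) * g x + \<xi> * \<kappa>" "(1 - \<xi>) * g y + \<xi> * \<kappa> \<le> x"
  shows False
proof -
  define b where "b = g2 \<kappa> / (2 * g1 \<kappa>)"
  have 1: "y - \<kappa> \<le> (1 - \<xi>) * (g x - \<kappa>)" and 2: "\<kappa> - x \<le> (1 - \<xi>) * (\<kappa> - g y)"
    using cycle by (auto simp: algebra_simps)
  have \<xi>1: "0 < 1 - \<xi>" using 1 xy \<xi> by (cases "\<xi> = 1") auto
  have pos: "0 < g x - \<kappa>" "0 < \<kappa> - g y"
    using 1 2 xy \<xi>1 by (smt (verit) mult_nonneg_nonpos)+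
  have "(g \<kappa> - g y) * (1 / (y - \<kappa>) - g2 \<kappa> / (2 * g1 \<kappa>)) < - g1 \<kappa>"
    by (rule schwarzian_estimate_right[where ?g3.0=g3]) (use xy g neg S in \<open>auto intro: continuous_on_subset[OF cont]\<close>)
  then have R: "(\<kappa> - g y) * (1 / (y - \<kappa>) - b) < - g1 \<kappa>" by (simp add: fixp b_def)
  have "(g x - g \<kappa>) * (1 / (\<kappa> - x) + g2 \<kappa> / (2 * g1 \<kappa>)) < - g1 \<kappa>"
    by (rule schwarzian_estimate_left[where ?g3.0=g3]) (use xy g neg S in \<open>auto intro: continuous_on_subset[OF cont]\<close>)
  then have L: "(g x - \<kappa>) * (1 / (\<kappa> - x) + b) < - g1 \<kappa>" by (simp add: fixp b_def)
  have a: "(1 - \<xi>) * - g1 \<kappa> \<le> 1" using slope by simp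
  have "(\<kappa> - x) * (1 / (y - \<kappa>) - b) < 1"
  proof (cases "0 \<le> 1 / (y - \<kappa>) - b")
    case True
    have "(\<kappa> - x) * (1 / (y - \<kappa>) - b) \<le> (1 - \<xi>) * (\<kappa> - g y) * (1 / (y - \<kappa>) - b)"
      by (rule mult_right_mono[OF 2 True])
    also have "\<dots> < (1 - \<xi>) * - g1 \<kappa>" using mult_strict_left_mono[OF R \<xi>1] by (simp add: mult.assoc)
    finally show ?thesis using a by linarith
  next
    case False
    then have "(\<kappa> - x) * (1 / (y - \<kappa>) - b) \<le> 0" using xy by (intro mult_nonneg_nonpos) auto
    then show ?thesis by simp
  qed
  then have R': "1 / (y - \<kappa>) - b < 1 / (\<kappa> - x)" using xy by (simp add: field_simps)
  have "(y - \<kappa>) * (1 / (\<kappa> - x) + b) < 1"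
  proof (cases "0 \<le> 1 / (\<kappa> - x) + b")
    case True
    have "(y - \<kappa>) * (1 / (\<kappa> - x) + b) \<le> (1 - \<xi>) * (g x - \<kappa>) * (1 / (\<kappa> - x) + b)"
      by (rule mult_right_mono[OF 1 True])
    also have "\<dots> < (1 - \<xi>) * - g1 \<kappa>" using mult_strict_left_mono[OF L \<xi>1] by (simp add: mult.assoc)
    finally show ?thesis using a by linarith
  next
    case False
    then have "(y - \<kappa>) * (1 / (\<kappa> - x) + b) \<le> 0" using xy by (intro mult_nonneg_nonpos) auto
    then show ?thesis by simp
  qed
  then have "1 / (\<kappa> - x) + b < 1 / (y - \<kappa>)" using xy by (simp add: field_simps)
  with R' show False by linarith
qed

text \<open>Rolle's theorem without derivatives, as the nonlinearity is merely continuous away from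
  the invariant interval. If both extreme values are taken at the ends, the function is constant and
  any interior point serves.\<close>

lemma equal_ends_extremum:
  fixes f :: "real \<Rightarrow> real"
  assumes ab: "a < b" and cont: "continuous_on {a..b} f" and eq: "f a = f b"
  obtains x where "x \<in> {a<..<b}" "(\<forall>\<^sub>F r in nhds x. f r \<le> f x) \<or> (\<forall>\<^sub>F r in nhds x. f x \<le> f r)"
proof -
  obtain x where x: "x \<in> {a..b}" "\<forall>r\<in>{a..b}. f r \<le> f x"
    using continuous_attains_sup[OF compact_Icc _ cont] ab by auto
  obtain z where z: "z \<in> {a..b}" "\<forall>r\<in>{a..b}. f z \<le> f r"
    using continuous_attains_inf[OF compact_Icc _ cont] ab by auto
  have ev: "\<forall>\<^sub>F r in nhds s. r \<in> {a..b}" if "s \<in> {a<..<b}" for s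
    using eventually_nhds_in_open[OF open_greaterThanLessThan that] by eventually_elim auto
  consider "x \<in> {a<..<b}" | "z \<in> {a<..<b}" | "f x = f a" "f z = f a" using x(1) z(1) eq by fastforce
  then show thesis
  proof cases
    case 1
    with ev[OF 1] x(2) that show thesis by (metis (mono_tags, lifting) eventually_mono)
  next
    case 2
    with ev[OF 2] z(2) that show thesis by (metis (mono_tags, lifting) eventually_mono)
  next
    case 3
    then have c: "f r = f a" if "r \<in> {a..b}" for r using x(2) z(2) that by force
    have mid: "(a + b) / 2 \<in> {a<..<b}" using ab by auto
    have "\<forall>\<^sub>F r in nhds ((a + b) / 2). f r \<le> f ((a + b) / 2)"
      using ev[OF mid]
    proof eventually_elim
      case (elim r)
      have "f ((a + b) / 2) = f a" by (rule c) (use ab in auto)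
      with c[OF elim] show ?case by linarith
    qed
    then show thesis using that mid by blast
  qed
qed

text \<open>Sharpens \<open>\<phi> 0 \<le> \<Gamma>\<close> at a global maximum: either the profile was at most \<open>\<kappa>\<close> at some time of
  the last delay interval, and then the equation bounds its growth since, or the delay term at \<open>0\<close> is
  itself reduced.\<close>

lemma profile_maximum_estimate:
  assumes c: "0 < c" and h: "0 \<le> h"
    and \<phi>: "\<And>t. (\<phi> has_real_derivative \<phi>1 t) (at t)" "\<And>t. (\<phi>1 has_real_derivative c * \<phi>1 t + \<phi> t - H t) (at t)"
    and max: "\<And>t. \<phi> t \<le> \<phi> 0" and H: "\<And>t. H t \<le> \<Gamma>" and \<Gamma>: "\<phi> 0 \<le> \<Gamma>" "\<kappa> \<le> \<Gamma>" and \<xi>: "\<xi> \<le> exp (- h)"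
    and delay: "(\<And>t. t \<in> {- (c * h)..0} \<Longrightarrow> \<kappa> < \<phi> t) \<Longrightarrow> H 0 \<le> (1 - \<xi>) * \<Gamma> + \<xi> * \<kappa>"
  shows "\<phi> 0 \<le> (1 - \<xi>) * \<Gamma> + \<xi> * \<kappa>"
proof -
  have crit: "\<phi>1 0 = 0"
    by (rule DERIV_local_max[OF \<phi>(1) zero_less_one]) (use max in auto)
  show ?thesis
  proof (cases "\<forall>t\<in>{- (c * h)..0}. \<kappa> < \<phi> t")
    case True
    \<comment> \<open>The second derivative test at the maximum: otherwise \<open>\<phi>1\<close>
      would increase from 0 and carry \<phi> above its maximum.\<close>
    have "\<phi> 0 \<le> H 0"
    proof (rule ccontr)
      assume "\<not> \<phi> 0 \<le> H 0"
      then have "0 < c * \<phi>1 0 + \<phi> 0 - H 0" by (simp add: crit)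
      from DERIV_pos_inc_right[OF \<phi>(2) this] obtain d where d: "0 < d" "\<And>s. 0 < s \<Longrightarrow> s < d \<Longrightarrow> 0 < \<phi>1 s"
        by (auto simp: crit)
      have "\<phi> 0 < \<phi> (d / 2)"
      proof (rule DERIV_pos_imp_increasing_open[where f=\<phi> and a=0 and b="d / 2"])
        show "\<exists>v. (\<phi> has_real_derivative v) (at s) \<and> 0 < v" if "0 < s" "s < d / 2" for s
          using d(2)[of s] \<phi>(1)[of s] that d(1) by auto
        show "continuous_on {0..d / 2} \<phi>" by (intro continuous_at_imp_continuous_on ballI DERIV_isCont[OF \<phi>(1)])
      qed (use d in auto)
      then show False using max[of "d / 2"] by simp
    qed
    then show ?thesis using delay True by force
  next
    case False
    then obtain \<tau> where \<tau>: "0 \<le> \<tau>" "\<tau> \<le> c * h" "\<phi> (- \<tau>) \<le> \<kappa>"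
      by (metis atLeastAtMost_iff minus_le_iff minus_minus neg_0_le_iff_le not_less)
    define l m where "l = lam c 1" and "m = mu c 1"
    have lm: "l + m = c" "l * m = - 1" "l < 0" "0 < m"
      using lam_plus_mu lam_mult_mu[of 1 c] lam_neg[of 1 c] mu_pos[of 1 c] by (auto simp: l_def m_def)
    define y where "y t = \<phi> t - \<Gamma>" for t
    have y: "(y has_real_derivative \<phi>1 t) (at t)" for t
      unfolding y_def[abs_def] by (auto intro!: derivative_eq_intros \<phi>)
    have y0: "y 0 \<le> 0" using \<Gamma> by (simp add: y_def)
    \<comment> \<open>\<open>W\<close>, and below \<open>q\<close>, invert the two first-order
      factors of the operator one after the other. Because of \<open>H \<le> \<Gamma>\<close> both
      derivatives have a sign, and integration runs backwards from the critical point 0 to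
      \<open>- \<tau>\<close>.\<close>
    define W where "W t = exp (- m * t) * (\<phi>1 t - l * y t)" for t
    have W: "(W has_real_derivative exp (- m * t) * (\<Gamma> - H t)) (at t)" for t
    proof -
      have "(W has_real_derivative exp (- m * t) * (- m) * (\<phi>1 t - l * y t) + exp (- m * t) * (c * \<phi>1 t + \<phi> t - H t - l * \<phi>1 t)) (at t)"
        unfolding W_def[abs_def] by (auto intro!: derivative_eq_intros \<phi> y simp: algebra_simps)
      also have "exp (- m * t) * (- m) * (\<phi>1 t - l * y t) + exp (- m * t) * (c * \<phi>1 t + \<phi> t - H t - l * \<phi>1 t)
         = exp (- m * t) * ((c - l - m) * \<phi>1 t + (l * m) * y t + \<phi> t - H t)"
        by (simp add: algebra_simps)
      also have "\<dots> = exp (- m * t) * (\<Gamma> - H t)" unfolding lm(2) using lm(1) by (simp add: y_def)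
      finally show ?thesis .
    qed
    have Wle: "W t \<le> - l * y 0" if "t \<le> 0" for t
    proof -
      have "W t \<le> W 0"
        by (rule DERIV_nonneg_imp_nondecreasing[where f=W, OF that]) (use W H in \<open>auto intro!: exI\<close>)
      then show ?thesis by (simp add: W_def crit)
    qed
    define q where "q t = exp (- l * t) * y t + l * y 0 / (m - l) * exp ((m - l) * t)" for t
    have q: "(q has_real_derivative exp ((m - l) * t) * (W t + l * y 0)) (at t)" for t
    proof -
      have "(q has_real_derivative exp (- l * t) * (- l) * y t + exp (- l * t) * \<phi>1 t + l * y 0 / (m - l) * (exp ((m - l) * t) * (m - l))) (at t)"
        unfolding q_def[abs_def]
        by (intro DERIV_add DERIV_cmult) (auto intro!: derivative_eq_intros y simp: algebra_simps)
      also have "l * y 0 / (m - l) * (exp ((m - l) * t) * (m - l)) = exp ((m - l) * t) * (l * y 0)"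
        using lm by simp
      also have "exp (- l * t) * (- l) * y t + exp (- l * t) * \<phi>1 t + exp ((m - l) * t) * (l * y 0) = exp ((m - l) * t) * (W t + l * y 0)"
      proof -
        have "exp ((m - l) * t) * exp (- m * t) = exp (- l * t)" by (simp add: algebra_simps flip: exp_add)
        then have "exp ((m - l) * t) * W t = exp (- l * t) * (\<phi>1 t - l * y t)" by (simp add: W_def flip: mult.assoc)
        then show ?thesis by (simp add: algebra_simps)
      qed
      finally show ?thesis .
    qed
    have "q 0 \<le> q (- \<tau>)"
    proof (rule DERIV_nonpos_imp_nonincreasing[where f=q])
      fix t assume "- \<tau> \<le> t" "t \<le> 0"
      then have "exp ((m - l) * t) * (W t + l * y 0) \<le> 0" using Wle[of t] by (intro mult_nonneg_nonpos) auto
      then show "\<exists>v. (q has_real_derivative v) (at t) \<and> v \<le> 0" using q by blast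
    qed (use \<tau> in simp)
    then have "(m - l) * (y 0 + l * y 0 / (m - l)) \<le> (m - l) * (exp (l * \<tau>) * y (- \<tau>) + l * y 0 / (m - l) * exp ((m - l) * - \<tau>))"
      using lm by (intro mult_left_mono) (auto simp: q_def)
    moreover have "(m - l) * (a + d / (m - l) * e) = (m - l) * a + d * e" "(m - l) * (a + d / (m - l)) = (m - l) * a + d" for a d e
      using lm by (simp_all add: distrib_left)
    ultimately have "(m - l) * y 0 + l * y 0 \<le> (m - l) * (exp (l * \<tau>) * y (- \<tau>)) + l * y 0 * exp ((m - l) * - \<tau>)"
      by (simp only:)
    then have "m * y 0 \<le> (m - l) * (exp (l * \<tau>) * y (- \<tau>)) + l * y 0 * exp ((m - l) * - \<tau>)"
      by (simp only: left_diff_distrib[of m l "y 0"] diff_add_cancel)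
    from mult_left_mono[OF this, of "exp (- l * \<tau>)"]
    have "exp (- l * \<tau>) * (m * y 0) \<le> (exp (- l * \<tau>) * exp (l * \<tau>)) * ((m - l) * y (- \<tau>)) + (exp (- l * \<tau>) * exp ((m - l) * - \<tau>)) * (l * y 0)"
      by (simp add: algebra_simps)
    moreover have "exp (- l * \<tau>) * exp (l * \<tau>) = 1" "exp (- l * \<tau>) * exp ((m - l) * - \<tau>) = exp (- m * \<tau>)"
      by (simp_all add: algebra_simps flip: exp_add)
    ultimately have main: "y 0 * (m * exp (- l * \<tau>) - l * exp (- m * \<tau>)) \<le> (m - l) * (\<kappa> - \<Gamma>)"
      using mult_left_mono[of "y (- \<tau>)" "\<kappa> - \<Gamma>" "m - l"] \<tau>(3) lm by (simp add: y_def algebra_simps)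
    \<comment> \<open>What is needed is \<open>m * exp (- l * \<tau>) - l * exp (- m * \<tau>) \<le>
      (m - l) * exp (\<tau> / c)\<close>; the relations \<open>l + m = c\<close> and
      \<open>l * m = - 1\<close> make the quotient \<open>D\<close> decreasing. The rate
      \<open>1 / c\<close> is chosen so that \<open>\<tau> \<le> c * h\<close> turns the exponential
      into \<open>exp h\<close>.\<close>
    define D where "D s = exp (- s / c) * (m * exp (- l * s) - l * exp (- m * s))" for s
    have "D \<tau> \<le> D 0"
    proof (rule DERIV_nonpos_imp_nonincreasing[where f=D, OF \<tau>(1)])
      fix s :: real assume "0 \<le> s"
      have "(D has_real_derivative exp (- s / c) * (- 1 / c) * (m * exp (- l * s) - l * exp (- m * s)) + exp (- s / c) * (m * (exp (- l * s) * - l) - l * (exp (- m * s) * - m))) (at s)"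
        unfolding D_def[abs_def] using c by (auto intro!: derivative_eq_intros simp: algebra_simps)
      also have "exp (- s / c) * (- 1 / c) * (m * exp (- l * s) - l * exp (- m * s)) + exp (- s / c) * (m * (exp (- l * s) * - l) - l * (exp (- m * s) * - m))
        = exp (- s / c) * (1 / c) * (- (m * exp (- l * s) - l * exp (- m * s)) + c * (- (l * m) * exp (- l * s) + (l * m) * exp (- m * s)))"
        using c by (simp add: field_simps)
      also have "- (m * exp (- l * s) - l * exp (- m * s)) + c * (- (l * m) * exp (- l * s) + (l * m) * exp (- m * s)) = l * exp (- l * s) - m * exp (- m * s)"
        unfolding lm(2) unfolding lm(1)[symmetric] by (simp add: algebra_simps)
      finally have "(D has_real_derivative exp (- s / c) * (1 / c) * (l * exp (- l * s) - m * exp (- m * s))) (at s)" .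
      moreover have "l * exp (- l * s) \<le> 0" "0 \<le> m * exp (- m * s)"
        using lm by (auto intro!: mult_nonpos_nonneg)
      then have "exp (- s / c) * (1 / c) * (l * exp (- l * s) - m * exp (- m * s)) \<le> 0"
        using c by (intro mult_nonneg_nonpos) auto
      ultimately show "\<exists>v. (D has_real_derivative v) (at s) \<and> v \<le> 0" by blast
    qed
    then have "exp (\<tau> / c) * D \<tau> \<le> exp (\<tau> / c) * (m - l)" by (intro mult_left_mono) (auto simp: D_def)
    moreover have "exp (\<tau> / c) * D \<tau> = m * exp (- l * \<tau>) - l * exp (- m * \<tau>)"
      by (simp add: D_def exp_minus)
    moreover have "exp (\<tau> / c) * (m - l) \<le> exp h * (m - l)"
      using \<tau>(2) c lm by (intro mult_right_mono) (auto simp: divide_le_eq mult.commute)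
    ultimately have "m * exp (- l * \<tau>) - l * exp (- m * \<tau>) \<le> exp h * (m - l)" by linarith
    from mult_left_mono_neg[OF this y0] main have "(m - l) * (y 0 * exp h) \<le> (m - l) * (\<kappa> - \<Gamma>)"
      by (simp add: algebra_simps)
    then have "y 0 * exp h \<le> \<kappa> - \<Gamma>" using lm by (simp add: mult_le_cancel_left_pos)
    then have "exp (- h) * (y 0 * exp h) \<le> exp (- h) * (\<kappa> - \<Gamma>)" by (intro mult_left_mono) auto
    also have "\<dots> \<le> \<xi> * (\<kappa> - \<Gamma>)" using \<xi> \<Gamma> by (intro mult_right_mono_neg) auto
    also have "exp (- h) * (y 0 * exp h) = y 0" by (simp add: exp_minus)
    finally show ?thesis by (simp add: y_def algebra_simps)
  qed
qed

lemma upper_limit_sequence: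
  fixes f :: "real \<Rightarrow> real"
  assumes bd: "\<And>t. \<bar>f t\<bar> \<le> B"
  obtains M T where "\<And>e. 0 < e \<Longrightarrow> \<forall>\<^sub>F t in at_top. f t < M + e" "filterlim T at_top sequentially" "(\<lambda>n. f (T n)) \<longlonglongrightarrow> M"
proof -
  define A where "A = {a. \<forall>\<^sub>F t in at_top. f t < a}"
  have low: "- B \<le> a" if "a \<in> A" for a
  proof -
    have "\<forall>\<^sub>F t :: real in at_top. - B \<le> a"
      using that[unfolded A_def, simplified] by eventually_elim (use bd in \<open>smt (verit)\<close>)
    then show ?thesis by simp
  qed
  have "B + 1 \<in> A" unfolding A_def using bd by (auto intro!: always_eventually simp: abs_le_iff) (smt (verit) bd)
  then have ne: "A \<noteq> {}" by blast
  have bb: "bdd_below A" using low by (rule bdd_belowI)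
  define M where "M = Inf A"
  have up: "\<forall>\<^sub>F t in at_top. f t < M + e" if "0 < e" for e
  proof -
    have "Inf A < M + e" using that by (simp add: M_def)
    then obtain a where "a \<in> A" "a < M + e" using cInf_lessD[OF ne] by blast
    then show ?thesis unfolding A_def by (auto elim: eventually_mono)
  qed
  have "\<exists>t\<ge>real n. M - 1 / real (Suc n) \<le> f t" for n
  proof (rule ccontr)
    assume "\<nexists>t. t \<ge> real n \<and> M - 1 / real (Suc n) \<le> f t"
    then have "M - 1 / real (Suc n) \<in> A"
      unfolding A_def mem_Collect_eq eventually_at_top_linorder by (meson not_le)
    then have "M \<le> M - 1 / real (Suc n)" unfolding M_def by (rule cInf_lower[OF _ bb])
    then show False by (simp add: divide_simps)
  qed
  then obtain T where T: "\<And>n. real n \<le> T n" "\<And>n. M - 1 / real (Suc n) \<le> f (T n)" by metis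
  have Tlim: "filterlim T at_top sequentially"
    by (rule filterlim_at_top_mono[OF filterlim_real_sequentially]) (use T in auto)
  have "(\<lambda>n. f (T n)) \<longlonglongrightarrow> M"
  proof (rule LIMSEQ_I)
    fix e :: real assume e: "0 < e"
    have "\<forall>\<^sub>F n in sequentially. f (T n) < M + e"
      using up[OF e] Tlim by (rule eventually_compose_filterlim)
    moreover have "(\<lambda>n. M - 1 / real (Suc n)) \<longlonglongrightarrow> M" by real_asymp
    then have "\<forall>\<^sub>F n in sequentially. M - e < M - 1 / real (Suc n)"
      using e by (intro order_tendstoD) auto
    ultimately have "\<forall>\<^sub>F n in sequentially. norm (f (T n) - M) < e"
      by eventually_elim (use T(2) in \<open>smt (verit) real_norm_def\<close>)
    then show "\<exists>N. \<forall>n\<ge>N. norm (f (T n) - M) < e" unfolding eventually_sequentially .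
  qed
  then show thesis using that up Tlim by blast
qed

section \<open>The kernel and the critical parameters\<close>

lemma card_zeros_strictly_convex:
  fixes f :: "real \<Rightarrow> real"
  assumes cont: "continuous_on UNIV f"
    and conv: "\<And>x y z. x < y \<Longrightarrow> y < z \<Longrightarrow> f y * (z - x) < f x * (z - y) + f z * (y - x)"
    and x0: "f x0 < 0" "a < x0" "0 < f a" "x0 < b" "0 < f b"
  shows "card {z. f z = 0} = 2"
proof -
  have c: "continuous_on S f" for S using cont by (rule continuous_on_subset) simp
  obtain r where r: "a \<le> r" "r \<le> x0" "f r = 0" using IVT2'[of f x0 0 a] x0 c by auto
  obtain s where s: "x0 \<le> s" "s \<le> b" "f s = 0" using IVT'[of f x0 0 b] x0 c by auto
  have rs: "r < s" using r s x0(1) by (cases "r = s") auto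
  have no3: False if "x < y" "y < z" "f x = 0" "f y = 0" "f z = 0" for x y z
    using conv[OF that(1,2)] that by simp
  have "z = r \<or> z = s" if "f z = 0" for z
    using no3[of z r s] no3[of r z s] no3[of r s z] that r s rs by (meson linorder_less_linear)
  then have "{z. f z = 0} = {r, s}" using r s by auto
  then show ?thesis using rs by simp
qed

text \<open>The points where a convex function is nonpositive form an interval; it avoids 0, hence
  lies on one side of 0.\<close>

lemma zeros_positive_strictly_convex:
  fixes f :: "real \<Rightarrow> real"
  assumes conv: "\<And>x y z. x < y \<Longrightarrow> y < z \<Longrightarrow> f y * (z - x) < f x * (z - y) + f z * (y - x)"
    and f0: "0 < f 0" and x0: "f x0 \<le> 0" "0 < x0" and r: "f r \<le> 0"
  shows "0 < r"
proof (rule ccontr)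
  assume "\<not> 0 < r"
  then have "r < 0" using f0 r by (cases "r = 0") auto
  have "f 0 * (x0 - r) < f r * (x0 - 0) + f x0 * (0 - r)" by (rule conv[OF \<open>r < 0\<close> x0(2)])
  also have "\<dots> \<le> 0" using x0 r \<open>r < 0\<close> by (intro add_nonpos_nonpos mult_nonpos_nonneg) auto
  finally show False using mult_pos_pos[OF f0, of "x0 - r"] x0 \<open>r < 0\<close> by simp
qed

locale kernel =
  fixes K :: "real \<Rightarrow> real"
  assumes K_nonneg: "\<And>s. 0 \<le> K s" and K_exp: "\<And>l. integrable lebesgue (\<lambda>s. K s * exp (l * s))"
    and K_one: "(\<integral>s. K s \<partial>lebesgue) = 1"
begin

text \<open>One family for both settings: \<open>psi\<close> uses
  \<open>J h (sqrt \<epsilon>)\<close>, the characteristic function at speed \<open>c\<close> uses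
  \<open>J (c * h) 1\<close>.\<close>

definition J :: "real \<Rightarrow> real \<Rightarrow> real \<Rightarrow> real" where
  "J a b w = (\<integral>s. K s * exp (- (w * (a + b * s))) \<partial>lebesgue)"

lemma J_integrable: "integrable lebesgue (\<lambda>s. K s * exp (- (w * (a + b * s))))"
proof -
  have "integrable lebesgue (\<lambda>s. exp (- w * a) * (K s * exp ((- w * b) * s)))"
    by (intro integrable_mult_right K_exp)
  also have "(\<lambda>s. exp (- w * a) * (K s * exp ((- w * b) * s))) = (\<lambda>s. K s * exp (- (w * (a + b * s))))"
    by (auto simp: fun_eq_iff algebra_simps simp flip: exp_add)
  finally show ?thesis .
qed

lemma J_eq: "J a b w = exp (- w * a) * J 0 1 (w * b)"
proof -
  have "J a b w = (\<integral>s. exp (- w * a) * (K s * exp (- (w * b * (0 + 1 * s)))) \<partial>lebesgue)"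
    unfolding J_def by (intro Bochner_Integration.integral_cong) (auto simp: algebra_simps simp flip: exp_add)
  then show ?thesis by (simp add: J_def)
qed

lemma psi_J: "psi K h p 1 z \<epsilon> = \<epsilon> * z\<^sup>2 - z - 1 + p * J h (sqrt \<epsilon>) z"
  unfolding psi_def J_eq[of h] by (simp add: J_def mult.commute mult.left_commute)

lemma J_nonneg: "0 \<le> J a b w"
  unfolding J_def using K_nonneg by (intro integral_nonneg_AE) auto

lemma J_zero: "J a b 0 = 1"
  by (simp add: J_def K_one)

lemma J_mono_shift:
  assumes "w * a \<le> w * a'" shows "J a' b w \<le> J a b w"
  unfolding J_def using assms K_nonneg
  by (intro integral_mono J_integrable mult_left_mono) (auto simp: algebra_simps)

lemma exp_three_points:
  assumes "x < y" "y < (z::real)"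
  shows "exp (- (y * k)) * (z - x) \<le> exp (- (x * k)) * (z - y) + exp (- (z * k)) * (y - x)"
proof -
  define u where "u = (y - x) / (z - x)"
  have u: "0 \<le> u" "u \<le> 1" "1 - u = (z - y) / (z - x)" using assms by (auto simp: u_def divide_simps)
  have "u * (z - x) = y - x" using assms by (simp add: u_def)
  then have y: "y = (1 - u) * x + u * z" by (simp add: algebra_simps)
  have "exp ((1 - u) *\<^sub>R (- (x * k)) + u *\<^sub>R (- (z * k))) \<le> (1 - u) * exp (- (x * k)) + u * exp (- (z * k))"
    using u by (intro convex_onD[OF exp_convex]) auto
  also have "(1 - u) *\<^sub>R (- (x * k)) + u *\<^sub>R (- (z * k)) = - (y * k)" by (simp add: y algebra_simps)
  finally have "exp (- (y * k)) * (z - x) \<le> ((1 - u) * exp (- (x * k)) + u * exp (- (z * k))) * (z - x)"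
    using assms by (intro mult_right_mono) auto
  also have "\<dots> = exp (- (x * k)) * ((1 - u) * (z - x)) + exp (- (z * k)) * (u * (z - x))" by (simp add: algebra_simps)
  also have "(1 - u) * (z - x) = z - y" using u(3) assms by simp
  finally show ?thesis using \<open>u * (z - x) = y - x\<close> by simp
qed

lemma J_three_points:
  assumes "x < y" "y < z"
  shows "J a b y * (z - x) \<le> J a b x * (z - y) + J a b z * (y - x)"
proof -
  have "J a b y * (z - x) = (\<integral>s. K s * exp (- (y * (a + b * s))) * (z - x) \<partial>lebesgue)" by (simp add: J_def)
  also have "\<dots> \<le> (\<integral>s. K s * exp (- (x * (a + b * s))) * (z - y) + K s * exp (- (z * (a + b * s))) * (y - x) \<partial>lebesgue)"
  proof (rule integral_mono)
    fix s
    show "K s * exp (- (y * (a + b * s))) * (z - x) \<le> K s * exp (- (x * (a + b * s))) * (z - y) + K s * exp (- (z * (a + b * s))) * (y - x)"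
      using mult_left_mono[OF exp_three_points[OF assms, of "a + b * s"] K_nonneg[of s]] by (simp add: algebra_simps)
  qed (intro Bochner_Integration.integrable_add integrable_mult_left J_integrable)+
  also have "\<dots> = J a b x * (z - y) + J a b z * (y - x)" by (simp add: J_def J_integrable)
  finally show ?thesis .
qed

text \<open>A finite convex function on the line is continuous, so no limit under the integral sign
  is needed.\<close>

lemma J_continuous: "continuous_on UNIV (J a b)"
proof (rule convex_on_continuous[OF open_UNIV])
  show "convex_on UNIV (J a b)"
  proof (rule convex_on_linorderI)
    fix t x y :: real assume t: "0 < t" "t < 1" and xy: "x < y"
    define m where "m = (1 - t) * x + t * y"
    have e: "m - x = t * (y - x)" "y - m = (1 - t) * (y - x)" by (auto simp: m_def algebra_simps)
    have "0 < m - x" "0 < y - m" unfolding e using t xy by auto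
    then have "J a b m * (y - x) \<le> J a b x * (y - m) + J a b y * (m - x)" by (intro J_three_points) auto
    also have "\<dots> = ((1 - t) * J a b x + t * J a b y) * (y - x)" unfolding e by (simp add: algebra_simps)
    finally show "J a b ((1 - t) *\<^sub>R x + t *\<^sub>R y) \<le> (1 - t) * J a b x + t * J a b y"
      using xy by (simp add: m_def)
  qed simp
qed

section \<open>Sign alternatives for \<open>psi\<close> and the critical parameters\<close>

context
  fixes h p :: real
  assumes h: "0 \<le> h" and p: "1 < p"
begin

abbreviation \<Psi> where "\<Psi> \<equiv> psi K h p 1"

lemma psi_zero: "0 < \<Psi> 0 \<epsilon>"
  using p by (simp add: psi_J J_zero)

lemma psi_ge: "\<epsilon> * z\<^sup>2 - z - 1 \<le> \<Psi> z \<epsilon>"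
  using p J_nonneg[of h "sqrt \<epsilon>" z] by (simp add: psi_J)

lemma psi_three_points:
  assumes "0 < \<epsilon>" "x < y" "y < z"
  shows "\<Psi> y \<epsilon> * (z - x) < \<Psi> x \<epsilon> * (z - y) + \<Psi> z \<epsilon> * (y - x)"
proof -
  define A where "A x = p * J h (sqrt \<epsilon>) x" for x
  have A: "\<Psi> x \<epsilon> = \<epsilon> * x\<^sup>2 - x - 1 + A x" for x by (simp add: psi_J A_def)
  have "A y * (z - x) \<le> A x * (z - y) + A z * (y - x)"
    using mult_left_mono[OF J_three_points[OF assms(2,3), of h "sqrt \<epsilon>"], of p] p by (simp add: A_def algebra_simps)
  moreover have "0 < \<epsilon> * ((y - x) * (z - y) * (z - x))" using assms by simp
  moreover have "(\<epsilon> * x\<^sup>2 - x - 1) * (z - y) + (\<epsilon> * z\<^sup>2 - z - 1) * (y - x) - (\<epsilon> * y\<^sup>2 - y - 1) * (z - x)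
      = \<epsilon> * ((y - x) * (z - y) * (z - x))" by (simp add: power2_eq_square algebra_simps)
  ultimately show ?thesis unfolding A by (simp add: algebra_simps)
qed

lemma psi_tendsto:
  assumes "Z \<longlonglongrightarrow> z" "X \<longlonglongrightarrow> \<epsilon>"
  shows "(\<lambda>n. \<Psi> (Z n) (X n)) \<longlonglongrightarrow> \<Psi> z \<epsilon>"
proof -
  have "isCont (J 0 1) (z * sqrt \<epsilon>)" using J_continuous by (simp add: continuous_on_eq_continuous_at)
  moreover have "(\<lambda>n. Z n * sqrt (X n)) \<longlonglongrightarrow> z * sqrt \<epsilon>" by (intro tendsto_intros assms)
  ultimately have "(\<lambda>n. J 0 1 (Z n * sqrt (X n))) \<longlonglongrightarrow> J 0 1 (z * sqrt \<epsilon>)" by (rule isCont_tendsto_compose)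
  then show ?thesis unfolding psi_J J_eq[of h] by (intro tendsto_intros assms)
qed

text \<open>In the variable \<open>x\<close> the parameter occurs only through
  \<open>1 / sqrt \<epsilon>\<close>, which is the speed. For fixed \<open>x\<close> the value is
  then monotone in the parameter, in opposite senses for positive and negative \<open>x\<close>;
  this orders the two alternatives below.\<close>

lemma psi_scale:
  assumes "0 < \<epsilon>"
  shows "\<Psi> (x / sqrt \<epsilon>) \<epsilon> = x\<^sup>2 - 1 / sqrt \<epsilon> * x - 1 + p * J (1 / sqrt \<epsilon> * h) 1 x"
proof -
  have "J h (sqrt \<epsilon>) (x / sqrt \<epsilon>) = J (1 / sqrt \<epsilon> * h) 1 x"
    unfolding J_eq[of h] J_eq[of "1 / sqrt \<epsilon> * h"] using assms by simp
  then show ?thesis using assms by (simp add: psi_J power_divide)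
qed

definition nonpos_right where "nonpos_right \<epsilon> \<longleftrightarrow> (\<exists>z>0. \<Psi> z \<epsilon> \<le> 0)"
definition nonpos_left where "nonpos_left \<epsilon> \<longleftrightarrow> (\<exists>z<0. \<Psi> z \<epsilon> \<le> 0)"

lemma psi_rescale_less:
  assumes "0 < \<epsilon>" "0 < \<epsilon>'" "x / sqrt \<epsilon> < x / sqrt \<epsilon>'"
  shows "\<Psi> (x / sqrt \<epsilon>') \<epsilon>' < \<Psi> (x / sqrt \<epsilon>) \<epsilon>"
proof -
  have le: "x * (1 / sqrt \<epsilon> * h) \<le> x * (1 / sqrt \<epsilon>' * h)"
    using mult_right_mono[OF less_imp_le[OF assms(3)] h] by simp
  have "p * J (1 / sqrt \<epsilon>' * h) 1 x \<le> p * J (1 / sqrt \<epsilon> * h) 1 x"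
    by (rule mult_left_mono[OF J_mono_shift[OF le]]) (use p in simp)
  then show ?thesis unfolding psi_scale[OF assms(1)] psi_scale[OF assms(2)] using assms(3) by simp
qed

lemma nonpos_right_less:
  assumes "nonpos_right \<epsilon>" "0 < \<epsilon>'" "\<epsilon>' < \<epsilon>" shows "\<exists>z>0. \<Psi> z \<epsilon>' < 0"
proof -
  obtain z where z: "0 < z" "\<Psi> z \<epsilon> \<le> 0" using assms(1) unfolding nonpos_right_def by blast
  define x where "x = z * sqrt \<epsilon>"
  have x: "0 < x" "z = x / sqrt \<epsilon>" using z assms by (auto simp: x_def)
  have "\<Psi> (x / sqrt \<epsilon>') \<epsilon>' < \<Psi> (x / sqrt \<epsilon>) \<epsilon>"
    using assms x(1) by (intro psi_rescale_less divide_strict_left_mono) auto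
  then show ?thesis using z x assms by (intro exI[of _ "x / sqrt \<epsilon>'"]) auto
qed

lemma nonpos_left_greater:
  assumes "nonpos_left \<epsilon>" "0 < \<epsilon>" "\<epsilon> < \<epsilon>'" shows "\<exists>z<0. \<Psi> z \<epsilon>' < 0"
proof -
  obtain z where z: "z < 0" "\<Psi> z \<epsilon> \<le> 0" using assms(1) unfolding nonpos_left_def by blast
  define x where "x = z * sqrt \<epsilon>"
  have x: "x < 0" "z = x / sqrt \<epsilon>" using z assms by (auto simp: x_def mult_neg_pos)
  have "\<Psi> (x / sqrt \<epsilon>') \<epsilon>' < \<Psi> (x / sqrt \<epsilon>) \<epsilon>"
    using assms x(1) by (intro psi_rescale_less divide_strict_left_mono_neg) auto
  then show ?thesis using z x assms by (intro exI[of _ "x / sqrt \<epsilon>'"]) (auto simp: divide_neg_pos)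
qed

lemma nonpos_right_not_left: "0 < \<epsilon> \<Longrightarrow> nonpos_right \<epsilon> \<Longrightarrow> nonpos_left \<epsilon> \<Longrightarrow> False"
  using zeros_positive_strictly_convex[of "\<lambda>z. \<Psi> z \<epsilon>", OF psi_three_points psi_zero]
  unfolding nonpos_right_def nonpos_left_def by (meson less_asym)

text \<open>The quadratic term confines nonpositive values to a compact set as long as the parameter
  stays away from 0. Since \<open>psi\<close> is positive at 0, limits of such points keep their
  sign, and both alternatives are closed in the parameter.\<close>

lemma psi_nonpos_bound:
  assumes "\<Psi> z X \<le> 0" "0 < e" "e \<le> X" shows "\<bar>z\<bar> \<le> max 1 (2 / e)"
proof (rule ccontr)
  assume "\<not> \<bar>z\<bar> \<le> max 1 (2 / e)"
  then have z: "1 < \<bar>z\<bar>" "2 / e < \<bar>z\<bar>" by auto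
  have "2 * \<bar>z\<bar> < e * \<bar>z\<bar> * \<bar>z\<bar>" using z assms(2) by (intro mult_strict_right_mono) (auto simp: field_simps)
  also have "\<dots> \<le> X * z\<^sup>2" using assms(3) by (simp add: power2_eq_square mult_right_mono mult.assoc)
  also have "\<dots> \<le> z + 1" using psi_ge[of X z] assms(1) by simp
  finally show False using z(1) by (simp add: abs_if split: if_splits)
qed

lemma nonpos_closed:
  assumes X: "X \<longlonglongrightarrow> \<epsilon>" "0 < \<epsilon>" and Z: "\<And>n. \<Psi> (Z n) (X n) \<le> 0"
  obtains z k where "strict_mono (k::nat\<Rightarrow>nat)" "(\<lambda>n. Z (k n)) \<longlonglongrightarrow> z" "\<Psi> z \<epsilon> \<le> 0"
proof -
  have "\<forall>\<^sub>F n in sequentially. \<epsilon> / 2 < X n" using X by (intro order_tendstoD) auto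
  then obtain N where N: "\<And>n. N \<le> n \<Longrightarrow> \<epsilon> / 2 < X n" unfolding eventually_sequentially by blast
  have "\<bar>Z (n + N)\<bar> \<le> max 1 (2 / (\<epsilon> / 2))" for n
    by (rule psi_nonpos_bound[OF Z]) (use X(2) N[of "n + N"] in auto)
  then have "bounded (range (\<lambda>n. Z (n + N)))" unfolding bounded_iff by auto
  from bounded_imp_convergent_subsequence[OF this]
  obtain z k where k: "strict_mono (k::nat\<Rightarrow>nat)" "((\<lambda>n. Z (n + N)) \<circ> k) \<longlonglongrightarrow> z" by auto
  have m: "strict_mono (\<lambda>n. k n + N)" using k(1) by (simp add: strict_mono_def)
  have zl: "(\<lambda>n. Z (k n + N)) \<longlonglongrightarrow> z" using k(2) by (simp add: o_def)
  have "(\<lambda>n. \<Psi> (Z (k n + N)) (X (k n + N))) \<longlonglongrightarrow> \<Psi> z \<epsilon>"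
    using LIMSEQ_subseq_LIMSEQ[OF X(1) m] by (intro psi_tendsto zl) (simp add: o_def)
  then have "\<Psi> z \<epsilon> \<le> 0" using Z by (intro tendsto_upperbound) auto
  then show thesis using that m zl by blast
qed

lemma nonpos_right_closed:
  assumes X: "X \<longlonglongrightarrow> \<epsilon>" "0 < \<epsilon>" and nonpos_right: "\<And>n. nonpos_right (X n)" shows "nonpos_right \<epsilon>"
proof -
  obtain Z where Z: "\<And>n. 0 < Z n" "\<And>n. \<Psi> (Z n) (X n) \<le> 0" using nonpos_right unfolding nonpos_right_def by metis
  obtain z k where z: "(\<lambda>n. Z (k n)) \<longlonglongrightarrow> z" "\<Psi> z \<epsilon> \<le> 0" by (rule nonpos_closed[OF X Z(2)]) blast
  have "0 \<le> z" using Z(1) by (intro tendsto_lowerbound[OF z(1)]) (auto intro: always_eventually less_imp_le)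
  moreover have "z \<noteq> 0" using psi_zero[of \<epsilon>] z(2) by auto
  ultimately show ?thesis using z(2) unfolding nonpos_right_def by (intro exI[of _ z]) auto
qed

lemma nonpos_left_closed:
  assumes X: "X \<longlonglongrightarrow> \<epsilon>" "0 < \<epsilon>" and nonpos_left: "\<And>n. nonpos_left (X n)" shows "nonpos_left \<epsilon>"
proof -
  obtain Z where Z: "\<And>n. Z n < 0" "\<And>n. \<Psi> (Z n) (X n) \<le> 0" using nonpos_left unfolding nonpos_left_def by metis
  obtain z k where z: "(\<lambda>n. Z (k n)) \<longlonglongrightarrow> z" "\<Psi> z \<epsilon> \<le> 0" by (rule nonpos_closed[OF X Z(2)]) blast
  have "z \<le> 0" using Z(1) by (intro tendsto_upperbound[OF z(1)]) (auto intro: always_eventually less_imp_le)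
  moreover have "z \<noteq> 0" using psi_zero[of \<epsilon>] z(2) by auto
  ultimately show ?thesis using z(2) unfolding nonpos_left_def by (intro exI[of _ z]) auto
qed

lemma nonpos_right_exists: "\<exists>\<epsilon>>0. nonpos_right \<epsilon>"
proof -
  \<comment> \<open>At speed \<open>k\<close> and rescaled variable 1 the expression is
    \<open>1 - k - 1 + p * J (k * h) 1 1\<close>, and a delay only decreases the integral.\<close>
  define k where "k = max 1 (p * J 0 1 1)"
  have k: "1 \<le> k" "p * J 0 1 1 \<le> k" by (auto simp: k_def)
  define \<epsilon> where "\<epsilon> = 1 / k\<^sup>2"
  have \<epsilon>: "0 < \<epsilon>" "1 / sqrt \<epsilon> = k" using k by (auto simp: \<epsilon>_def real_sqrt_divide)
  have "J (k * h) 1 1 \<le> J 0 1 1" using k h by (intro J_mono_shift) auto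
  then have "p * J (k * h) 1 1 \<le> k" using k(2) p by (smt (verit) mult_left_mono)
  then have "\<Psi> (1 / sqrt \<epsilon>) \<epsilon> \<le> 0" using psi_scale[OF \<epsilon>(1), of 1] \<epsilon>(2) by simp
  moreover have "0 < 1 / sqrt \<epsilon>" using \<epsilon>(1) by simp
  ultimately show ?thesis using \<epsilon>(1) unfolding nonpos_right_def by blast
qed

lemma psi_two_zeros:
  assumes "0 < \<epsilon>" "\<Psi> x0 \<epsilon> < 0" shows "card {z. \<Psi> z \<epsilon> = 0} = 2"
proof -
  \<comment> \<open>Large enough that \<open>\<epsilon> * b\<^sup>2 > 2 * b > b + 1\<close>, so the
    quadratic part alone is positive at both \<open>b\<close> and \<open>- b\<close>.\<close>
  define b where "b = \<bar>x0\<bar> + 2 + 2 / \<epsilon>"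
  have d: "0 < 2 / \<epsilon>" and "0 \<le> \<epsilon> * \<bar>x0\<bar>" using assms(1) by auto
  then have b1: "2 < \<epsilon> * b" unfolding b_def using assms(1) by (simp add: distrib_left add_nonneg_pos)
  have b: "2 < \<epsilon> * b" "1 < b" "x0 < b" "- b < x0" using b1 d unfolding b_def by linarith+
  have "2 * b < \<epsilon> * b\<^sup>2" using mult_strict_right_mono[OF b(1), of b] b by (simp add: power2_eq_square mult.assoc)
  then have "0 < \<Psi> b \<epsilon>" "0 < \<Psi> (- b) \<epsilon>" using psi_ge[of \<epsilon> b] psi_ge[of \<epsilon> "- b"] b by auto
  moreover have "continuous_on UNIV (\<lambda>z. \<Psi> z \<epsilon>)"
    unfolding psi_J by (intro continuous_intros J_continuous)
  ultimately show ?thesis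
    using assms(2) b by (intro card_zeros_strictly_convex[of "\<lambda>z. \<Psi> z \<epsilon>" x0 "- b" b] psi_three_points assms(1)) auto
qed

lemma psi_zeros_positive:
  assumes "0 < \<epsilon>" "0 < x0" "\<Psi> x0 \<epsilon> < 0" "\<Psi> z \<epsilon> = 0" shows "0 < z"
  using zeros_positive_strictly_convex[of "\<lambda>z. \<Psi> z \<epsilon>" x0 z] psi_three_points[OF assms(1)] psi_zero assms by auto

lemma psi_zeros_negative:
  assumes "0 < \<epsilon>" "x0 < 0" "\<Psi> x0 \<epsilon> < 0" "\<Psi> z \<epsilon> = 0" shows "z < 0"
proof -
  have "0 < z \<Longrightarrow> False"
    using zeros_positive_strictly_convex[of "\<lambda>z. \<Psi> z \<epsilon>" z x0] psi_three_points[OF assms(1)] psi_zero assms by auto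
  moreover have "z \<noteq> 0" using psi_zero[of \<epsilon>] assms(4) by auto
  ultimately show ?thesis by (meson linorder_cases)
qed

definition e0 :: ereal where "e0 = Sup (ereal ` {\<epsilon>. 0 < \<epsilon> \<and> nonpos_right \<epsilon>})"
definition e1 :: ereal where "e1 = Inf (ereal ` {\<epsilon>. 0 < \<epsilon> \<and> nonpos_left \<epsilon>})"

lemma nonpos_right_below_e0:
  assumes "0 < \<epsilon>" "ereal \<epsilon> < e0" shows "\<exists>z>0. \<Psi> z \<epsilon> < 0"
  using assms nonpos_right_less unfolding e0_def less_Sup_iff by auto

lemma nonpos_left_above_e1:
  assumes "e1 < ereal \<epsilon>" shows "\<exists>z<0. \<Psi> z \<epsilon> < 0"
  using assms nonpos_left_greater unfolding e1_def Inf_less_iff by auto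

lemma e0_pos: "0 < e0"
proof -
  obtain \<epsilon> where "0 < \<epsilon>" "nonpos_right \<epsilon>" using nonpos_right_exists by blast
  then show ?thesis unfolding e0_def less_Sup_iff by (intro bexI[of _ "ereal \<epsilon>"]) auto
qed

lemma nonpos_right_at_e0:
  assumes "e0 = ereal x" shows "0 < x" "nonpos_right x"
proof -
  show x: "0 < x" using e0_pos assms by simp
  define X where "X n = x - x / (real n + 2)" for n
  have "x / (real n + 2) < x" "0 < x / (real n + 2)" for n using x by (auto simp: divide_less_eq)
  then have "0 < X n" "X n < x" for n by (simp_all add: X_def)
  then have "nonpos_right (X n)" for n using nonpos_right_below_e0[of "X n"] assms unfolding nonpos_right_def by (auto intro: less_imp_le)
  moreover have "X \<longlonglongrightarrow> x" unfolding X_def by real_asymp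
  ultimately show "nonpos_right x" using nonpos_right_closed x by blast
qed

text \<open>At a finite common value both alternatives would hold, by closedness from the left and
  from the right; but the nonpositive values of \<open>psi\<close> lie on one side of 0.\<close>

lemma e0_neq_e1:
  assumes "e0 = e1" shows "e0 = \<infinity>"
proof (rule ccontr)
  assume "e0 \<noteq> \<infinity>"
  then obtain x where x: "e0 = ereal x" using e0_pos by (cases e0) auto
  note xp = nonpos_right_at_e0[OF x]
  define X where "X n = x + 1 / (real n + 1)" for n
  have "x < X n" for n by (simp add: X_def)
  then have "nonpos_left (X n)" for n using nonpos_left_above_e1[of "X n"] x assms unfolding nonpos_left_def by (auto intro: less_imp_le)
  moreover have "X \<longlonglongrightarrow> x" unfolding X_def by real_asymp
  ultimately have "nonpos_left x" using nonpos_left_closed xp by blast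
  then show False using nonpos_right_not_left xp by blast
qed

lemma e0_le_e1: "e0 \<le> e1"
  unfolding e0_def e1_def
proof (intro Sup_least Inf_greatest, clarsimp)
  fix x y assume "0 < x" "nonpos_right x" "0 < y" "nonpos_left y"
  show "x \<le> y"
  proof (rule ccontr)
    assume "\<not> x \<le> y"
    then have "nonpos_left x" using nonpos_left_greater[OF \<open>nonpos_left y\<close> \<open>0 < y\<close>, of x] unfolding nonpos_left_def by (auto intro: less_imp_le)
    then show False using nonpos_right_not_left \<open>0 < x\<close> \<open>nonpos_right x\<close> by blast
qed
  qed

lemma critical_e0_e1: "critical_eps K h p 1 e0 e1"
  unfolding critical_eps_def
proof (intro conjI allI impI)
  show "0 < e0" by (rule e0_pos)
  show "e0 \<le> e1" by (rule e0_le_e1)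
next
  fix \<epsilon> assume "0 < \<epsilon> \<and> ereal \<epsilon> < e0"
  then obtain x0 where x0: "0 < \<epsilon>" "0 < x0" "\<Psi> x0 \<epsilon> < 0" using nonpos_right_below_e0 by blast
  show "card {z. \<Psi> z \<epsilon> = 0} = 2" by (rule psi_two_zeros[OF x0(1,3)])
  show "0 < z" if "\<Psi> z \<epsilon> = 0" for z by (rule psi_zeros_positive[OF x0 that])
next
  fix \<epsilon> z assume \<epsilon>: "e0 < ereal \<epsilon> \<and> ereal \<epsilon> < e1"
  then have pos: "0 < \<epsilon>" using e0_pos by (metis ereal_less(2) less_trans)
  have "\<not> nonpos_right \<epsilon>"
  proof
    assume "nonpos_right \<epsilon>"
    then have "ereal \<epsilon> \<le> e0" unfolding e0_def using pos by (intro Sup_upper) auto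
    then show False using \<epsilon> by (auto dest: leD)
  qed
  moreover have "\<not> nonpos_left \<epsilon>"
  proof
    assume "nonpos_left \<epsilon>"
    then have "e1 \<le> ereal \<epsilon>" unfolding e1_def using pos by (intro Inf_lower) auto
    then show False using \<epsilon> by (auto dest: leD)
  qed
  ultimately show "0 < \<Psi> z \<epsilon>" unfolding nonpos_right_def nonpos_left_def using psi_zero[of \<epsilon>]
    by (cases z "0::real" rule: linorder_cases) (auto simp: not_le)
next
  fix \<epsilon> assume \<epsilon>: "e1 < ereal \<epsilon>"
  have pos: "0 < \<epsilon>" using e0_le_e1 \<epsilon> e0_pos by (metis ereal_less(2) le_less_trans less_trans)
  obtain x0 where x0: "x0 < 0" "\<Psi> x0 \<epsilon> < 0" using nonpos_left_above_e1[OF \<epsilon>] by blast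
  show "card {z. \<Psi> z \<epsilon> = 0} = 2" by (rule psi_two_zeros[OF pos x0(2)])
  show "z < 0" if "\<Psi> z \<epsilon> = 0" for z by (rule psi_zeros_negative[OF pos x0 that])
next
  show "e0 = e1 \<longleftrightarrow> e0 = \<infinity> \<and> e1 = \<infinity>" using e0_neq_e1 by auto
qed

end

text \<open>Gives uniqueness. A finite \<open>a\<close> is strictly below \<open>b\<close>, so just
  above \<open>a\<close> the first pair forbids zeros, while the second pair still demands two of
  them.\<close>

lemma critical_eps_not_less:
  assumes "critical_eps K h p q a b" "critical_eps K h p q a' b'" "a < a'" shows False
proof -
  have "a \<noteq> \<infinity>" using assms(3) by auto
  moreover have "a \<le> b" "a = b \<longleftrightarrow> a = \<infinity> \<and> b = \<infinity>" using assms(1) unfolding critical_eps_def by blast+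
  ultimately have "a < b" by auto
  then have "a < min a' b" using assms(3) by simp
  then obtain \<epsilon> where \<epsilon>: "a < ereal \<epsilon>" "ereal \<epsilon> < a'" "ereal \<epsilon> < b" using ereal_dense2 by (metis min_less_iff_conj)
  have "0 < a" using assms(1) unfolding critical_eps_def by blast
  then have "0 < \<epsilon>" using \<epsilon>(1) by (metis ereal_less(2) less_trans)
  then have "card {z. psi K h p q z \<epsilon> = 0} = 2" using assms(2) \<epsilon> unfolding critical_eps_def by blast
  moreover have "0 < psi K h p q z \<epsilon>" for z using assms(1) \<epsilon> unfolding critical_eps_def by blast
  then have "psi K h p q z \<epsilon> \<noteq> 0" for z by (metis less_irrefl)
  ultimately show False by simp
qed

text \<open>The speed \<open>c\<close> corresponds to the parameter \<open>1 / c\<^sup>2\<close>,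
  which is at most the critical one. The critical speed itself is included because the right
  alternative is closed.\<close>

lemma nonpos_at_supercritical_speed:
  assumes h: "0 \<le> h" and p: "1 < p" and c: "0 < c"
    and speed: "(if eps0 K h p 1 = \<infinity> then 0 else real_of_ereal (eps0 K h p 1) powr (- 1 / 2)) \<le> c"
  obtains x where "0 < x" "x\<^sup>2 - c * x - 1 + p * J (c * h) 1 x \<le> 0"
proof -
  note crit = critical_e0_e1[OF h p]
  have e: "eps0 K h p 1 = e0 h p"
    unfolding eps0_def
  proof (rule the_equality)
    show "\<exists>e1. critical_eps K h p 1 (e0 h p) e1" using crit by blast
    show "a = e0 h p" if "\<exists>b. critical_eps K h p 1 a b" for a
      using that crit critical_eps_not_less by (metis linorder_less_linear)
  qed
  define \<epsilon> where "\<epsilon> = 1 / c\<^sup>2"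
  have \<epsilon>: "0 < \<epsilon>" "1 / sqrt \<epsilon> = c" using c by (auto simp: \<epsilon>_def real_sqrt_divide)
  have "nonpos_right h p \<epsilon>"
  proof (cases "e0 h p = \<infinity>")
    case True
    then show ?thesis using nonpos_right_below_e0[OF h p \<epsilon>(1)] unfolding nonpos_right_def[OF h p] by (auto intro: less_imp_le)
  next
    case False
    then obtain x where x: "e0 h p = ereal x" using e0_pos[OF h p] by (cases "e0 h p") auto
    note xp = nonpos_right_at_e0[OF h p x]
    have "x powr (- 1 / 2) \<le> c" using speed x by (simp add: e)
    moreover have "x powr (- 1 / 2) = 1 / sqrt x"
      using powr_minus_divide[of x "1 / 2"] powr_half_sqrt[OF less_imp_le[OF xp(1)]] by simp
    ultimately have "1 / sqrt x \<le> c" by simp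
    then have "(1 / sqrt x)\<^sup>2 \<le> c\<^sup>2" using xp(1) by (intro power_mono) auto
    then have "\<epsilon> \<le> x" using xp(1) c by (simp add: \<epsilon>_def power_divide field_simps)
    then show ?thesis
      using nonpos_right_less[OF h p xp(2) \<epsilon>(1)] xp(2) unfolding nonpos_right_def[OF h p] by (cases "\<epsilon> = x") (auto intro: less_imp_le)
  qed
  then obtain z where z: "0 < z" "psi K h p 1 z \<epsilon> \<le> 0" unfolding nonpos_right_def[OF h p] by blast
  have "psi K h p 1 (z * sqrt \<epsilon> / sqrt \<epsilon>) \<epsilon> \<le> 0" using z \<epsilon> by simp
  then have "(z * sqrt \<epsilon>)\<^sup>2 - c * (z * sqrt \<epsilon>) - 1 + p * J (c * h) 1 (z * sqrt \<epsilon>) \<le> 0"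
    unfolding psi_scale[OF h p \<epsilon>(1)] \<epsilon>(2) .
  then show thesis using that z \<epsilon> by (metis mult_pos_pos real_sqrt_gt_0_iff)
qed

end

section \<open>The law of the delayed shift\<close>

context kernel begin

text \<open>The law of \<open>- s - d\<close> for \<open>s\<close> distributed with density \<open>K\<close>: it turns the nonlocal delayed
  term of the equation with \<open>d = c * h\<close> into an average over shifts of the profile.\<close>

definition law :: "real \<Rightarrow> real measure" where
  "law d = distr (density lebesgue (\<lambda>s. ennreal (K s))) borel (\<lambda>s. - s - d)"

lemma K_measurable [measurable]: "K \<in> borel_measurable lebesgue"
  using borel_measurable_integrable[OF K_exp[of 0]] by simp

lemma shift_measurable [measurable]: "(\<lambda>s. - s - d) \<in> lebesgue \<rightarrow>\<^sub>M (borel :: real measure)"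
  by (rule measurable_completion) measurable

lemma sets_law: "sets (law d) = sets borel"
  by (simp add: law_def)

lemma prob_space_law: "prob_space (law d)"
proof -
  have "integrable lebesgue K" using K_exp[of 0] by simp
  then have "(\<integral>\<^sup>+ s. ennreal (K s) \<partial>lebesgue) = 1"
    using K_nonneg K_one by (subst nn_integral_eq_integral) auto
  then have "prob_space (density lebesgue (\<lambda>s. ennreal (K s)))"
    by (intro prob_spaceI) (simp add: emeasure_density)
  then show ?thesis unfolding law_def by (rule prob_space.prob_space_distr) simp
qed

lemma
  fixes f :: "real \<Rightarrow> real" assumes f: "f \<in> borel_measurable borel"
  shows integrable_law: "integrable (law d) f \<longleftrightarrow> integrable lebesgue (\<lambda>s. K s * f (- s - d))"
    and integral_law: "(\<integral>r. f r \<partial>law d) = (\<integral>s. K s * f (- s - d) \<partial>lebesgue)"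
proof -
  have fs: "(\<lambda>s. f (- s - d)) \<in> borel_measurable lebesgue"
    by (rule measurable_compose[OF shift_measurable f])
  show "integrable (law d) f \<longleftrightarrow> integrable lebesgue (\<lambda>s. K s * f (- s - d))"
    unfolding law_def using fs f K_nonneg
    by (subst integrable_distr_eq) (auto simp: integrable_density)
  show "(\<integral>r. f r \<partial>law d) = (\<integral>s. K s * f (- s - d) \<partial>lebesgue)"
    unfolding law_def using fs f K_nonneg
    by (subst integral_distr) (auto simp: integral_density)
qed

lemma law_exp: "integrable (law d) (\<lambda>r. exp (l * r))" "(\<integral>r. exp (l * r) \<partial>law d) = J d 1 l"
proof -
  have eq: "(\<lambda>s. K s * exp (l * (- s - d))) = (\<lambda>s. K s * exp (- (l * (d + 1 * s))))"
    by (auto simp: algebra_simps fun_eq_iff)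
  show "integrable (law d) (\<lambda>r. exp (l * r))"
    by (subst integrable_law) (simp_all add: eq J_integrable[where b=1, simplified])
  show "(\<integral>r. exp (l * r) \<partial>law d) = J d 1 l"
    by (subst integral_law) (simp_all add: eq J_def[where b=1, simplified])
qed

text \<open>The substitution \<open>y = x - s\<close> turns the convolution into an average over
  \<open>law d\<close>, a Borel measure even though the kernel is only Lebesgue measurable.\<close>

lemma convolution_law:
  fixes f :: "real \<Rightarrow> real" assumes f: "f \<in> borel_measurable borel" "\<And>x. \<bar>f x\<bar> \<le> C"
  shows "integrable lebesgue (\<lambda>y. K (x - y) * f (y + b))"
    and "(\<integral>y. K (x - y) * f (y + b) \<partial>lebesgue) = (\<integral>r. f (x + b + d + r) \<partial>law d)"
proof -
  interpret L: prob_space "law d" by (rule prob_space_law)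
  define F where "F s = K s * f (x + b + d + (- s - d))" for s
  have m: "(\<lambda>r. f (x + b + d + r)) \<in> borel_measurable borel" using f(1) by measurable
  have F: "(\<lambda>y. K (x - y) * f (y + b)) = (\<lambda>y. F (x + (- 1) * y))"
    by (auto simp: F_def fun_eq_iff algebra_simps)
  have "integrable (law d) (\<lambda>r. f (x + b + d + r))"
    by (rule L.integrable_const_bound[where B=C]) (use f m in \<open>auto simp: measurable_cong_sets[OF sets_law refl]\<close>)
  then have "integrable lebesgue F" unfolding F_def using integrable_law[OF m] by simp
  then show "integrable lebesgue (\<lambda>y. K (x - y) * f (y + b))"
    unfolding F by (subst lebesgue_integrable_real_affine_iff) auto
  have "(\<integral>s. F s \<partial>lebesgue) = (\<integral>y. F (x + (- 1) * y) \<partial>lebesgue)"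
    using lebesgue_integral_real_affine[of "- 1" F x] by simp
  then show "(\<integral>y. K (x - y) * f (y + b) \<partial>lebesgue) = (\<integral>r. f (x + b + d + r) \<partial>law d)"
    unfolding F integral_law[OF m] F_def by simp
qed

text \<open>The reflection of \<open>s\<close> to \<open>- s - d\<close> maps
  \<open>{- d..0}\<close> onto itself, so this interval has the same mass under \<open>law d\<close>
  as under the density \<open>K\<close>; a smaller window has less.\<close>

lemma law_interval_ge:
  assumes "0 \<le> d'" "d' \<le> d"
  shows "(LINT u:{- d'..0}|lebesgue. K u) \<le> measure (law d) {- d..0}"
    and "0 \<le> (LINT u:{- d'..0}|lebesgue. K u)"
proof -
  interpret L: prob_space "law d" by (rule prob_space_law)
  have iK: "integrable lebesgue K" using K_exp[of 0] by simp
  have ind: "integrable lebesgue (\<lambda>s. indicator A s * K s)" if "A \<in> sets lebesgue" for A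
    using integrable_mult_indicator[OF that iK] by simp
  have "measure (law d) {- d..0} = (\<integral>r. indicator {- d..0} r \<partial>law d)"
    by (simp add: sets_law)
  also have "\<dots> = (\<integral>s. K s * indicator {- d..0} (- s - d) \<partial>lebesgue)" by (rule integral_law) simp
  also have "(\<lambda>s. K s * indicator {- d..0} (- s - d)) = (\<lambda>s. indicator {- d..0} s * K s)"
    by (auto simp: indicator_def fun_eq_iff)
  finally have eq: "measure (law d) {- d..0} = (\<integral>s. indicator {- d..0} s * K s \<partial>lebesgue)" .
  show "(LINT u:{- d'..0}|lebesgue. K u) \<le> measure (law d) {- d..0}"
    unfolding eq set_lebesgue_integral_def
    using assms K_nonneg by (simp, intro integral_mono ind) (auto simp: indicator_def)
  show "0 \<le> (LINT u:{- d'..0}|lebesgue. K u)"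
    unfolding set_lebesgue_integral_def using K_nonneg by (intro integral_nonneg_AE) auto
qed

end

section \<open>Limits at infinity\<close>

context profile_equation begin

definition profile :: "(real \<Rightarrow> real) \<Rightarrow> bool" where
  "profile \<phi> \<longleftrightarrow> \<phi> \<in> borel_measurable borel \<and> (\<forall>t. 0 < \<phi> t) \<and> (\<forall>t. \<phi> t = resolv c 1 (act \<phi>) t)"

lemma profileD:
  assumes "profile \<phi>"
  shows "\<phi> \<in> borel_measurable borel" "\<And>t. 0 < \<phi> t" "\<And>t. \<phi> t = resolv c 1 (act \<phi>) t"
    "harnack c \<phi>" "continuous_on UNIV \<phi>" "\<And>t. \<phi> t \<le> B"
proof -
  show p: "\<phi> \<in> borel_measurable borel" "\<And>t. 0 < \<phi> t" "\<And>t. \<phi> t = resolv c 1 (act \<phi>) t"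
    using assms unfolding profile_def by blast+
  show "harnack c \<phi>" "continuous_on UNIV \<phi>"
    using forcedD[OF forced_one[OF p] zero_le_one order_refl] by auto
  have ab: "\<bar>act \<phi> t\<bar> \<le> B" for t using act_bounds[OF p(1), of t] by simp
  show "\<phi> t \<le> B" for t
    using abs_resolv_le[OF zero_less_one act_measurable[OF p(1)] ab, of c t] p(3)[of t] by simp
qed

lemma profile_ode:
  assumes "profile \<phi>"
  obtains \<phi>1 where "\<And>t. (\<phi> has_real_derivative \<phi>1 t) (at t)"
    "\<And>t. (\<phi>1 has_real_derivative c * \<phi>1 t + \<phi> t - act \<phi> t) (at t)"
proof -
  note p = profileD[OF assms]
  have ab: "\<bar>act \<phi> t\<bar> \<le> B" for t using act_bounds[OF p(1), of t] by simp
  obtain \<phi>1 where d: "\<And>t. (resolv c 1 (act \<phi>) has_real_derivative \<phi>1 t) (at t)"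
    "\<And>t. (\<phi>1 has_real_derivative c * \<phi>1 t + 1 * resolv c 1 (act \<phi>) t - act \<phi> t) (at t)"
    using resolv_ode[OF zero_less_one act_continuous[OF p(5)] ab] by blast
  have eq: "resolv c 1 (act \<phi>) = \<phi>" using p(3) by (simp add: fun_eq_iff)
  show thesis using d unfolding eq by (intro that) auto
qed

text \<open>Positivity of the limit is not claimed: translates could converge to 0. It is supplied
  by persistence when the times tend to infinity.\<close>

lemma profile_translates_limit:
  assumes \<phi>: "profile \<phi>"
  obtains k y where "strict_mono (k::nat\<Rightarrow>nat)" "\<And>x. (\<lambda>n. \<phi> (T (k n) + x)) \<longlonglongrightarrow> y x"
    "y \<in> borel_measurable borel" "\<And>t. y t = resolv c 1 (act y) t"
proof -
  note p = profileD[OF \<phi>]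
  define Y where "Y n x = \<phi> (T n + x)" for n x
  have Y: "0 < Y n x" "Y n x \<le> B" for n x using p(2,6) by (auto simp: Y_def)
  have Yh: "harnack c (Y n)" for n
    using harnack_rescale[OF p(4) zero_less_one, of "T n"] by (simp add: Y_def[abs_def])
  have Ym: "Y n \<in> borel_measurable borel" for n
    using p(1) unfolding Y_def by measurable
  have ab: "\<bar>Y n x\<bar> \<le> B" for n x using Y[of n x] by simp
  obtain k y where k: "strict_mono (k::nat\<Rightarrow>nat)" and lim: "\<And>t. (\<lambda>n. Y (k n) t) \<longlonglongrightarrow> y t" and cont: "continuous_on UNIV y"
    by (rule equicontinuous_convergent_subsequence[of Y "\<lambda>_. B", OF ab])
       (use harnack_equicontinuous[of c Y "\<lambda>_. B", OF Yh less_imp_le[OF Y(1)] Y(2)] in blast)+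
  have ym: "y \<in> borel_measurable borel" using cont by (rule borel_measurable_continuous_onI)
  have sh: "act (Y n) = (\<lambda>s. act \<phi> (T n + s))" for n by (simp add: act_def Y_def add.assoc fun_eq_iff)
  have Yeq: "Y n t = resolv c 1 (act (Y n)) t" for n t
    using p(3)[of "T n + t"] by (simp add: Y_def sh resolv_translate)
  have eq: "y t = resolv c 1 (act y) t" for t
  proof -
    have "(\<lambda>n. resolv c 1 (act (Y (k n))) t) \<longlonglongrightarrow> resolv c 1 (act y) t"
    proof (rule resolv_tendsto_bounded[OF zero_less_one])
      show "\<bar>act (Y (k n)) s\<bar> \<le> B" for n s using act_bounds[OF Ym, of "k n" s] by simp
      show "(\<lambda>n. act (Y (k n)) s) \<longlonglongrightarrow> act y s" for s by (rule act_tendsto[OF Ym ym lim])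
    qed (use act_measurable Ym ym in auto)
    moreover have "(\<lambda>n. resolv c 1 (act (Y (k n))) t) \<longlonglongrightarrow> y t" using lim[of t] by (simp flip: Yeq)
    ultimately show ?thesis by (rule LIMSEQ_unique[rotated])
  qed
  show thesis using that[OF k _ ym eq] lim by (simp add: Y_def)
qed

text \<open>Translating along times that realise the lower and the upper limit produces two further
  profiles, for which these limits are a global minimum and maximum, attained at 0. Extremum
  arguments then apply although the original profile need not attain them.\<close>

lemma profile_omega_limits:
  assumes \<phi>: "profile \<phi>"
  obtains m M y z where "0 < m" "profile y" "profile z" "\<And>t. m \<le> y t" "\<And>t. y t \<le> M" "\<And>t. m \<le> z t" "\<And>t. z t \<le> M"
    "y 0 = M" "z 0 = m" "\<And>e. 0 < e \<Longrightarrow> \<forall>\<^sub>F t in at_top. m - e < \<phi> t \<and> \<phi> t < M + e"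
proof -
  note p = profileD[OF \<phi>]
  have ab: "\<bar>\<phi> t\<bar> \<le> B" "\<bar>- \<phi> t\<bar> \<le> B" for t using p(2,6)[of t] by auto
  obtain M T where M: "\<And>e. 0 < e \<Longrightarrow> \<forall>\<^sub>F t in at_top. \<phi> t < M + e"
    and T: "filterlim T at_top sequentially" "(\<lambda>n. \<phi> (T n)) \<longlonglongrightarrow> M"
    using upper_limit_sequence[of \<phi> B, OF ab(1)] by blast
  obtain m' S where m': "\<And>e. 0 < e \<Longrightarrow> \<forall>\<^sub>F t in at_top. - \<phi> t < m' + e"
    and S: "filterlim S at_top sequentially" "(\<lambda>n. - \<phi> (S n)) \<longlonglongrightarrow> m'"
    using upper_limit_sequence[of "\<lambda>t. - \<phi> t" B, OF ab(2)] by blast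
  define m where "m = - m'"
  have m: "\<forall>\<^sub>F t in at_top. m - e < \<phi> t" if "0 < e" for e
    using m'[OF that] by eventually_elim (simp add: m_def)
  have Sm: "(\<lambda>n. \<phi> (S n)) \<longlonglongrightarrow> m" using tendsto_minus[OF S(2)] by (simp add: m_def)
  obtain s d where d: "0 < d" "\<And>t. s \<le> t \<Longrightarrow> d \<le> \<phi> t" using uniform_persistence[OF p(1-3)] by blast
  have dm: "d \<le> m"
  proof (rule tendsto_lowerbound[OF Sm])
    have "\<forall>\<^sub>F n in sequentially. s \<le> S n" using S(1) by (simp add: filterlim_at_top)
    then show "\<forall>\<^sub>F n in sequentially. d \<le> \<phi> (S n)" by eventually_elim (rule d)
  qed simp
  have bounds: "m \<le> v \<and> v \<le> M"
    if k: "strict_mono (k::nat\<Rightarrow>nat)" and U: "filterlim U at_top sequentially" and lim: "(\<lambda>n. \<phi> (U (k n) + x)) \<longlonglongrightarrow> v" for k U x v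
  proof -
    have "filterlim (\<lambda>n. U (k n)) at_top sequentially"
      using filterlim_compose[OF U filterlim_subseq[OF k]] .
    then have top: "filterlim (\<lambda>n. U (k n) + x) at_top sequentially"
      using filterlim_tendsto_add_at_top[OF tendsto_const[of x]] by (simp add: add.commute)
    have "m - e \<le> v" "v \<le> M + e" if e: "0 < e" for e
    proof -
      have "\<forall>\<^sub>F n in sequentially. m - e < \<phi> (U (k n) + x)" using m[OF e] top by (rule eventually_compose_filterlim)
      then show "m - e \<le> v" by (intro tendsto_lowerbound[OF lim]) (auto elim: eventually_mono)
      have "\<forall>\<^sub>F n in sequentially. \<phi> (U (k n) + x) < M + e" using M[OF e] top by (rule eventually_compose_filterlim)
      then show "v \<le> M + e" by (intro tendsto_upperbound[OF lim]) (auto elim: eventually_mono)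
    qed
    then show ?thesis by (auto intro: field_le_epsilon simp: diff_le_eq)
  qed
  obtain k y where k: "strict_mono (k::nat\<Rightarrow>nat)" and y: "\<And>x. (\<lambda>n. \<phi> (T (k n) + x)) \<longlonglongrightarrow> y x"
    "y \<in> borel_measurable borel" "\<And>t. y t = resolv c 1 (act y) t"
    using profile_translates_limit[OF \<phi>, of T] by blast
  obtain l z where l: "strict_mono (l::nat\<Rightarrow>nat)" and z: "\<And>x. (\<lambda>n. \<phi> (S (l n) + x)) \<longlonglongrightarrow> z x"
    "z \<in> borel_measurable borel" "\<And>t. z t = resolv c 1 (act z) t"
    using profile_translates_limit[OF \<phi>, of S] by blast
  have yb: "m \<le> y x" "y x \<le> M" and zb: "m \<le> z x" "z x \<le> M" for x
    using bounds[OF k T(1) y(1)[of x]] bounds[OF l S(1) z(1)[of x]] by auto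
  have pos: "0 < y x" "0 < z x" for x using yb(1)[of x] zb(1)[of x] dm d(1) by linarith+
  have y0: "y 0 = M" using LIMSEQ_unique[OF y(1)[of 0]] LIMSEQ_subseq_LIMSEQ[OF T(2) k] by (simp add: o_def)
  have z0: "z 0 = m" using LIMSEQ_unique[OF z(1)[of 0]] LIMSEQ_subseq_LIMSEQ[OF Sm l] by (simp add: o_def)
  have ev: "\<forall>\<^sub>F t in at_top. m - e < \<phi> t \<and> \<phi> t < M + e" if "0 < e" for e
    using m[OF that] M[OF that] by eventually_elim simp
  have pr: "profile y" "profile z" using y z pos by (auto simp: profile_def)
  have "0 < m" using dm d(1) by linarith
  then show thesis by (rule that[OF _ pr yb zb y0 z0 ev])
qed

text \<open>Both \<open>P\<close> and \<open>green c 1\<close> have total mass 1, so a constant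
  bound on the nonlinearity passes unchanged through the two averages.\<close>

lemma profile_le:
  assumes y: "profile y" and G: "\<And>t. g (y t) \<le> \<Gamma>" shows "act y t \<le> \<Gamma>" "y t \<le> \<Gamma>"
proof -
  note p = profileD[OF y]
  show a: "act y t \<le> \<Gamma>" for t
  proof -
    have "act y t \<le> (\<integral>r. \<Gamma> \<partial>P)" unfolding act_def by (intro integral_mono integrable_act p G) auto
    then show ?thesis by (simp add: prob_space)
  qed
  have ab: "\<bar>act y t\<bar> \<le> B" for t using act_bounds[OF p(1), of t] by simp
  have "y t \<le> resolv c 1 (\<lambda>_. \<Gamma>) t" unfolding p(3)[of t]
    by (intro resolv_mono integrable_green_bounded[OF zero_less_one act_measurable[OF p(1)] ab]
        integrable_green_bounded[OF zero_less_one _ order_refl] a) auto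
  then show "y t \<le> \<Gamma>" by (simp add: resolv_const)
qed

lemma profile_ge:
  assumes y: "profile y" and G: "\<And>t. \<Gamma> \<le> g (y t)" shows "\<Gamma> \<le> act y t" "\<Gamma> \<le> y t"
proof -
  note p = profileD[OF y]
  show a: "\<Gamma> \<le> act y t" for t
  proof -
    have "(\<integral>r. \<Gamma> \<partial>P) \<le> act y t" unfolding act_def by (intro integral_mono integrable_act p G) auto
    then show ?thesis by (simp add: prob_space)
  qed
  have ab: "\<bar>act y t\<bar> \<le> B" for t using act_bounds[OF p(1), of t] by simp
  have "resolv c 1 (\<lambda>_. \<Gamma>) t \<le> y t" unfolding p(3)[of t]
    by (intro resolv_mono integrable_green_bounded[OF zero_less_one act_measurable[OF p(1)] ab]
        integrable_green_bounded[OF zero_less_one _ order_refl] a) auto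
  then show "\<Gamma> \<le> y t" by (simp add: resolv_const)
qed

lemma integral_mixture: "(\<integral>r. indicator A r * \<kappa> + (1 - indicator A r) * \<Gamma> \<partial>P) = prob A * \<kappa> + (1 - prob A) * \<Gamma>"
  and integrable_mixture: "integrable P (\<lambda>r. indicator A r * \<kappa> + (1 - indicator A r) * \<Gamma>)" if "A \<in> events"
proof -
  have i: "integrable P (\<lambda>r. indicator A r * \<kappa>)" "integrable P (\<lambda>r. indicator A r * \<Gamma>)"
    using that by (auto intro!: integrable_mult_left integrable_real_indicator simp: less_top[symmetric])
  have e: "(\<lambda>r. indicator A r * \<kappa> + (1 - indicator A r) * \<Gamma>) = (\<lambda>r. indicator A r * \<kappa> + (\<Gamma> - indicator A r * \<Gamma>))"
    by (simp add: algebra_simps)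
  show "integrable P (\<lambda>r. indicator A r * \<kappa> + (1 - indicator A r) * \<Gamma>)"
    unfolding e using i by (intro Bochner_Integration.integrable_add Bochner_Integration.integrable_diff) auto
  show "(\<integral>r. indicator A r * \<kappa> + (1 - indicator A r) * \<Gamma> \<partial>P) = prob A * \<kappa> + (1 - prob A) * \<Gamma>"
    unfolding e Bochner_Integration.integral_add[OF i(1) Bochner_Integration.integrable_diff[OF integrable_const i(2)]]
      Bochner_Integration.integral_diff[OF integrable_const i(2)]
    using that by (simp add: prob_space algebra_simps)
qed

text \<open>If the profile stays above \<kappa> on the delay window, then a set of shifts of mass at
  least \<xi> contributes at most \<kappa> and the rest at most \<Gamma>; this is the delay
  alternative of the maximum estimate.\<close>

lemma profile_maximum:
  assumes y: "profile y" and max: "\<And>t. y t \<le> y 0" and h: "0 \<le> h"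
    and \<xi>: "\<xi> \<le> exp (- h)" "\<xi> \<le> prob {- (c * h)..0}"
    and G: "\<And>t. g (y t) \<le> \<Gamma>" and \<kappa>: "\<kappa> \<le> \<Gamma>" "\<And>s. \<kappa> \<le> s \<Longrightarrow> s \<le> y 0 \<Longrightarrow> g s \<le> \<kappa>"
  shows "y 0 \<le> (1 - \<xi>) * \<Gamma> + \<xi> * \<kappa>"
proof -
  obtain y1 where d: "\<And>t. (y has_real_derivative y1 t) (at t)"
    "\<And>t. (y1 has_real_derivative c * y1 t + y t - act y t) (at t)" using profile_ode[OF y] by blast
  show ?thesis
  proof (rule profile_maximum_estimate[OF c_pos h d max profile_le(1)[OF y G] profile_le(2)[OF y G] \<kappa>(1) \<xi>(1)])
    assume *: "\<And>t. t \<in> {- (c * h)..0} \<Longrightarrow> \<kappa> < y t"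
    define A where "A = {- (c * h)..0}"
    have A: "A \<in> events" by (simp add: A_def sets_P)
    have "act y 0 \<le> (\<integral>r. indicator A r * \<kappa> + (1 - indicator A r) * \<Gamma> \<partial>P)"
      unfolding act_def
    proof (intro integral_mono integrable_act profileD(1)[OF y] integrable_mixture[OF A])
      fix r
      show "g (y (0 + r)) \<le> indicator A r * \<kappa> + (1 - indicator A r) * \<Gamma>"
        using G[of r] \<kappa>(2)[of "y r"] *[of r] max[of r] by (cases "r \<in> A") (auto simp: A_def)
    qed
    also have "\<dots> = \<Gamma> - prob A * (\<Gamma> - \<kappa>)" unfolding integral_mixture[OF A] by (simp add: algebra_simps)
    also have "\<dots> \<le> \<Gamma> - \<xi> * (\<Gamma> - \<kappa>)" using \<xi>(2) \<kappa>(1) by (auto simp: A_def intro!: mult_right_mono)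
    finally show "act y 0 \<le> (1 - \<xi>) * \<Gamma> + \<xi> * \<kappa>" by (simp add: algebra_simps)
  qed
qed

text \<open>The differential inequality is linear in the profile and its forcing, so the maximum
  estimate applies to the negatives; the nonlinearity itself is never reflected.\<close>

lemma profile_minimum:
  assumes y: "profile y" and min: "\<And>t. y 0 \<le> y t" and h: "0 \<le> h"
    and \<xi>: "\<xi> \<le> exp (- h)" "\<xi> \<le> prob {- (c * h)..0}"
    and G: "\<And>t. \<Gamma> \<le> g (y t)" and \<kappa>: "\<Gamma> \<le> \<kappa>" "\<And>s. y 0 \<le> s \<Longrightarrow> s \<le> \<kappa> \<Longrightarrow> \<kappa> \<le> g s"
  shows "(1 - \<xi>) * \<Gamma> + \<xi> * \<kappa> \<le> y 0"
proof -
  obtain y1 where d: "\<And>t. (y has_real_derivative y1 t) (at t)"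
    "\<And>t. (y1 has_real_derivative c * y1 t + y t - act y t) (at t)" using profile_ode[OF y] by blast
  have "- y 0 \<le> (1 - \<xi>) * (- \<Gamma>) + \<xi> * (- \<kappa>)"
  proof (rule profile_maximum_estimate[OF c_pos h, where \<phi>="\<lambda>t. - y t" and ?\<phi>1.0="\<lambda>t. - y1 t" and H="\<lambda>t. - act y t"])
    show "((\<lambda>t. - y t) has_real_derivative - y1 t) (at t)" for t by (rule DERIV_minus[OF d(1)])
    show "((\<lambda>t. - y1 t) has_real_derivative c * - y1 t + - y t - - act y t) (at t)" for t
      using DERIV_minus[OF d(2)[of t]] by (simp add: algebra_simps)
    assume *: "\<And>t. t \<in> {- (c * h)..0} \<Longrightarrow> - \<kappa> < - y t"
    define A where "A = {- (c * h)..0}"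
    have A: "A \<in> events" by (simp add: A_def sets_P)
    have "(\<integral>r. indicator A r * \<kappa> + (1 - indicator A r) * \<Gamma> \<partial>P) \<le> act y 0"
      unfolding act_def
    proof (intro integral_mono integrable_act profileD(1)[OF y] integrable_mixture[OF A])
      fix r
      show "indicator A r * \<kappa> + (1 - indicator A r) * \<Gamma> \<le> g (y (0 + r))"
        using G[of r] \<kappa>(2)[of "y r"] *[of r] min[of r] by (cases "r \<in> A") (auto simp: A_def)
    qed
    moreover have "(\<integral>r. indicator A r * \<kappa> + (1 - indicator A r) * \<Gamma> \<partial>P) = \<Gamma> + prob A * (\<kappa> - \<Gamma>)"
      unfolding integral_mixture[OF A] by (simp add: algebra_simps)
    moreover have "\<xi> * (\<kappa> - \<Gamma>) \<le> prob A * (\<kappa> - \<Gamma>)" using \<xi>(2) \<kappa>(1) by (auto simp: A_def intro!: mult_right_mono)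
    ultimately show "- act y 0 \<le> (1 - \<xi>) * - \<Gamma> + \<xi> * - \<kappa>" by (simp add: algebra_simps)
  qed (use min profile_ge[OF y G] \<kappa>(1) \<xi>(1) in auto)
  then show ?thesis by (simp add: algebra_simps)
qed

end

text \<open>What remains is one-dimensional. The assumptions \<open>plain\<close> trap the two
  limits on both sides of \<kappa> and inside the invariant interval. If the peak of
  \<open>g\<close> is not left of \<kappa>, monotonicity then suffices; otherwise \<open>hi\<close>
  and \<open>lo\<close> produce exactly the pair which \<open>cycle\<close> forbids.\<close>

lemma interval_collapse:
  fixes g :: "real \<Rightarrow> real"
  assumes cont: "continuous_on {m..M} g"
    and inc: "\<And>a b. 0 \<le> a \<Longrightarrow> a \<le> b \<Longrightarrow> b \<le> sM \<Longrightarrow> g a \<le> g b"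
    and dec: "\<And>a b. sM \<le> a \<Longrightarrow> a \<le> b \<Longrightarrow> g b \<le> g a"
    and above: "\<And>s. 0 < s \<Longrightarrow> s < \<kappa> \<Longrightarrow> s < g s" and below: "\<And>s. \<kappa> < s \<Longrightarrow> g s < s" and fixp: "g \<kappa> = \<kappa>"
    and \<zeta>: "0 < \<zeta>1" "\<zeta>1 < \<kappa>" "\<kappa> \<le> \<zeta>2" "\<And>s. 0 \<le> s \<Longrightarrow> s \<le> \<zeta>2 \<Longrightarrow> g s \<le> \<zeta>2"
      "\<And>s. \<zeta>1 \<le> s \<Longrightarrow> s \<le> \<zeta>2 \<Longrightarrow> g \<zeta>1 \<le> g s" "\<kappa> \<le> g (g \<zeta>2)"
    and mM: "0 < m" "m \<le> M"
    and plain: "\<And>\<Gamma>. (\<And>s. s \<in> {m..M} \<Longrightarrow> g s \<le> \<Gamma>) \<Longrightarrow> M \<le> \<Gamma>" "\<And>\<Gamma>. (\<And>s. s \<in> {m..M} \<Longrightarrow> \<Gamma> \<le> g s) \<Longrightarrow> \<Gamma> \<le> m"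
    and hi: "\<And>\<Gamma>. \<kappa> \<le> \<Gamma> \<Longrightarrow> (\<And>s. s \<in> {m..M} \<Longrightarrow> g s \<le> \<Gamma>) \<Longrightarrow> (\<And>s. \<kappa> \<le> s \<Longrightarrow> s \<le> M \<Longrightarrow> g s \<le> \<kappa>) \<Longrightarrow> M \<le> (1 - \<xi>) * \<Gamma> + \<xi> * \<kappa>"
    and lo: "\<And>\<Gamma>. \<Gamma> \<le> \<kappa> \<Longrightarrow> (\<And>s. s \<in> {m..M} \<Longrightarrow> \<Gamma> \<le> g s) \<Longrightarrow> (\<And>s. m \<le> s \<Longrightarrow> s \<le> \<kappa> \<Longrightarrow> \<kappa> \<le> g s) \<Longrightarrow> (1 - \<xi>) * \<Gamma> + \<xi> * \<kappa> \<le> m"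
    and cycle: "\<And>x y. sM < \<kappa> \<Longrightarrow> sM \<le> x \<Longrightarrow> \<zeta>1 \<le> x \<Longrightarrow> x < \<kappa> \<Longrightarrow> \<kappa> < y \<Longrightarrow> y \<le> \<zeta>2 \<Longrightarrow>
        y \<le> (1 - \<xi>) * g x + \<xi> * \<kappa> \<Longrightarrow> (1 - \<xi>) * g y + \<xi> * \<kappa> \<le> x \<Longrightarrow> False"
  shows "m = \<kappa> \<and> M = \<kappa>"
proof -
  obtain s where s: "s \<in> {m..M}" "\<forall>t\<in>{m..M}. g t \<le> g s"
    using continuous_attains_sup[OF compact_Icc _ cont] mM by auto
  obtain t where t: "t \<in> {m..M}" "\<forall>s\<in>{m..M}. g t \<le> g s"
    using continuous_attains_inf[OF compact_Icc _ cont] mM by auto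
  have Ms: "M \<le> g s" using s(2) by (intro plain(1)) auto
  have tm: "g t \<le> m" using t(2) by (intro plain(2)) auto
  \<comment> \<open>Right of \<kappa> the graph lies below the diagonal, so a maximiser there would
    give \<open>M \<le> g s < s \<le> M\<close>. The minimiser is treated symmetrically.\<close>
  have s\<kappa>: "s \<le> \<kappa>" using below[of s] Ms s(1) by (cases "\<kappa> < s") auto
  have t\<kappa>: "\<kappa> \<le> t" using above[of t] tm t(1) mM by (cases "t < \<kappa>") auto
  have M\<zeta>: "M \<le> \<zeta>2" using \<zeta>(3) \<zeta>(4)[of s] s(1) s\<kappa> Ms mM by auto
  have m\<zeta>: "\<zeta>1 \<le> m"
  proof -
    have "g \<zeta>1 \<le> g t" using \<zeta>(2) t\<kappa> t(1) M\<zeta> by (intro \<zeta>(5)) auto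
    then show ?thesis using above[of \<zeta>1] \<zeta>(1,2) tm by linarith
  qed
  have m\<kappa>: "m \<le> \<kappa>" using s(1) s\<kappa> by simp
  have \<kappa>M: "\<kappa> \<le> M" using t(1) t\<kappa> by simp
  show ?thesis
  proof (cases "\<kappa> \<le> sM")
    case True
    have "g s \<le> g \<kappa>" using s(1) s\<kappa> mM True by (intro inc) auto
    then have M: "M = \<kappa>" using Ms fixp \<kappa>M by simp
    then have "t = \<kappa>" using t(1) t\<kappa> by simp
    then show ?thesis using tm fixp m\<kappa> M by simp
  next
    case False
    show ?thesis
    proof (rule ccontr)
      assume contra: "\<not> (m = \<kappa> \<and> M = \<kappa>)"
      have M': "\<kappa> < M"
      proof (rule ccontr)
        assume "\<not> \<kappa> < M"
        then have "M = \<kappa>" using \<kappa>M by simp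
        then have "t = \<kappa>" using t(1) t\<kappa> by simp
        then show False using tm fixp m\<kappa> contra \<open>M = \<kappa>\<close> by simp
      qed
      have m': "m < \<kappa>"
      proof (rule ccontr)
        assume "\<not> m < \<kappa>"
        then have "s = \<kappa>" using m\<kappa> s(1) s\<kappa> by simp
        then show False using Ms fixp M' by simp
      qed
      have gM: "g M \<le> m" using dec[of t M] t t\<kappa> False tm by auto
      have g\<zeta>: "g \<zeta>2 \<le> m" using dec[of M \<zeta>2] M\<zeta> M' False gM by simp
      have g\<zeta>0: "0 \<le> g \<zeta>2" using \<zeta>(1,2,3) \<zeta>(5)[of \<zeta>2] above[of \<zeta>1] by linarith
      \<comment> \<open>The assumption on \<open>g (g \<zeta>2)\<close> enters here: on the
        increasing branch \<open>g \<zeta>2 \<le> m \<le> r\<close> bounds \<open>g r\<close> from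
        below by it.\<close>
      have ge: "\<kappa> \<le> g r" if "m \<le> r" "r \<le> \<kappa>" for r
      proof (cases "sM \<le> r")
        case True
        then show ?thesis using dec[of r \<kappa>] that fixp by simp
      next
        case False
        then have "g (g \<zeta>2) \<le> g r" using that g\<zeta> g\<zeta>0 by (intro inc) auto
        then show ?thesis using \<zeta>(6) by simp
      qed
      have le: "g r \<le> \<kappa>" if "\<kappa> \<le> r" for r using dec[of \<kappa> r] that False fixp by simp
      \<comment> \<open>The place where \<open>g\<close> is largest to the right of
        \<open>m\<close>. Moving from \<open>m\<close> to \<open>x\<close> reaches the decreasing
        branch, on which the Schwarzian estimate works, and only weakens the second cycle
        inequality.\<close>
      define x where "x = max m sM"
      have x: "sM \<le> x" "m \<le> x" "x < \<kappa>" using m' False by (auto simp: x_def)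
      have gx: "g r \<le> g x" if "m \<le> r" for r
      proof (cases "sM \<le> r")
        case True
        then show ?thesis using that by (intro dec) (auto simp: x_def)
      next
        case r: False
        then have "x = sM" using that by (simp add: x_def)
        then show ?thesis using r that mM by (intro inc) auto
      qed
      have "M \<le> (1 - \<xi>) * g x + \<xi> * \<kappa>"
        using gx[of \<kappa>] m\<kappa> fixp by (intro hi gx le) auto
      moreover have "(1 - \<xi>) * g M + \<xi> * \<kappa> \<le> m"
      proof (rule lo)
        show "g M \<le> \<kappa>" by (rule le[OF \<kappa>M])
        show "g M \<le> g r" if "r \<in> {m..M}" for r
        proof (cases "r \<le> \<kappa>")
          case True
          then show ?thesis using ge[of r] that le[OF \<kappa>M] by simp
        next
          case rk: False
          then show ?thesis using that False by (intro dec) auto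
        qed
      qed (rule ge)
      ultimately show False using cycle[of x M] x M' M\<zeta> m\<zeta> False by auto
    qed
  qed
qed

section \<open>Wavefronts of the evolution equation\<close>

text \<open>Passing from \<open>p\<close> to \<open>g0\<close> keeps the value at \<open>x\<close>
  nonpositive, while the value at 0 is \<open>g0 - 1 > 0\<close>; convexity on
  \<open>z < 0 < x\<close> then excludes a nonpositive value at \<open>z\<close>.\<close>

lemma (in kernel) char_positive_on_nonpos:
  assumes g0: "1 < g0" "g0 \<le> p" and x: "0 < x" "x\<^sup>2 - c * x - 1 + p * J d 1 x \<le> 0" and z: "z \<le> 0"
  shows "0 < z\<^sup>2 - c * z - 1 + g0 * J d 1 z"
proof (cases "z = 0")
  case True
  then show ?thesis using g0 by (simp add: J_zero)
next
  case False
  then have z': "z < 0" using z by simp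
  have gx: "x\<^sup>2 - c * x - 1 + g0 * J d 1 x \<le> 0"
    using mult_right_mono[OF g0(2) J_nonneg[of d 1 x]] x(2) by linarith
  have J3: "g0 * (x - z) \<le> g0 * J d 1 z * x - g0 * J d 1 x * z"
    using mult_left_mono[OF J_three_points[OF z' x(1), of d 1], of g0] g0 by (simp add: J_zero algebra_simps)
  show ?thesis
  proof (rule ccontr)
    assume "\<not> ?thesis"
    then have 1: "(z\<^sup>2 - c * z - 1 + g0 * J d 1 z) * x \<le> 0" using x(1) by (intro mult_nonpos_nonneg) auto
    have 2: "(x\<^sup>2 - c * x - 1 + g0 * J d 1 x) * (- z) \<le> 0" using gx z by (intro mult_nonpos_nonneg) auto
    have 3: "0 \<le> (- z) * x * (x - z)" using x(1) z by (intro mult_nonneg_nonneg) auto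
    have 4: "(z\<^sup>2 - c * z - 1 + g0 * J d 1 z) * x + (x\<^sup>2 - c * x - 1 + g0 * J d 1 x) * (- z)
       = (- z) * x * (x - z) + (g0 * J d 1 z * x - g0 * J d 1 x * z) - 1 * (x - z)"
      by (simp add: power2_eq_square algebra_simps)
    have lin: "b1 + b2 = b3 + b4 - b5 \<Longrightarrow> b1 \<le> 0 \<Longrightarrow> b2 \<le> 0 \<Longrightarrow> 0 \<le> b3 \<Longrightarrow> b6 \<le> b4 \<Longrightarrow> b6 \<le> b5" for b1 b2 b3 b4 b5 b6 :: real
      by linarith
    have "g0 * (x - z) \<le> 1 * (x - z)" by (rule lin[OF 4 1 2 3 J3])
    then show False using x(1) z' g0(1) by (simp add: mult_le_cancel_right)
  qed
qed

text \<open>Equal values at two points on one side of the peak would create another extremum, so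
  \<open>g\<close> is injective and hence strictly monotone on each side. The directions follow from
  \<open>g 0 = 0 < g sM\<close> on the left and from the local maximum on the right.\<close>

lemma single_extremum_monotone:
  fixes g :: "real \<Rightarrow> real"
  assumes cont: "continuous_on {0..} g" and ext: "{s. 0 < s \<and> (local_max_at g s \<or> local_min_at g s)} = {sM}"
    and max: "local_max_at g sM" and g0: "g 0 = 0" and pos: "\<And>s. 0 < s \<Longrightarrow> 0 < g s"
  shows "0 < sM" "\<And>a b. 0 \<le> a \<Longrightarrow> a \<le> b \<Longrightarrow> b \<le> sM \<Longrightarrow> g a \<le> g b" "\<And>a b. sM \<le> a \<Longrightarrow> a \<le> b \<Longrightarrow> g b \<le> g a"
proof -
  show sM: "0 < sM" using ext by blast
  have inj: "g a \<noteq> g b" if "a < b" "0 \<le> a" "b \<le> sM \<or> sM \<le> a" for a b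
  proof
    assume eq: "g a = g b"
    have "continuous_on {a..b} g" using that by (intro continuous_on_subset[OF cont]) auto
    from equal_ends_extremum[OF that(1) this eq] obtain x where x: "x \<in> {a<..<b}" "local_max_at g x \<or> local_min_at g x"
      unfolding local_max_at_def local_min_at_def by blast
    then have "x \<in> {s. 0 < s \<and> (local_max_at g s \<or> local_min_at g s)}" using that(2) by simp
    then have "x = sM" unfolding ext by simp
    then show False using x(1) that(3) by auto
  qed
  have cases: "strict_mono_on S g \<or> strict_antimono_on S g" if "is_interval S" "S \<subseteq> {0..}" "S \<subseteq> {..sM} \<or> S \<subseteq> {sM..}" for S
  proof -
    have "inj_on g S"
    proof (rule linorder_inj_onI)
      show "g x \<noteq> g y" if "x < y" "x \<in> S" "y \<in> S" for x y
        using inj[of x y] that \<open>S \<subseteq> {0..}\<close> \<open>S \<subseteq> {..sM} \<or> S \<subseteq> {sM..}\<close> by auto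
    qed auto
    then show ?thesis using injective_eq_monotone_map[OF that(1) continuous_on_subset[OF cont that(2)]] by blast
  qed
  have "strict_mono_on {0..sM} g"
  proof -
    have "\<not> strict_antimono_on {0..sM} g" using pos[OF sM] g0 sM by (force simp: monotone_on_def)
    then show ?thesis using cases[of "{0..sM}"] by (auto simp: is_interval_cc)
  qed
  then show "g a \<le> g b" if "0 \<le> a" "a \<le> b" "b \<le> sM" for a b
    using that by (cases "a = b") (auto simp: monotone_on_def less_imp_le)
  have "strict_antimono_on {sM..} g"
  proof -
    obtain e where e: "0 < e" "\<And>r. dist r sM < e \<Longrightarrow> g r \<le> g sM"
      using max unfolding local_max_at_def eventually_nhds_metric by blast
    have le: "g (sM + e / 2) \<le> g sM" using e(1) by (intro e(2)) (simp add: dist_real_def)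
    have "\<not> strict_mono_on {sM..} g"
    proof
      assume "strict_mono_on {sM..} g"
      then have "g sM < g (sM + e / 2)" by (rule monotone_onD) (use e(1) in auto)
      then show False using le by simp
    qed
    then show ?thesis using cases[of "{sM..}"] sM by (auto simp: is_interval_ci)
  qed
  then show "g b \<le> g a" if "sM \<le> a" "a \<le> b" for a b
    using that by (cases "a = b") (auto simp: monotone_on_def less_imp_le)
qed

text \<open>The quotient is controlled near 0 by the derivative and elsewhere by
  \<open>B / d\<close>; this boundedness gives the supremum in \<open>c_star\<close> its
  meaning.\<close>

lemma ratio_bounds:
  fixes g :: "real \<Rightarrow> real"
  assumes der: "(g has_real_derivative g0) (at 0 within {0..})" and g0: "g 0 = 0"
    and bd: "\<And>s. 0 \<le> s \<Longrightarrow> g s \<le> B" and B: "0 \<le> B"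
  shows "((\<lambda>s. g s / s) \<longlongrightarrow> g0) (at_right 0)" "g0 \<le> (SUP s\<in>{0<..}. g s / s)"
    "\<And>s. 0 \<le> s \<Longrightarrow> g s \<le> (SUP s\<in>{0<..}. g s / s) * s"
proof -
  show lim: "((\<lambda>s. g s / s) \<longlongrightarrow> g0) (at_right 0)"
    using der unfolding has_field_derivative_iff by (simp add: g0 at_within_Ici_at_right)
  then have "\<forall>\<^sub>F s in at_right 0. g s / s < g0 + 1" by (intro order_tendstoD) auto
  then obtain d where d: "0 < d" "\<And>s. 0 < s \<Longrightarrow> s < d \<Longrightarrow> g s / s < g0 + 1"
    unfolding eventually_at_right_field by blast
  have bdd: "bdd_above ((\<lambda>s. g s / s) ` {0<..})"
  proof (rule bdd_aboveI2)
    fix s :: real assume "s \<in> {0<..}"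
    then have s: "0 < s" by simp
    show "g s / s \<le> max (g0 + 1) (B / d)"
    proof (cases "s < d")
      case True then show ?thesis using d(2)[OF s] by simp
    next
      case False
      then have "g s / s \<le> B / d" using bd[of s] s d(1) B by (intro frac_le) auto
      then show ?thesis by simp
    qed
  qed
  have le: "g s / s \<le> (SUP s\<in>{0<..}. g s / s)" if "0 < s" for s
    using that by (intro cSUP_upper[OF _ bdd]) auto
  show "g0 \<le> (SUP s\<in>{0<..}. g s / s)"
  proof (rule tendsto_upperbound[OF lim])
    show "\<forall>\<^sub>F s in at_right 0. g s / s \<le> (SUP s\<in>{0<..}. g s / s)"
      using eventually_at_right_less[of 0] by eventually_elim (rule le)
  qed simp
  show "g s \<le> (SUP s\<in>{0<..}. g s / s) * s" if "0 \<le> s" for s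
    using le[of s] that g0 by (cases "s = 0") (auto simp: pos_divide_le_eq)
qed

lemma fixed_point_sides:
  fixes g :: "real \<Rightarrow> real"
  assumes cont: "continuous_on {0..} g" and fixp: "{s. 0 \<le> s \<and> g s = s} = {0, \<kappa>}" and \<kappa>: "0 < \<kappa>"
    and lim: "((\<lambda>s. g s / s) \<longlongrightarrow> g0) (at_right 0)" "1 < g0" and bd: "\<And>s. 0 \<le> s \<Longrightarrow> g s \<le> B"
  shows "\<And>s. 0 < s \<Longrightarrow> s < \<kappa> \<Longrightarrow> s < g s" "\<And>s. \<kappa> < s \<Longrightarrow> g s < s"
proof -
  have c: "continuous_on {a..b} (\<lambda>s. g s - s)" if "0 \<le> a" for a b
    using that by (intro continuous_intros continuous_on_subset[OF cont]) auto
  have fp: "s = 0 \<or> s = \<kappa>" if "0 \<le> s" "g s = s" for s using fixp that by blast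
  have "\<forall>\<^sub>F s in at_right 0. 1 < g s / s" using lim by (intro order_tendstoD)
  then obtain d where d: "0 < d" "\<And>s. 0 < s \<Longrightarrow> s < d \<Longrightarrow> 1 < g s / s"
    unfolding eventually_at_right_field by blast
  show "s < g s" if s: "0 < s" "s < \<kappa>" for s
  proof (rule ccontr)
    assume "\<not> s < g s"
    define a where "a = min (d / 2) (s / 2)"
    have a: "0 < a" "a < d" "a < s" using d(1) s by (auto simp: a_def)
    have "a < g a" using d(2)[OF a(1,2)] a(1) by (simp add: field_simps)
    then obtain x where "a \<le> x" "x \<le> s" "g x - x = 0"
      using IVT2'[of "\<lambda>s. g s - s" s 0 a] c[of a s] a \<open>\<not> s < g s\<close> by auto
    then show False using fp[of x] a s by auto
  qed
  show "g s < s" if s: "\<kappa> < s" for s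
  proof (rule ccontr)
    assume "\<not> g s < s"
    define b where "b = max B s + 1"
    have b: "s < b" "B < b" by (auto simp: b_def)
    have "g b < b" using bd[of b] b s \<kappa> by simp
    then obtain x where "s \<le> x" "x \<le> b" "g x - x = 0"
      using IVT2'[of "\<lambda>s. g s - s" b 0 s] c[of s b] b s \<kappa> \<open>\<not> g s < s\<close> by auto
    then show False using fp[of x] s \<kappa> by auto
  qed
qed

text \<open>The one-dimensional argument is an assumption here, so that the shape of the
  nonlinearity stays out of the analysis of the equation.\<close>

lemma (in profile_equation) profile_converges:
  assumes \<phi>: "profile \<phi>" and h: "0 \<le> h" and \<xi>: "\<xi> \<le> exp (- h)" "\<xi> \<le> prob {- (c * h)..0}"
    and collapse: "\<And>m M. 0 < m \<Longrightarrow> m \<le> M \<Longrightarrow>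
      (\<And>\<Gamma>. (\<And>s. s \<in> {m..M} \<Longrightarrow> g s \<le> \<Gamma>) \<Longrightarrow> M \<le> \<Gamma>) \<Longrightarrow>
      (\<And>\<Gamma>. (\<And>s. s \<in> {m..M} \<Longrightarrow> \<Gamma> \<le> g s) \<Longrightarrow> \<Gamma> \<le> m) \<Longrightarrow>
      (\<And>\<Gamma>. \<kappa> \<le> \<Gamma> \<Longrightarrow> (\<And>s. s \<in> {m..M} \<Longrightarrow> g s \<le> \<Gamma>) \<Longrightarrow> (\<And>s. \<kappa> \<le> s \<Longrightarrow> s \<le> M \<Longrightarrow> g s \<le> \<kappa>) \<Longrightarrow> M \<le> (1 - \<xi>) * \<Gamma> + \<xi> * \<kappa>) \<Longrightarrow>
      (\<And>\<Gamma>. \<Gamma> \<le> \<kappa> \<Longrightarrow> (\<And>s. s \<in> {m..M} \<Longrightarrow> \<Gamma> \<le> g s) \<Longrightarrow> (\<And>s. m \<le> s \<Longrightarrow> s \<le> \<kappa> \<Longrightarrow> \<kappa> \<le> g s) \<Longrightarrow> (1 - \<xi>) * \<Gamma> + \<xi> * \<kappa> \<le> m) \<Longrightarrow>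
      m = \<kappa> \<and> M = \<kappa>"
  shows "(\<phi> \<longlongrightarrow> \<kappa>) at_top"
proof -
  obtain m M y z where m: "0 < m" and y: "profile y" "\<And>t. m \<le> y t" "\<And>t. y t \<le> M" "y 0 = M"
    and z: "profile z" "\<And>t. m \<le> z t" "\<And>t. z t \<le> M" "z 0 = m"
    and ev: "\<And>e. 0 < e \<Longrightarrow> \<forall>\<^sub>F t in at_top. m - e < \<phi> t \<and> \<phi> t < M + e"
    by (rule profile_omega_limits[OF \<phi>]) blast
  have "m = \<kappa> \<and> M = \<kappa>"
  proof (rule collapse[OF m])
    show "m \<le> M" using y(2)[of 0] y(4) by simp
    show "M \<le> \<Gamma>" if "\<And>s. s \<in> {m..M} \<Longrightarrow> g s \<le> \<Gamma>" for \<Gamma>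
      using profile_le(2)[OF y(1), of \<Gamma> 0] that y(2,3,4) by auto
    show "\<Gamma> \<le> m" if "\<And>s. s \<in> {m..M} \<Longrightarrow> \<Gamma> \<le> g s" for \<Gamma>
      using profile_ge(2)[OF z(1), of \<Gamma> 0] that z(2,3,4) by auto
    show "M \<le> (1 - \<xi>) * \<Gamma> + \<xi> * \<kappa>"
      if "\<kappa> \<le> \<Gamma>" "\<And>s. s \<in> {m..M} \<Longrightarrow> g s \<le> \<Gamma>" "\<And>s. \<kappa> \<le> s \<Longrightarrow> s \<le> M \<Longrightarrow> g s \<le> \<kappa>" for \<Gamma>
      using profile_maximum[OF y(1) _ h \<xi> _ that(1)] that(2,3) y(2,3,4) by auto
    show "(1 - \<xi>) * \<Gamma> + \<xi> * \<kappa> \<le> m"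
      if "\<Gamma> \<le> \<kappa>" "\<And>s. s \<in> {m..M} \<Longrightarrow> \<Gamma> \<le> g s" "\<And>s. m \<le> s \<Longrightarrow> s \<le> \<kappa> \<Longrightarrow> \<kappa> \<le> g s" for \<Gamma>
      using profile_minimum[OF z(1) _ h \<xi> _ that(1)] that(2,3) z(2,3,4) by auto
  qed
  then have ev': "\<forall>\<^sub>F t in at_top. \<kappa> - e < \<phi> t \<and> \<phi> t < \<kappa> + e" if "0 < e" for e using ev[OF that] by simp
  show ?thesis
  proof (rule tendstoI)
    fix e :: real assume "0 < e"
    from ev'[OF this] show "\<forall>\<^sub>F t in at_top. dist (\<phi> t) \<kappa> < e"
      by eventually_elim (auto simp: dist_real_def abs_less_iff)
  qed
qed

section \<open>Profiles as travelling solutions of the evolution equation\<close>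

locale kernel_profile_equation = kernel K + profile_equation "law (c * h)" c g B p g0 w
  for K h c g B p g0 w
begin

lemma delay_term:
  assumes "\<phi> \<in> borel_measurable borel"
  shows "integrable lebesgue (\<lambda>y. K (x - y) * g (\<phi> (y + c * (t - h))))"
    and "(\<integral>y. K (x - y) * g (\<phi> (y + c * (t - h))) \<partial>lebesgue) = act \<phi> (x + c * t)"
proof -
  have m: "(\<lambda>s. g (\<phi> s)) \<in> borel_measurable borel" using assms by measurable
  have b: "\<bar>g (\<phi> s)\<bar> \<le> B" for s using g_nonneg g_le_B by simp
  show "integrable lebesgue (\<lambda>y. K (x - y) * g (\<phi> (y + c * (t - h))))"
    by (rule convolution_law(1)[OF m b])
  have eq: "x + c * (t - h) + c * h = x + c * t" by (simp add: algebra_simps)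
  show "(\<integral>y. K (x - y) * g (\<phi> (y + c * (t - h))) \<partial>lebesgue) = act \<phi> (x + c * t)"
    unfolding act_def convolution_law(2)[OF m b, where d="c * h"] eq by (rule refl)
qed

lemma profile_semi_wavefront:
  assumes \<phi>: "profile \<phi>" and lim: "(\<phi> \<longlongrightarrow> 0) at_bot"
  shows "semi_wavefront h K g c \<phi>"
proof -
  note p = profileD[OF \<phi>]
  obtain \<phi>1 where d: "\<And>t. (\<phi> has_real_derivative \<phi>1 t) (at t)"
    "\<And>t. (\<phi>1 has_real_derivative c * \<phi>1 t + \<phi> t - act \<phi> t) (at t)" using profile_ode[OF \<phi>] by blast
  define \<phi>2 where "\<phi>2 t = c * \<phi>1 t + \<phi> t - act \<phi> t" for t
  have c1: "continuous_on UNIV \<phi>1"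
    using d(2) by (intro continuous_at_imp_continuous_on ballI) (rule DERIV_isCont)
  have c2: "continuous_on UNIV \<phi>2"
    unfolding \<phi>2_def by (intro continuous_intros c1 p(5) act_continuous)
  have comp: "continuous_on UNIV (\<lambda>(t, x). k * f (x + c * t))" if "continuous_on UNIV f" for f :: "real \<Rightarrow> real" and k
    unfolding split_beta by (intro continuous_intros continuous_on_compose2[OF that]) auto
  have dx: "((\<lambda>y. f (y + c * t)) has_real_derivative f' (x + c * t)) (at x)"
    if "\<And>s. (f has_real_derivative f' s) (at s)" for f f' :: "real \<Rightarrow> real" and t x
  proof -
    have "((\<lambda>y. y + c * t) has_real_derivative 1) (at x)" by (auto intro!: derivative_eq_intros)
    from DERIV_chain'[OF this that] show ?thesis by simp
  qed
  have dt: "((\<lambda>r. \<phi> (x + c * r)) has_real_derivative c * \<phi>1 (x + c * t)) (at t)" for t x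
  proof -
    have "((\<lambda>r. x + c * r) has_real_derivative c) (at t)" by (auto intro!: derivative_eq_intros)
    from DERIV_chain'[OF this d(1)] show ?thesis by (simp add: mult.commute)
  qed
  have "classical_solution h K g (\<lambda>t x. \<phi> (x + c * t))"
    unfolding classical_solution_def
  proof (intro exI conjI allI)
    show "continuous_on UNIV (\<lambda>(t, x). (\<lambda>t x. c * \<phi>1 (x + c * t)) t x)" using comp[OF c1, of c] by simp
    show "continuous_on UNIV (\<lambda>(t, x). (\<lambda>t x. \<phi>1 (x + c * t)) t x)" using comp[OF c1, of 1] by simp
    show "continuous_on UNIV (\<lambda>(t, x). (\<lambda>t x. \<phi>2 (x + c * t)) t x)" using comp[OF c2, of 1] by simp
    fix t x
    show "((\<lambda>r. \<phi> (x + c * r)) has_real_derivative c * \<phi>1 (x + c * t)) (at t)" by (rule dt)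
    show "((\<lambda>y. \<phi> (y + c * t)) has_real_derivative \<phi>1 (x + c * t)) (at x)" by (rule dx[OF d(1)])
    show "((\<lambda>y. \<phi>1 (y + c * t)) has_real_derivative \<phi>2 (x + c * t)) (at x)"
      by (rule dx) (simp add: \<phi>2_def d)
    show "integrable lebesgue (\<lambda>y. K (x - y) * g (\<phi> (y + c * (t - h))))" by (rule delay_term(1)[OF p(1)])
    show "c * \<phi>1 (x + c * t) = \<phi>2 (x + c * t) - \<phi> (x + c * t) + (\<integral>y. K (x - y) * g (\<phi> (y + c * (t - h))) \<partial>lebesgue)"
      unfolding delay_term(2)[OF p(1)] by (simp add: \<phi>2_def)
  qed
  moreover have "norm (\<phi> t) \<le> B" for t using p(2)[of t] p(6)[of t] by simp
  then have "bounded (range \<phi>)" unfolding bounded_iff by blast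
  ultimately show ?thesis using p(2) lim by (auto simp: semi_wavefront_def)
qed

text \<open>At \<open>t = 0\<close> the chain rule identifies the time derivative with
  \<open>c\<close> times the space derivative, which leaves the profile equation; boundedness then
  yields its convolution form.\<close>

lemma semi_wavefront_profile:
  assumes "semi_wavefront h K g c \<phi>"
  shows "profile \<phi>"
proof -
  from assms obtain ut ux uxx where u:
      "\<And>t x. ((\<lambda>r. \<phi> (x + c * r)) has_real_derivative ut t x) (at t)"
      "\<And>t x. ((\<lambda>y. \<phi> (y + c * t)) has_real_derivative ux t x) (at x)"
      "\<And>t x. ((\<lambda>y. ux t y) has_real_derivative uxx t x) (at x)"
      "\<And>t x. ut t x = uxx t x - \<phi> (x + c * t) + (\<integral>y. K (x - y) * g (\<phi> (y + c * (t - h))) \<partial>lebesgue)"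
    unfolding semi_wavefront_def classical_solution_def by blast
  have pos: "\<And>t. 0 < \<phi> t" and "bounded (range \<phi>)" using assms unfolding semi_wavefront_def by blast+
  then obtain C where C: "\<And>t. \<bar>\<phi> t\<bar> \<le> C" unfolding bounded_iff by auto
  have d1: "(\<phi> has_real_derivative ux 0 x) (at x)" for x
  proof -
    have "((\<lambda>y. \<phi> (y + c * 0)) has_real_derivative ux 0 x) (at x)" by (rule u(2))
    then show ?thesis by simp
  qed
  have cont: "continuous_on UNIV \<phi>"
    using d1 by (intro continuous_at_imp_continuous_on ballI) (rule DERIV_isCont)
  have m: "\<phi> \<in> borel_measurable borel" using cont by (rule borel_measurable_continuous_onI)
  have "ut 0 x = c * ux 0 x" for x
  proof (rule DERIV_unique)
    show "((\<lambda>r. \<phi> (x + c * r)) has_real_derivative ut 0 x) (at 0)" by (rule u(1))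
    have "((\<lambda>r. x + c * r) has_real_derivative c) (at 0)" by (auto intro!: derivative_eq_intros)
    from DERIV_chain'[OF this d1] show "((\<lambda>r. \<phi> (x + c * r)) has_real_derivative c * ux 0 x) (at 0)"
      by (simp add: mult.commute)
  qed
  then have "uxx 0 x = c * ux 0 x + 1 * \<phi> x - act \<phi> x" for x
    using u(4)[of 0 x] delay_term(2)[OF m, of x 0] by simp
  then have d2: "((\<lambda>y. ux 0 y) has_real_derivative c * ux 0 x + 1 * \<phi> x - act \<phi> x) (at x)" for x
    using u(3)[of 0 x] by simp
  have ab: "\<bar>act \<phi> t\<bar> \<le> B" for t using act_bounds[OF m, of t] by simp
  have "\<phi> t = resolv c 1 (act \<phi>) t" for t
    by (rule resolv_unique[OF zero_less_one act_continuous[OF cont] ab d1 d2 C])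
  then show ?thesis using m pos by (simp add: profile_def)
qed

end

theorem theorem5:
  fixes h :: real and K g :: "real \<Rightarrow> real" and sM \<kappa> g0' \<zeta>1 \<zeta>2 \<epsilon> :: real
  assumes "0 \<le> h"
    and "\<And>s. 0 \<le> K s"
    and "\<And>l::real. integrable lebesgue (\<lambda>s. K s * exp (l * s))"
    and "(\<integral>s. K s \<partial>lebesgue) = 1"
    and "continuous_on {0..} g"
    and "\<And>s. 0 \<le> s \<Longrightarrow> 0 \<le> g s"
    and "{s. 0 < s \<and> (local_max_at g s \<or> local_min_at g s)} = {sM}"
    and "local_max_at g sM"
    and "g 0 = 0"
    and "\<And>s. 0 < s \<Longrightarrow> 0 < g s"
    and "0 < \<kappa>"
    and "{s. 0 \<le> s \<and> g s = s} = {0, \<kappa>}"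
    and "(g has_real_derivative g0') (at 0 within {0..})"
    and "1 < g0'"
    and "0 < \<zeta>1" and "\<zeta>1 < \<zeta>2"
    and "g ` {\<zeta>1..\<zeta>2} \<subseteq> {\<zeta>1..\<zeta>2}"
    and "g ` {0..\<zeta>1} \<subseteq> {0..\<zeta>2}"
    and "\<And>s. s \<in> {\<zeta>1..\<zeta>2} \<Longrightarrow> g \<zeta>1 \<le> g s"
    and "\<And>s. s \<in> {0<..\<zeta>1} \<Longrightarrow> s < g s"
    and "Ck_on 3 {\<zeta>1..\<zeta>2} g"
    and "\<And>s. s \<in> {\<zeta>1..\<zeta>2} - {sM} \<Longrightarrow>
           deriv_on {\<zeta>1..\<zeta>2} g s \<noteq> 0 \<and> schwarzian_on {\<zeta>1..\<zeta>2} g s < 0"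
    and "\<kappa> \<le> g (g \<zeta>2)"
    and "0 < \<epsilon>"
    and "(1 - min (exp (- h)) (LINT u:{- h / sqrt \<epsilon>..0}|lebesgue. K u))
           * deriv_on {\<zeta>1..\<zeta>2} g \<kappa> \<ge> - 1"
  shows "\<forall>c \<ge> max (c_star K h g) (1 / sqrt \<epsilon>).
           (\<exists>\<phi>. wavefront h K g \<kappa> c \<phi>) \<and>
           (\<forall>\<phi>. semi_wavefront h K g c \<phi> \<longrightarrow> wavefront h K g \<kappa> c \<phi>)"
proof (intro allI impI)
  fix c assume c: "max (c_star K h g) (1 / sqrt \<epsilon>) \<le> c"
  interpret kernel K using assms(2-4) by unfold_locales
  define p where "p = (SUP s\<in>{0<..}. g s / s)"
  define B where "B = g sM"
  define \<xi> where "\<xi> = min (exp (- h)) (LINT u:{- h / sqrt \<epsilon>..0}|lebesgue. K u)"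
  \<comment> \<open>The extension by \<open>g 0 = 0\<close> to negative arguments; the values of the
    given function there are arbitrary.\<close>
  define gg where "gg s = g (max 0 s)" for s
  define S where "S = {\<zeta>1..\<zeta>2}"
  have "0 < 1 / sqrt \<epsilon>" using \<open>0 < \<epsilon>\<close> by simp
  then have c0: "0 < c" using c by linarith
  have mono: "0 < sM" "\<And>a b. 0 \<le> a \<Longrightarrow> a \<le> b \<Longrightarrow> b \<le> sM \<Longrightarrow> g a \<le> g b" "\<And>a b. sM \<le> a \<Longrightarrow> a \<le> b \<Longrightarrow> g b \<le> g a"
    by (rule single_extremum_monotone[OF assms(5,7-9)]; blast intro: assms(10))+
  have B: "g s \<le> B" if "0 \<le> s" for s
    using mono(2)[of s sM] mono(3)[of sM s] that mono(1) unfolding B_def by (cases "s \<le> sM") auto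
  have B0: "0 < B" unfolding B_def by (rule assms(10)[OF mono(1)])
  have ratio: "((\<lambda>s. g s / s) \<longlongrightarrow> g0') (at_right 0)" "g0' \<le> p" "\<And>s. 0 \<le> s \<Longrightarrow> g s \<le> p * s"
    unfolding p_def by (rule ratio_bounds[OF assms(13,9) _ less_imp_le[OF B0]]; blast intro: B)+
  have sides: "\<And>s. 0 < s \<Longrightarrow> s < \<kappa> \<Longrightarrow> s < g s" "\<And>s. \<kappa> < s \<Longrightarrow> g s < s"
    by (rule fixed_point_sides[OF assms(5,12,11) ratio(1) assms(14)]; blast intro: B)+
  have fixp: "g \<kappa> = \<kappa>" using assms(12) by blast
  have p1: "1 < p" using ratio(2) assms(14) by simp
  obtain w where w: "0 < w" "w\<^sup>2 - c * w - 1 + p * J (c * h) 1 w \<le> 0"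
    by (rule nonpos_at_supercritical_speed[OF assms(1) p1 c0])
       (use c in \<open>auto simp: c_star_def Let_def p_def[symmetric]\<close>)
  interpret kernel_profile_equation K h c gg B p g0' w
  proof (intro kernel_profile_equation.intro kernel_axioms profile_equation.intro prob_space_law profile_equation_axioms.intro)
    show "continuous_on UNIV gg"
      unfolding gg_def by (intro continuous_on_compose2[OF assms(5)] continuous_intros) auto
    show "0 < z\<^sup>2 - c * z - 1 + g0' * (\<integral>r. exp (z * r) \<partial>law (c * h))" if "z \<le> 0" for z
      unfolding law_exp(2) by (rule char_positive_on_nonpos[OF assms(14) ratio(2) w that])
    show "w\<^sup>2 - c * w - 1 + p * (\<integral>r. exp (w * r) \<partial>law (c * h)) \<le> 0"
      unfolding law_exp(2) by (rule w(2))
    show "((\<lambda>s. gg s / s) \<longlongrightarrow> g0') (at_right 0)"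
    proof (rule Lim_transform_eventually[OF ratio(1)])
      show "\<forall>\<^sub>F s in at_right 0. g s / s = gg s / s"
        using eventually_at_right_less[of 0] by eventually_elim (simp add: gg_def)
    qed
  qed (use c0 w sets_law law_exp(1) assms(6,10) B ratio(3) in \<open>auto simp: gg_def\<close>)
  have gg_pos: "gg s = g s" if "0 \<le> s" for s using that by (simp add: gg_def)
  have \<zeta>\<kappa>: "\<zeta>1 < \<kappa>" using assms(20)[of \<kappa>] fixp \<open>0 < \<kappa>\<close> by (cases "\<kappa> \<le> \<zeta>1") auto
  have \<kappa>\<zeta>: "\<kappa> \<le> \<zeta>2"
  proof (rule ccontr)
    assume "\<not> \<kappa> \<le> \<zeta>2"
    then have "\<zeta>2 < g \<zeta>2" using assms(15,16) by (intro sides(1)) auto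
    moreover have "g \<zeta>2 \<le> \<zeta>2" using assms(16,17) by (auto simp: image_subset_iff)
    ultimately show False by simp
  qed
  have \<zeta>2: "g s \<le> \<zeta>2" if "0 \<le> s" "s \<le> \<zeta>2" for s
    using assms(17,18) that by (cases "s \<le> \<zeta>1") (auto simp: image_subset_iff)
  have smooth: "((deriv_on S ^^ j) g has_real_derivative (deriv_on S ^^ Suc j) g t) (at t)"
    if "t \<in> {\<zeta>1<..<\<zeta>2}" "j < 3" for t j
  proof -
    have "((deriv_on S ^^ j) g has_real_derivative (deriv_on S ^^ Suc j) g t) (at t within S)"
      using assms(21) that unfolding Ck_on_def S_def by auto
    then show ?thesis using that by (simp add: S_def at_within_Icc_at)
  qed
  have d1: "(g has_real_derivative deriv_on S g t) (at t)" if "t \<in> {\<zeta>1<..<\<zeta>2}" for t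
    using smooth[OF that, of 0] by simp
  have d2: "(deriv_on S g has_real_derivative (deriv_on S ^^ 2) g t) (at t)" if "t \<in> {\<zeta>1<..<\<zeta>2}" for t
    using smooth[OF that, of 1] by (simp add: numeral_2_eq_2)
  have d3: "((deriv_on S ^^ 2) g has_real_derivative (deriv_on S ^^ 3) g t) (at t)" if "t \<in> {\<zeta>1<..<\<zeta>2}" for t
    using smooth[OF that, of 2] by (simp add: numeral_3_eq_3 numeral_2_eq_2)
  have cycle: False
    if xy: "sM < \<kappa>" "sM \<le> x" "\<zeta>1 \<le> x" "x < \<kappa>" "\<kappa> < y" "y \<le> \<zeta>2"
      and cyc: "y \<le> (1 - \<xi>) * gg x + \<xi> * \<kappa>" "(1 - \<xi>) * gg y + \<xi> * \<kappa> \<le> x" for x y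
  proof (rule no_two_cycle[where g=g and ?g1.0="deriv_on S g" and ?g2.0="(deriv_on S ^^ 2) g" and ?g3.0="(deriv_on S ^^ 3) g" and \<kappa>=\<kappa> and x=x and y=y and \<xi>=\<xi>])
    show "continuous_on {x..y} g" using xy assms(15) by (intro continuous_on_subset[OF assms(5)]) auto
    fix t assume t: "t \<in> {x<..<y}"
    then have t\<zeta>: "t \<in> {\<zeta>1<..<\<zeta>2}" and ts: "t \<in> S - {sM}" using xy by (auto simp: S_def)
    show "(g has_real_derivative deriv_on S g t) (at t)"
      "(deriv_on S g has_real_derivative (deriv_on S ^^ 2) g t) (at t)"
      "((deriv_on S ^^ 2) g has_real_derivative (deriv_on S ^^ 3) g t) (at t)"
      using d1 d2 d3 t\<zeta> by blast+
    show "(deriv_on S ^^ 3) g t / deriv_on S g t - 3 / 2 * ((deriv_on S ^^ 2) g t / deriv_on S g t)\<^sup>2 < 0"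
      using assms(22)[of t] ts unfolding schwarzian_on_def S_def by blast
    \<comment> \<open>Monotonicity right of the peak excludes a positive derivative, and the
      hypothesis accompanying the Schwarzian derivative excludes a zero one.\<close>
    show "deriv_on S g t < 0"
    proof (rule ccontr)
      assume "\<not> deriv_on S g t < 0"
      moreover have "deriv_on S g t \<noteq> 0" using assms(22)[of t] ts unfolding S_def by blast
      ultimately have "0 < deriv_on S g t" by simp
      from DERIV_pos_inc_right[OF d1[OF t\<zeta>] this] obtain d where d: "0 < d" "\<And>r. 0 < r \<Longrightarrow> r < d \<Longrightarrow> g t < g (t + r)" by blast
      have "g (t + d / 2) \<le> g t" using t xy d(1) by (intro mono(3)) auto
      then show False using d(2)[of "d / 2"] d(1) by simp
    qed
  next
    show "- 1 \<le> (1 - \<xi>) * deriv_on S g \<kappa>" using assms(25) by (simp add: \<xi>_def S_def)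
    show "\<xi> \<le> 1" using assms(1) by (simp add: \<xi>_def min_le_iff_disj)
    have "0 \<le> x" "0 \<le> y" using xy assms(15) by auto
    then show "y \<le> (1 - \<xi>) * g x + \<xi> * \<kappa>" "(1 - \<xi>) * g y + \<xi> * \<kappa> \<le> x" using cyc by (simp_all add: gg_pos)
  qed (use xy fixp in auto)
  have \<xi>h: "\<xi> \<le> exp (- h)" by (simp add: \<xi>_def)
  have \<xi>P: "\<xi> \<le> prob {- (c * h)..0}"
  proof -
    \<comment> \<open>The smallest admissible speed has the shortest delay window, so a condition
      stated for \<epsilon> covers all larger speeds.\<close>
    have "1 / sqrt \<epsilon> * h \<le> c * h" using c assms(1) by (intro mult_right_mono) auto
    then have "(LINT u:{- (h / sqrt \<epsilon>)..0}|lebesgue. K u) \<le> prob {- (c * h)..0}"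
      using assms(1,24) by (intro law_interval_ge(1)) auto
    then show ?thesis by (simp add: \<xi>_def min_le_iff_disj)
  qed
  have conv: "(\<phi> \<longlongrightarrow> \<kappa>) at_top" if "profile \<phi>" for \<phi>
  proof (rule profile_converges[OF that assms(1) \<xi>h \<xi>P])
    fix m M
    assume mM: "0 < m" "m \<le> M"
      and est: "\<And>\<Gamma>. (\<And>s. s \<in> {m..M} \<Longrightarrow> gg s \<le> \<Gamma>) \<Longrightarrow> M \<le> \<Gamma>"
        "\<And>\<Gamma>. (\<And>s. s \<in> {m..M} \<Longrightarrow> \<Gamma> \<le> gg s) \<Longrightarrow> \<Gamma> \<le> m"
        "\<And>\<Gamma>. \<kappa> \<le> \<Gamma> \<Longrightarrow> (\<And>s. s \<in> {m..M} \<Longrightarrow> gg s \<le> \<Gamma>) \<Longrightarrow> (\<And>s. \<kappa> \<le> s \<Longrightarrow> s \<le> M \<Longrightarrow> gg s \<le> \<kappa>) \<Longrightarrow> M \<le> (1 - \<xi>) * \<Gamma> + \<xi> * \<kappa>"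
        "\<And>\<Gamma>. \<Gamma> \<le> \<kappa> \<Longrightarrow> (\<And>s. s \<in> {m..M} \<Longrightarrow> \<Gamma> \<le> gg s) \<Longrightarrow> (\<And>s. m \<le> s \<Longrightarrow> s \<le> \<kappa> \<Longrightarrow> \<kappa> \<le> gg s) \<Longrightarrow> (1 - \<xi>) * \<Gamma> + \<xi> * \<kappa> \<le> m"
    show "m = \<kappa> \<and> M = \<kappa>"
    proof (rule interval_collapse[where g=gg and sM=sM and ?\<zeta>1.0=\<zeta>1 and ?\<zeta>2.0=\<zeta>2, OF _ _ _ _ _ _ assms(15) \<zeta>\<kappa> \<kappa>\<zeta> _ _ _ mM est cycle])
      show "continuous_on {m..M} gg" by (rule continuous_on_subset[OF g_cont]) simp
      show "gg a \<le> gg b" if "0 \<le> a" "a \<le> b" "b \<le> sM" for a b using mono(2)[OF that] that by (simp add: gg_pos)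
      show "gg b \<le> gg a" if "sM \<le> a" "a \<le> b" for a b using mono(3)[OF that] that mono(1) by (simp add: gg_pos)
      show "s < gg s" if "0 < s" "s < \<kappa>" for s using sides(1)[OF that] that by (simp add: gg_pos)
      show "gg s < s" if "\<kappa> < s" for s using sides(2)[OF that] that assms(11) by (simp add: gg_pos)
      show "gg \<kappa> = \<kappa>" using fixp assms(11) by (simp add: gg_pos)
      show "gg s \<le> \<zeta>2" if "0 \<le> s" "s \<le> \<zeta>2" for s using \<zeta>2[OF that] that by (simp add: gg_pos)
      show "gg \<zeta>1 \<le> gg s" if "\<zeta>1 \<le> s" "s \<le> \<zeta>2" for s using assms(15,19) that by (simp add: gg_pos)
      show "\<kappa> \<le> gg (gg \<zeta>2)" using assms(6,15,16,23) by (simp add: gg_pos)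
    qed
  qed
  \<comment> \<open>A semi-wavefront is positive, so the equation never sees the extension.\<close>
  have same: "semi_wavefront h K gg c \<phi> \<longleftrightarrow> semi_wavefront h K g c \<phi>" for \<phi>
  proof (cases "\<forall>s. 0 < \<phi> s")
    case True
    then have "gg (\<phi> s) = g (\<phi> s)" for s by (simp add: gg_pos less_imp_le)
    then show ?thesis by (simp add: semi_wavefront_def classical_solution_def)
  qed (auto simp: semi_wavefront_def)
  show "(\<exists>\<phi>. wavefront h K g \<kappa> c \<phi>) \<and> (\<forall>\<phi>. semi_wavefront h K g c \<phi> \<longrightarrow> wavefront h K g \<kappa> c \<phi>)"
  proof (intro conjI allI impI)
    obtain \<phi> where \<phi>: "\<phi> \<in> borel_measurable borel" "\<And>t. 0 < \<phi> t" "\<And>t. \<phi> t = resolv c 1 (act \<phi>) t" "(\<phi> \<longlongrightarrow> 0) at_bot"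
      by (rule semi_wavefront_profile_exists) blast
    then have pr: "profile \<phi>" by (simp add: profile_def)
    then have "wavefront h K g \<kappa> c \<phi>"
      using profile_semi_wavefront[OF pr \<phi>(4)] conv[OF pr] by (simp add: wavefront_def same)
    then show "\<exists>\<phi>. wavefront h K g \<kappa> c \<phi>" by blast
  next
    fix \<phi> assume s: "semi_wavefront h K g c \<phi>"
    then have "profile \<phi>" using semi_wavefront_profile same by blast
    then show "wavefront h K g \<kappa> c \<phi>" using s conv by (simp add: wavefront_def)
  qed
qed

end
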